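(* Let $F=F(x_1,\dots,x_r)\in\mathbb{C}[x_1,\ldots,x_r]$ be a smooth form of degree $d\ge 3$ with $r\ge 3$, and let $G$ be a subgroup of $\mathrm{Aut}(F)$ with decomposition data $V_i,W_{ij},k_i,r_{ij},H_{ij},m$ (as in the context), the underlying basis of $\mathbb{C}^r$ being compatible with $\mathbb{C}^r=\bigoplus_{i,j}W_{ij}$. Suppose $m\ge 2$ and let $V_1':=\bigoplus_{i\ne 2}V_i$. If there is a monomial $\mathfrak{m}\in S^{d-1}(V_1'^* )\otimes S^1(V_2^* )$ in $F$, then $$|G|\le\frac{B(G,F)}{|H_{21}|^{k_2}}\le\frac{R(l(G),d)\cdot d^r\cdot r!}{\mathrm{JC}(r_{21})^{k_2}}.$$
   Context: A form $F\in\mathbb{C}[x_1,\dots,x_r]$ is smooth if the origin is the only common zero of its first partial derivatives. $\mathrm{Aut}(F)=\{A\in\mathrm{GL}(r,\mathbb{C})\mid A(F)=F\}$ where $A(F)=F(\sum_i a_{1i}x_i,\ldots,\sum_i a_{ri}x_i)$; it is finite. A monomial is "in $F$" if its coefficient in $F$ is non-zero. A finite group acting irreducibly on a complex vector space $W$ acts primitively if $W$ cannot be decomposed as a direct sum of proper subspaces permuted by the group. A finite subgroup of $\mathrm{PGL}(k,\mathbb{C})$ is primitive if it is the image of a finite primitive subgroup of $\mathrm{GL}(k,\mathbb{C})$. $\mathrm{JC}(k)$ is the maximum order of a finite primitive subgroup of $\mathrm{PGL}(k,\mathbb{C})$. (By Collins: $\mathrm{JC}(k)=(k+1)!$ for $k=10,11$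 and $k\ge 13$, and $\mathrm{JC}(k)=1,60,360,25920,25920,6531840,1451520,348364800,4199040,448345497600$ for $k=1,2,3,4,5,6,7,8,9,12$.) Decomposition data of a finite subgroup $G\subset\mathrm{GL}(r,\mathbb{C})$ (one choice fixed): $\mathbb{C}^r=V_1\oplus\cdots\oplus V_m$ with $V_i$ irreducible $G$-stable; $V_i=W_{i1}\oplus\cdots\oplus W_{ik_i}$ with subspaces permuted transitively by $G$ and $\mathrm{Stab}_G(W_{ij})=\{g\in G\mid g(W_{ij})=W_{ij}\}$ acting primitively on $W_{ij}$; $r_{ij}=\dim W_{ij}$; $s=\sum_i k_i$; $H_{ij}\subset\mathrm{PGL}(W_{ij})$ is the image of $\mathrm{Stab}_G(W_{ij})$. The subdegree sequence $l(G)$ is the tuple of all $r_{ij}$ arranged in non-increasing order. The basis is compatible with the decomposition if it is a union of bases of the $W_{ij}$ (in order), so each coordinate $x_k$ lies in one $W_{ij}^*$ (the dual basis is used on the dual space). Canonical bound: $B(G,F)=d^s\cdot\prod_{i,j}|H_{ij}|\cdot\prod_{i=1}^m k_i!$. Fermat-test ratio: for a non-increasing tuple $l=(r_1',\ldots,r_s')$ of positive integers with sum $r$ whose distinct values occur with multiplicities $a_1,\dots,a_t$, $R(l,d)=\dfrac{d^s\prod_{i=1}^s\mathrm{JC}(r_i')\prod_{j=1}^t a_j!}{d^r\cdot r!}$. *)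

theory Defs
  imports
    Complex_Main
    "HOL-Library.FuncSet"
    "HOL-Library.Poly_Mapping"
    "HOL-Algebra.Coset"
    "HOL-Algebra.Bij"
    "Jordan_Normal_Form.Matrix"
    "Jordan_Normal_Form.VS_Connect"
begin

text \<open>
  Complex polynomials are finitely supported functions from monomials (exponent vectors) to
  coefficients, so that \<open>Poly_Mapping.keys F\<close> is the set of monomials in \<open>F\<close>. The coordinates
  of the \<open>r\<close>-dimensional space \<open>carrier_vec r\<close> are numbered \<open>0, \<dots>, r - 1\<close>; the summands of a
  decomposition are numbered from 1.
\<close>

type_synonym cpoly = "(nat \<Rightarrow>\<^sub>0 nat) \<Rightarrow>\<^sub>0 complex"


subsection \<open>Smooth forms and their automorphisms\<close>

definition is_form :: "nat \<Rightarrow> nat \<Rightarrow> cpoly \<Rightarrow> bool" where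
  "is_form r d F \<longleftrightarrow> (\<forall>\<mu>\<in>Poly_Mapping.keys F.
     Poly_Mapping.keys \<mu> \<subseteq> {..<r} \<and> (\<Sum>k<r. Poly_Mapping.lookup \<mu> k) = d)"

text \<open>Evaluation in an algebra over the complex numbers with structure map \<open>c\<close>.\<close>

definition insertion :: "(complex \<Rightarrow> 'a::comm_semiring_1) \<Rightarrow> (nat \<Rightarrow> 'a) \<Rightarrow> cpoly \<Rightarrow> 'a" where
  "insertion c p F =
     (\<Sum>\<mu>\<in>Poly_Mapping.keys F. c (Poly_Mapping.lookup F \<mu>) *
        (\<Prod>k\<in>Poly_Mapping.keys \<mu>. p k ^ Poly_Mapping.lookup \<mu> k))"

definition eval_at :: "complex vec \<Rightarrow> cpoly \<Rightarrow> complex" where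
  "eval_at v F = insertion (\<lambda>c. c) (\<lambda>k. v $ k) F"

text \<open>The subtraction of exponents is truncated, but it only truncates where the coefficient
  \<open>Poly_Mapping.lookup \<mu> k\<close> vanishes.\<close>

definition partial :: "nat \<Rightarrow> cpoly \<Rightarrow> cpoly" where
  "partial k F = (\<Sum>\<mu>\<in>Poly_Mapping.keys F.
     Poly_Mapping.single (\<mu> - Poly_Mapping.single k 1)
       (of_nat (Poly_Mapping.lookup \<mu> k) * Poly_Mapping.lookup F \<mu>))"

definition smooth :: "nat \<Rightarrow> cpoly \<Rightarrow> bool" where
  "smooth r F \<longleftrightarrow> {v \<in> carrier_vec r. \<forall>k<r. eval_at v (partial k F) = 0} = {0\<^sub>v r}"

definition GL :: "nat \<Rightarrow> complex mat monoid" where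
  "GL n = units_of (ring_mat TYPE(complex) n ())"

definition poly_var :: "nat \<Rightarrow> cpoly" where
  "poly_var i = Poly_Mapping.single (Poly_Mapping.single i 1) 1"

definition poly_const :: "complex \<Rightarrow> cpoly" where
  "poly_const c = Poly_Mapping.single 0 c"

text \<open>The form \<open>A(F)\<close>: the variable \<open>x\<^sub>k\<close> is replaced by \<open>\<Sum>\<^sub>i a\<^sub>k\<^sub>i x\<^sub>i\<close>.\<close>

definition mat_subst :: "nat \<Rightarrow> complex mat \<Rightarrow> cpoly \<Rightarrow> cpoly" where
  "mat_subst r A F = insertion poly_const (\<lambda>k. \<Sum>i<r. poly_const (A $$ (k, i)) * poly_var i) F"

definition Aut :: "nat \<Rightarrow> cpoly \<Rightarrow> complex mat set" where
  "Aut r F = {A \<in> carrier (GL r). mat_subst r A F = F}"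


subsection \<open>Linear algebra in \<open>carrier_vec n\<close>\<close>

abbreviation is_subspace :: "nat \<Rightarrow> complex vec set \<Rightarrow> bool" where
  "is_subspace n W \<equiv> VectorSpace.subspace class_ring W (module_vec TYPE(complex) n)"

abbreviation subspace_vs :: "nat \<Rightarrow> complex vec set \<Rightarrow> (complex, complex vec) module" where
  "subspace_vs n W \<equiv> (module_vec TYPE(complex) n)\<lparr>carrier := W\<rparr>"

abbreviation sdim :: "nat \<Rightarrow> complex vec set \<Rightarrow> nat" where
  "sdim n W \<equiv> vectorspace.dim class_ring (subspace_vs n W)"

abbreviation vspan :: "nat \<Rightarrow> complex vec set \<Rightarrow> complex vec set" where
  "vspan n S \<equiv> LinearCombinations.module.span class_ring (module_vec TYPE(complex) n) S"

definition family_sum :: "nat \<Rightarrow> 'i set \<Rightarrow> ('i \<Rightarrow> complex vec set) \<Rightarrow> complex vec set" where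
  "family_sum n I U = (\<lambda>u. finsum_vec TYPE(complex) n u I) ` (\<Pi>\<^sub>E i\<in>I. U i)"

text \<open>\<open>W\<close> is the internal direct sum of the \<open>U i\<close>: every vector of \<open>W\<close> is the sum of a unique
  family of vectors of the \<open>U i\<close>.\<close>

definition is_direct_sum ::
  "nat \<Rightarrow> complex vec set \<Rightarrow> 'i set \<Rightarrow> ('i \<Rightarrow> complex vec set) \<Rightarrow> bool" where
  "is_direct_sum n W I U \<longleftrightarrow>
     finite I \<and> is_subspace n W \<and> (\<forall>i\<in>I. is_subspace n (U i)) \<and>
     bij_betw (\<lambda>u. finsum_vec TYPE(complex) n u I) (\<Pi>\<^sub>E i\<in>I. U i) W"

definition translate :: "complex mat \<Rightarrow> complex vec set \<Rightarrow> complex vec set" where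
  "translate g W = (\<lambda>v. g *\<^sub>v v) ` W"

definition stabilizer :: "complex mat set \<Rightarrow> complex vec set \<Rightarrow> complex mat set" where
  "stabilizer G W = {g \<in> G. translate g W = W}"


subsection \<open>Irreducible and primitive actions\<close>

text \<open>In both definitions \<open>S\<close> is meant to be a group of matrices that stabilizes \<open>W\<close>.\<close>

definition acts_irreducibly :: "nat \<Rightarrow> complex mat set \<Rightarrow> complex vec set \<Rightarrow> bool" where
  "acts_irreducibly n S W \<longleftrightarrow>
     is_subspace n W \<and> W \<noteq> {0\<^sub>v n} \<and> (\<forall>g\<in>S. translate g W = W) \<and>
     (\<forall>U. is_subspace n U \<and> U \<subseteq> W \<and> (\<forall>g\<in>S. translate g U = U) \<longrightarrow> U = {0\<^sub>v n} \<or> U = W)"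

definition acts_primitively :: "nat \<Rightarrow> complex mat set \<Rightarrow> complex vec set \<Rightarrow> bool" where
  "acts_primitively n S W \<longleftrightarrow>
     acts_irreducibly n S W \<and>
     \<not> (\<exists>P. is_direct_sum n W P (\<lambda>U. U) \<and> (\<forall>U\<in>P. U \<subset> W) \<and>
           (\<forall>g\<in>S. \<forall>U\<in>P. translate g U \<in> P))"


subsection \<open>Projective linear groups and \<open>JC\<close>\<close>

definition GL_space :: "nat \<Rightarrow> complex vec set \<Rightarrow> (complex vec \<Rightarrow> complex vec) monoid" where
  "GL_space n W = (BijGroup W)
     \<lparr>carrier := {f \<in> Bij W.
        f \<in> LinearCombinations.module_hom class_ring (subspace_vs n W) (subspace_vs n W)}\<rparr>"

definition scalars :: "complex vec set \<Rightarrow> (complex vec \<Rightarrow> complex vec) set" where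
  "scalars W = {(\<lambda>v\<in>W. c \<cdot>\<^sub>v v) | c. c \<noteq> 0}"

definition PGL_space :: "nat \<Rightarrow> complex vec set \<Rightarrow> (complex vec \<Rightarrow> complex vec) set monoid" where
  "PGL_space n W = GL_space n W Mod scalars W"

abbreviation PGL :: "nat \<Rightarrow> (complex vec \<Rightarrow> complex vec) set monoid" where
  "PGL k \<equiv> PGL_space k (carrier_vec k)"

definition proj_image ::
  "nat \<Rightarrow> complex mat set \<Rightarrow> complex vec set \<Rightarrow> (complex vec \<Rightarrow> complex vec) set set" where
  "proj_image n S W = (\<lambda>g. scalars W #>\<^bsub>GL_space n W\<^esub> (\<lambda>v\<in>W. g *\<^sub>v v)) ` S"

definition primitive_in_PGL :: "nat \<Rightarrow> (complex vec \<Rightarrow> complex vec) set set \<Rightarrow> bool" where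
  "primitive_in_PGL k H \<longleftrightarrow>
     subgroup H (PGL k) \<and> finite H \<and>
     (\<exists>\<Gamma>. subgroup \<Gamma> (GL k) \<and> finite \<Gamma> \<and> acts_primitively k \<Gamma> (carrier_vec k) \<and>
          H = proj_image k \<Gamma> (carrier_vec k))"

text \<open>For \<open>k \<ge> 1\<close> the set below is finite (Jordan) and non-empty, so its maximum exists.\<close>

definition JC :: "nat \<Rightarrow> nat" where
  "JC k = Max {card H | H. primitive_in_PGL k H}"


subsection \<open>Decomposition data\<close>

definition decomposition_data ::
  "nat \<Rightarrow> complex mat set \<Rightarrow> nat \<Rightarrow> (nat \<Rightarrow> complex vec set) \<Rightarrow> (nat \<Rightarrow> nat) \<Rightarrow>
   (nat \<Rightarrow> nat \<Rightarrow> complex vec set) \<Rightarrow> bool" where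
  "decomposition_data r G m V k W \<longleftrightarrow>
     is_direct_sum r (carrier_vec r) {1..m} V \<and>
     (\<forall>i\<in>{1..m}. acts_irreducibly r G (V i)) \<and>
     (\<forall>i\<in>{1..m}. is_direct_sum r (V i) {1..k i} (W i)) \<and>
     (\<forall>i\<in>{1..m}. \<forall>g\<in>G. \<forall>j\<in>{1..k i}. \<exists>j'\<in>{1..k i}. translate g (W i j) = W i j') \<and>
     (\<forall>i\<in>{1..m}. \<forall>j\<in>{1..k i}. \<forall>j'\<in>{1..k i}. \<exists>g\<in>G. translate g (W i j) = W i j') \<and>
     (\<forall>i\<in>{1..m}. \<forall>j\<in>{1..k i}. acts_primitively r (stabilizer G (W i j)) (W i j))"

text \<open>For a subspace \<open>U\<close> spanned by vectors of the standard basis, \<open>coords r U\<close> is the set of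
  indices of the coordinates that lie in \<open>U\<^sup>*\<close> (by means of the dual basis).\<close>

definition coords :: "nat \<Rightarrow> complex vec set \<Rightarrow> nat set" where
  "coords r U = {p. p < r \<and> unit_vec r p \<in> U}"

text \<open>The standard basis is a union of bases of the \<open>W i j\<close>, which appear in the lexicographic
  order of the pairs \<open>(i, j)\<close>.\<close>

definition compatible_basis ::
  "nat \<Rightarrow> nat \<Rightarrow> (nat \<Rightarrow> nat) \<Rightarrow> (nat \<Rightarrow> nat \<Rightarrow> complex vec set) \<Rightarrow> bool" where
  "compatible_basis r m k W \<longleftrightarrow>
     (\<forall>i\<in>{1..m}. \<forall>j\<in>{1..k i}. vspan r (unit_vec r ` coords r (W i j)) = W i j) \<and>
     (\<Union>i\<in>{1..m}. \<Union>j\<in>{1..k i}. coords r (W i j)) = {..<r} \<and>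
     (\<forall>i\<in>{1..m}. \<forall>j\<in>{1..k i}. \<forall>i'\<in>{1..m}. \<forall>j'\<in>{1..k i'}.
        \<forall>p\<in>coords r (W i j). \<forall>q\<in>coords r (W i' j'). p < q \<longrightarrow> i < i' \<or> i = i' \<and> j \<le> j')"

text \<open>The monomial \<open>\<mu>\<close> lies in \<open>S\<^sup>a(U\<^sup>*) \<otimes> S\<^sup>b(U'\<^sup>*)\<close>, for complementary subspaces
  \<open>U\<close>, \<open>U'\<close> spanned by vectors of the standard basis.\<close>

definition in_sym_tensor ::
  "nat \<Rightarrow> (nat \<Rightarrow>\<^sub>0 nat) \<Rightarrow> nat \<Rightarrow> complex vec set \<Rightarrow> nat \<Rightarrow> complex vec set \<Rightarrow> bool" where
  "in_sym_tensor r \<mu> a U b U' \<longleftrightarrow>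
     Poly_Mapping.keys \<mu> \<subseteq> coords r U \<union> coords r U' \<and>
     (\<Sum>p\<in>coords r U. Poly_Mapping.lookup \<mu> p) = a \<and>
     (\<Sum>p\<in>coords r U'. Poly_Mapping.lookup \<mu> p) = b"

definition H_group ::
  "nat \<Rightarrow> complex mat set \<Rightarrow> complex vec set \<Rightarrow> (complex vec \<Rightarrow> complex vec) set set" where
  "H_group r G W = proj_image r (stabilizer G W) W"

definition canonical_bound ::
  "nat \<Rightarrow> nat \<Rightarrow> complex mat set \<Rightarrow> nat \<Rightarrow> (nat \<Rightarrow> nat) \<Rightarrow>
   (nat \<Rightarrow> nat \<Rightarrow> complex vec set) \<Rightarrow> nat" where
  "canonical_bound r d G m k W =
     d ^ (\<Sum>i\<in>{1..m}. k i) * (\<Prod>i\<in>{1..m}. \<Prod>j\<in>{1..k i}. card (H_group r G (W i j))) *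
     (\<Prod>i\<in>{1..m}. fact (k i))"

definition subdegree_sequence ::
  "nat \<Rightarrow> nat \<Rightarrow> (nat \<Rightarrow> nat) \<Rightarrow> (nat \<Rightarrow> nat \<Rightarrow> complex vec set) \<Rightarrow> nat list" where
  "subdegree_sequence r m k W =
     rev (sort (concat (map (\<lambda>i. map (\<lambda>j. sdim r (W i j)) [1..<Suc (k i)]) [1..<Suc m])))"

definition fermat_ratio :: "nat list \<Rightarrow> nat \<Rightarrow> real" where
  "fermat_ratio l d =
     real (d ^ length l * prod_list (map JC l) * (\<Prod>a\<in>set l. fact (count_list l a))) /
     real (d ^ sum_list l * fact (sum_list l))"

end

theory Submission
  imports Defs "Jordan_Normal_Form.Determinant"
begin

text \<open>
  The elements of \<open>G\<close> that preserve all \<open>W i j\<close> have index at most \<open>\<Prod> k i!\<close>. Among them, those that are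
  scalar on every \<open>W i j\<close> with \<open>i \<noteq> 2\<close> form a normal subgroup \<open>N\<close> of index at most the product of the
  \<open>|H i j|\<close> with \<open>i \<noteq> 2\<close>. The given monomial makes the derivative of \<open>F\<close> at points of \<open>V\<^sub>1'\<close> in
  directions of \<open>V 2\<close> a nonzero invariant pairing; as \<open>V 2\<close> is irreducible, an element that is
  trivial on \<open>V\<^sub>1'\<close> is trivial on \<open>V 2\<close>. Hence \<open>N\<close> is commutative, and primitivity makes it scalar on the
  \<open>W 2 j\<close> too. Smoothness supplies a monomial \<open>x\<^sub>p ^ (d - 1) x\<^sub>q\<close> for every \<open>p\<close>, so the eigenvalues of
  \<open>g \<in> N\<close> solve a system of monomial equations, which has at most \<open>d\<^sup>s\<close> solutions.

  For the second inequality, \<open>JC\<close> has to be known to be a maximum. A finite primitive group is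
  conjugate to one with bounded entries, in which all elements near 1 are scalar; the pigeonhole
  principle then bounds its projective image.
\<close>

subsection \<open>Vectors, subspaces and direct sums\<close>

text \<open>The factors \<open>|H 2 j|\<close> drop out because \<open>V 2\<close> embeds
  equivariantly into the functions on \<open>V\<^sub>1'\<close>: \<open>y\<close> is sent to the
  derivative of \<open>F\<close> in direction \<open>y\<close>, and irreducibility leaves no kernel.
  An element of \<open>N\<close> need not be trivial on \<open>V\<^sub>1'\<close>, since its scalars
  vary from block to block; a commutator of two such elements is. Hence commutativity is the
  intermediate goal, and primitivity has to finish the argument. Finiteness is the recurring
  obstacle: \<open>card\<close> of an infinite set is 0 and \<open>Max\<close> of an infinite set is
  unspecified. Finiteness of \<open>G\<close> is derived from that of all \<open>H i j\<close>; if
  \<open>G\<close> is infinite, some \<open>H i j\<close> is infinite, the canonical bound is 0 by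
  convention, and the claim reads 0 \<le> 0 \<le> R. For \<open>JC\<close> a bound uniform over all
  primitive groups of one degree is needed, however crude. Jordan's argument is short for primitive
  groups, because there commuting conjugates are already scalar. The condition d \<ge> 3 makes d - 1
  > 1, so that the exponents of the eigenvalue system define an injective linear map, whichever
  block \<open>x\<^sub>q\<close> lies in.\<close>

abbreviation "vsum n \<equiv> finsum_vec TYPE(complex) n"

lemma is_subspace_iff:
  "is_subspace n W \<longleftrightarrow> W \<subseteq> carrier_vec n \<and> 0\<^sub>v n \<in> W \<and> (\<forall>u\<in>W. \<forall>v\<in>W. u + v \<in> W) \<and>
     (\<forall>c. \<forall>v\<in>W. c \<cdot>\<^sub>v v \<in> W)"
  using vec_vs[of n, where 'a = complex] vec_module[of n, where 'a = complex]
  unfolding VectorSpace.subspace_def submodule_def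
  by (auto simp: module_vec_simps class_ring_simps)

lemma
  assumes "is_subspace n W"
  shows subspace_carrier: "v \<in> W \<Longrightarrow> v \<in> carrier_vec n"
    and subspace_zero: "0\<^sub>v n \<in> W"
    and subspace_add: "u \<in> W \<Longrightarrow> v \<in> W \<Longrightarrow> u + v \<in> W"
    and subspace_smult: "v \<in> W \<Longrightarrow> c \<cdot>\<^sub>v v \<in> W"
  using assms unfolding is_subspace_iff by auto

lemma vsum_index:
  assumes "finite I" "\<And>i. i \<in> I \<Longrightarrow> u i \<in> carrier_vec n" "p < n"
  shows "vsum n u I $ p = (\<Sum>i\<in>I. u i $ p)"
  using assms by (intro index_finsum_vec) auto

lemma vsum_closed:
  assumes "\<And>i. i \<in> I \<Longrightarrow> u i \<in> carrier_vec n"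
  shows "vsum n u I \<in> carrier_vec n"
  using assms by (intro finsum_vec_closed) auto

lemma vsum_cong:
  assumes "finite I" "\<And>i. i \<in> I \<Longrightarrow> u i = v i" "\<And>i. i \<in> I \<Longrightarrow> v i \<in> carrier_vec n"
  shows "vsum n u I = vsum n v I"
  using assms vsum_closed[of I u n] vsum_closed[of I v n]
  by (intro eq_vecI) (auto simp: vsum_index)

lemma vsum_restrict:
  assumes "finite I" "\<And>i. i \<in> I \<Longrightarrow> u i \<in> carrier_vec n"
  shows "vsum n (restrict u I) I = vsum n u I"
  using assms by (intro vsum_cong) auto

lemma vsum_in_subspace:
  assumes "is_subspace n W" "finite I" "\<And>i. i \<in> I \<Longrightarrow> u i \<in> W"
  shows "vsum n u I \<in> W"
  using assms(2,3)
proof (induction I)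
  case empty
  then show ?case using subspace_zero[OF assms(1)] by (simp add: finsum_vec_empty)
next
  case (insert i I)
  then show ?case
    using assms(1) subspace_carrier[OF assms(1)]
    by (subst finsum_vec_insert) (auto intro: subspace_add)
qed

lemma vsum_single:
  assumes "finite I" "i \<in> I" "v \<in> carrier_vec n"
  shows "vsum n (\<lambda>j. if j = i then v else 0\<^sub>v n) I = v"
proof (rule eq_vecI)
  show "dim_vec (vsum n (\<lambda>j. if j = i then v else 0\<^sub>v n) I) = dim_vec v"
    using assms vsum_closed[of I "\<lambda>j. if j = i then v else 0\<^sub>v n" n] by simp
  fix p assume "p < dim_vec v"
  then have p: "p < n" using assms by auto
  have "(\<Sum>j\<in>I. (if j = i then v else 0\<^sub>v n) $ p) = (\<Sum>j\<in>I. if j = i then v $ p else 0)"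
    using p by (intro sum.cong) auto
  then show "vsum n (\<lambda>j. if j = i then v else 0\<^sub>v n) I $ p = v $ p"
    using assms p by (subst vsum_index) auto
qed

lemma vsum_add:
  assumes "finite I" "\<And>i. i \<in> I \<Longrightarrow> u i \<in> carrier_vec n" "\<And>i. i \<in> I \<Longrightarrow> v i \<in> carrier_vec n"
  shows "vsum n (\<lambda>i. u i + v i) I = vsum n u I + vsum n v I"
proof (rule eq_vecI)
  show "dim_vec (vsum n (\<lambda>i. u i + v i) I) = dim_vec (vsum n u I + vsum n v I)"
    using assms vsum_closed[of I u n] vsum_closed[of I v n] vsum_closed[of I "\<lambda>i. u i + v i" n] by simp
  fix p assume "p < dim_vec (vsum n u I + vsum n v I)"
  then have p: "p < n" using assms vsum_closed[of I v n] by auto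
  have c: "dim_vec (u i) = n" "dim_vec (v i) = n" if "i \<in> I" for i
    using assms that by auto
  show "vsum n (\<lambda>i. u i + v i) I $ p = (vsum n u I + vsum n v I) $ p"
    using assms p vsum_closed[of I v n]
    by (simp add: vsum_index sum.distrib c carrier_vecD)
qed

lemma vsum_smult:
  assumes "finite I" "\<And>i. i \<in> I \<Longrightarrow> u i \<in> carrier_vec n"
  shows "vsum n (\<lambda>i. c \<cdot>\<^sub>v u i) I = c \<cdot>\<^sub>v vsum n u I"
proof (rule eq_vecI)
  show "dim_vec (vsum n (\<lambda>i. c \<cdot>\<^sub>v u i) I) = dim_vec (c \<cdot>\<^sub>v vsum n u I)"
    using assms vsum_closed[of I u n] vsum_closed[of I "\<lambda>i. c \<cdot>\<^sub>v u i" n] by simp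
  fix p assume "p < dim_vec (c \<cdot>\<^sub>v vsum n u I)"
  then have p: "p < n" using assms vsum_closed[of I u n] by auto
  have c: "dim_vec (u i) = n" if "i \<in> I" for i
    using assms that by auto
  show "vsum n (\<lambda>i. c \<cdot>\<^sub>v u i) I $ p = (c \<cdot>\<^sub>v vsum n u I) $ p"
    using assms p vsum_closed[of I u n]
    by (simp add: vsum_index sum_distrib_left c carrier_vecD)
qed

text \<open>\<open>restrict\<close> bridges the gap between arbitrary families and the extensional
  ones in the definition.\<close>

lemma family_sum_iff:
  assumes "finite I" "\<And>i. i \<in> I \<Longrightarrow> is_subspace n (U i)"
  shows "v \<in> family_sum n I U \<longleftrightarrow> (\<exists>u. (\<forall>i\<in>I. u i \<in> U i) \<and> v = vsum n u I)"
proof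
  assume "v \<in> family_sum n I U"
  then obtain u where "u \<in> (\<Pi>\<^sub>E i\<in>I. U i)" "v = vsum n u I" unfolding family_sum_def by blast
  then show "\<exists>u. (\<forall>i\<in>I. u i \<in> U i) \<and> v = vsum n u I" by (intro exI[of _ u]) auto
next
  assume "\<exists>u. (\<forall>i\<in>I. u i \<in> U i) \<and> v = vsum n u I"
  then obtain u where u: "\<forall>i\<in>I. u i \<in> U i" "v = vsum n u I" by blast
  have "u i \<in> carrier_vec n" if "i \<in> I" for i using u(1) that subspace_carrier[OF assms(2)] by blast
  then have "v = vsum n (restrict u I) I" unfolding u(2) using vsum_restrict[OF assms(1)] by simp
  then show "v \<in> family_sum n I U" unfolding family_sum_def
    using u(1) by (intro image_eqI[of _ _ "restrict u I"]) auto
qed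

lemma family_sum_subspace:
  assumes fin: "finite I" and U: "\<And>i. i \<in> I \<Longrightarrow> is_subspace n (U i)"
  shows "is_subspace n (family_sum n I U)"
proof -
  have iff: "v \<in> family_sum n I U \<longleftrightarrow> (\<exists>u. (\<forall>i\<in>I. u i \<in> U i) \<and> v = vsum n u I)" for v
    using fin U by (rule family_sum_iff)
  have c: "u i \<in> carrier_vec n" if "\<forall>i\<in>I. u i \<in> U i" "i \<in> I" for u i
    using that subspace_carrier[OF U] by blast
  show ?thesis
    unfolding is_subspace_iff
  proof (intro conjI ballI allI subsetI)
    fix v assume "v \<in> family_sum n I U"
    then obtain u where u: "\<forall>i\<in>I. u i \<in> U i" "v = vsum n u I" using iff by blast
    then show "v \<in> carrier_vec n" using c by (auto intro!: vsum_closed)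
  next
    have "0\<^sub>v n = vsum n (\<lambda>_. 0\<^sub>v n) I"
      using fin vsum_closed[of I "\<lambda>_. 0\<^sub>v n" n] by (intro eq_vecI) (auto simp: vsum_index)
    then show "0\<^sub>v n \<in> family_sum n I U"
      unfolding iff using subspace_zero[OF U] by (intro exI[of _ "\<lambda>_. 0\<^sub>v n"]) simp
  next
    fix a b assume "a \<in> family_sum n I U" "b \<in> family_sum n I U"
    then obtain u v where "\<forall>i\<in>I. u i \<in> U i" "a = vsum n u I" "\<forall>i\<in>I. v i \<in> U i" "b = vsum n v I"
      using iff by blast
    then show "a + b \<in> family_sum n I U" unfolding iff using fin c subspace_add[OF U]
      by (intro exI[of _ "\<lambda>i. u i + v i"]) (simp add: vsum_add)
  next
    fix z a assume "a \<in> family_sum n I U"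
    then obtain u where "\<forall>i\<in>I. u i \<in> U i" "a = vsum n u I" using iff by blast
    then show "z \<cdot>\<^sub>v a \<in> family_sum n I U" unfolding iff using fin c subspace_smult[OF U]
      by (intro exI[of _ "\<lambda>i. z \<cdot>\<^sub>v u i"]) (simp add: vsum_smult)
  qed
qed

lemma vec_eq_vsum_unit_vecs:
  assumes "C \<subseteq> {..<n}"
  shows "vec n (\<lambda>p. if p \<in> C then x p else 0) = vsum n (\<lambda>p. x p \<cdot>\<^sub>v unit_vec n p) C" (is "?v = ?s")
proof (rule eq_vecI)
  have fin: "finite C" using assms finite_subset by blast
  have c: "?s \<in> carrier_vec n" by (intro vsum_closed) auto
  then show "dim_vec ?v = dim_vec ?s" by simp
  fix q assume "q < dim_vec ?s"
  then have q: "q < n" using c by simp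
  have "?s $ q = (\<Sum>p\<in>C. (x p \<cdot>\<^sub>v unit_vec n p) $ q)" using fin q by (intro vsum_index) auto
  also have "\<dots> = (\<Sum>p\<in>C. if p = q then x p else 0)" using q assms by (intro sum.cong) auto
  finally show "?v $ q = ?s $ q" using q fin by simp
qed

lemma mult_mat_vec_index:
  fixes A :: "'a::comm_semiring_0 mat"
  assumes "A \<in> carrier_mat m n" "v \<in> carrier_vec n" "p < m"
  shows "(A *\<^sub>v v) $ p = (\<Sum>q<n. A $$ (p, q) * v $ q)"
  using assms by (auto simp: scalar_prod_def lessThan_atLeast0 intro!: sum.cong)

lemma mult_mat_vsum:
  assumes "finite I" "\<And>i. i \<in> I \<Longrightarrow> u i \<in> carrier_vec n" "A \<in> carrier_mat m n"
  shows "A *\<^sub>v vsum n u I = vsum m (\<lambda>i. A *\<^sub>v u i) I"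
proof (rule eq_vecI)
  have c: "vsum m (\<lambda>i. A *\<^sub>v u i) I \<in> carrier_vec m"
    using assms by (intro vsum_closed) auto
  then show "dim_vec (A *\<^sub>v vsum n u I) = dim_vec (vsum m (\<lambda>i. A *\<^sub>v u i) I)"
    using assms by simp
  fix p assume "p < dim_vec (vsum m (\<lambda>i. A *\<^sub>v u i) I)"
  then have p: "p < m" using c by auto
  have "(A *\<^sub>v vsum n u I) $ p = (\<Sum>q<n. A $$ (p, q) * (\<Sum>i\<in>I. u i $ q))"
    using assms p vsum_closed[of I u n]
    by (subst mult_mat_vec_index) (auto simp: vsum_index)
  also have "\<dots> = (\<Sum>i\<in>I. \<Sum>q<n. A $$ (p, q) * u i $ q)"
    by (simp add: sum_distrib_left) (rule sum.swap)
  also have "\<dots> = (\<Sum>i\<in>I. (A *\<^sub>v u i) $ p)"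
    using assms p by (intro sum.cong refl mult_mat_vec_index[symmetric]) auto
  also have "\<dots> = vsum m (\<lambda>i. A *\<^sub>v u i) I $ p"
    using assms p by (subst vsum_index) auto
  finally show "(A *\<^sub>v vsum n u I) $ p = vsum m (\<lambda>i. A *\<^sub>v u i) I $ p" .
qed

text \<open>Uniqueness of the decomposition reduces to the zero vector: two families with the same
  sum differ by a family with sum zero. The criterion speaks of arbitrary families, so that
  extensionality need not be handled at each use.\<close>

lemma is_direct_sumI:
  assumes "finite I" "is_subspace n W" "\<And>i. i \<in> I \<Longrightarrow> is_subspace n (U i)"
    and sub: "\<And>i. i \<in> I \<Longrightarrow> U i \<subseteq> W"
    and ex: "\<And>w. w \<in> W \<Longrightarrow> \<exists>u. (\<forall>i\<in>I. u i \<in> U i) \<and> w = vsum n u I"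
    and ind: "\<And>u i. (\<And>i. i \<in> I \<Longrightarrow> u i \<in> U i) \<Longrightarrow> vsum n u I = 0\<^sub>v n \<Longrightarrow> i \<in> I \<Longrightarrow> u i = 0\<^sub>v n"
  shows "is_direct_sum n W I U"
proof -
  have car: "u \<in> carrier_vec n" if "i \<in> I" "u \<in> U i" for u i
    using assms(3)[OF that(1)] that(2) subspace_carrier by blast
  have "bij_betw (\<lambda>u. vsum n u I) (\<Pi>\<^sub>E i\<in>I. U i) W"
  proof (intro bij_betwI' )
    fix u v assume u: "u \<in> (\<Pi>\<^sub>E i\<in>I. U i)" and v: "v \<in> (\<Pi>\<^sub>E i\<in>I. U i)"
    show "(vsum n u I = vsum n v I) = (u = v)"
    proof
      assume eq: "vsum n u I = vsum n v I"
      have uc: "u i \<in> carrier_vec n" if "i \<in> I" for i using car u that by blast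
      have vc: "v i \<in> carrier_vec n" if "i \<in> I" for i using car v that by blast
      have "vsum n (\<lambda>i. u i + (-1) \<cdot>\<^sub>v v i) I = vsum n u I + (-1) \<cdot>\<^sub>v vsum n v I"
        using assms(1) uc vc by (subst vsum_add) (auto simp: vsum_smult)
      also have "\<dots> = 0\<^sub>v n"
        unfolding eq using vsum_closed[of I v n] vc by (intro eq_vecI) auto
      finally have 0: "vsum n (\<lambda>i. u i + (-1) \<cdot>\<^sub>v v i) I = 0\<^sub>v n" .
      have "u i = v i" if "i \<in> I" for i
      proof -
        have "u i + (-1) \<cdot>\<^sub>v v i = 0\<^sub>v n"
        proof (rule ind[OF _ 0 that])
          fix i assume "i \<in> I"
          then show "u i + (-1) \<cdot>\<^sub>v v i \<in> U i"
            using u v assms(3)[of i] by (intro subspace_add subspace_smult) auto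
        qed
        then have "\<And>p. p < n \<Longrightarrow> u i $ p = v i $ p"
          using uc[OF that] vc[OF that]
          by (auto simp: vec_eq_iff)
        then show ?thesis using uc[OF that] vc[OF that] by (intro eq_vecI) auto
      qed
      then show "u = v" using u v by (intro PiE_ext) auto
    qed simp
  next
    fix u assume "u \<in> (\<Pi>\<^sub>E i\<in>I. U i)"
    then show "vsum n u I \<in> W" using assms(1,2) sub by (intro vsum_in_subspace) auto
  next
    fix w assume "w \<in> W"
    then obtain u where u: "\<forall>i\<in>I. u i \<in> U i" "w = vsum n u I" using ex by blast
    show "\<exists>x\<in>\<Pi>\<^sub>E i\<in>I. U i. w = vsum n x I"
      using u car assms(1) by (intro bexI[of _ "restrict u I"]) (auto simp: vsum_restrict)
  qed
  then show ?thesis using assms unfolding is_direct_sum_def by auto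
qed

text \<open>The inclusion comes from a family supported at a single index, independence from
  comparison with the zero family.\<close>

lemma is_direct_sumD:
  assumes "is_direct_sum n W I U"
  shows "finite I" "is_subspace n W" "\<And>i. i \<in> I \<Longrightarrow> is_subspace n (U i)"
    and "\<And>i. i \<in> I \<Longrightarrow> U i \<subseteq> W"
    and "\<And>w. w \<in> W \<Longrightarrow> \<exists>u. (\<forall>i\<in>I. u i \<in> U i) \<and> w = vsum n u I"
    and "\<And>u i. (\<And>i. i \<in> I \<Longrightarrow> u i \<in> U i) \<Longrightarrow> vsum n u I = 0\<^sub>v n \<Longrightarrow> i \<in> I \<Longrightarrow> u i = 0\<^sub>v n"
proof -
  show fin: "finite I" and "is_subspace n W" and sub: "\<And>i. i \<in> I \<Longrightarrow> is_subspace n (U i)"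
    using assms unfolding is_direct_sum_def by auto
  have bij: "bij_betw (\<lambda>u. vsum n u I) (\<Pi>\<^sub>E i\<in>I. U i) W"
    using assms unfolding is_direct_sum_def by auto
  have car: "u \<in> carrier_vec n" if "i \<in> I" "u \<in> U i" for u i
    using sub[OF that(1)] that(2) subspace_carrier by blast
  show "U i \<subseteq> W" if i: "i \<in> I" for i
  proof
    fix v assume v: "v \<in> U i"
    let ?u = "\<lambda>j. if j = i then v else 0\<^sub>v n"
    have "restrict ?u I \<in> (\<Pi>\<^sub>E i\<in>I. U i)" using v sub subspace_zero by auto
    then have "vsum n (restrict ?u I) I \<in> W" using bij unfolding bij_betw_def by blast
    moreover have "vsum n (restrict ?u I) I = vsum n ?u I"
      using fin car[OF i v] by (intro vsum_restrict) auto
    ultimately show "v \<in> W" using vsum_single[OF fin i car[OF i v]] by auto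
  qed
  show "\<exists>u. (\<forall>i\<in>I. u i \<in> U i) \<and> w = vsum n u I" if "w \<in> W" for w
  proof -
    from that bij obtain u where "u \<in> (\<Pi>\<^sub>E i\<in>I. U i)" "w = vsum n u I"
      unfolding bij_betw_def by blast
    then show ?thesis by (intro exI[of _ u]) auto
  qed
  fix u i assume u: "\<And>i. i \<in> I \<Longrightarrow> u i \<in> U i" and 0: "vsum n u I = 0\<^sub>v n" and i: "i \<in> I"
  have "restrict u I \<in> (\<Pi>\<^sub>E i\<in>I. U i)" using u by auto
  moreover have "(\<lambda>i\<in>I. 0\<^sub>v n) \<in> (\<Pi>\<^sub>E i\<in>I. U i)" using sub subspace_zero by auto
  moreover have "vsum n (restrict u I) I = vsum n (\<lambda>i\<in>I. 0\<^sub>v n) I"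
  proof -
    have "vsum n (restrict u I) I = 0\<^sub>v n"
      using fin u car 0 by (subst vsum_restrict) auto
    moreover have "vsum n (\<lambda>i\<in>I. 0\<^sub>v n) I = 0\<^sub>v n"
      using fin vsum_closed[of I "(\<lambda>i\<in>I. 0\<^sub>v n)" n] by (intro eq_vecI) (auto simp: vsum_index)
    ultimately show ?thesis by simp
  qed
  ultimately have "restrict u I = (\<lambda>i\<in>I. 0\<^sub>v n)"
    using bij unfolding bij_betw_def inj_on_def by blast
  then show "u i = 0\<^sub>v n" using i by (metis restrict_apply')
qed

subsection \<open>Polynomial functions\<close>

abbreviation "ev p F \<equiv> insertion (\<lambda>c. c) p F"

abbreviation monom_at :: "(nat \<Rightarrow> complex) \<Rightarrow> (nat \<Rightarrow>\<^sub>0 nat) \<Rightarrow> complex" where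
  "monom_at p \<mu> \<equiv> \<Prod>k\<in>Poly_Mapping.keys \<mu>. p k ^ Poly_Mapping.lookup \<mu> k"

text \<open>A common finite index set allows polynomials with different supports to be added term by
  term.\<close>

lemma insertion_superset:
  assumes "finite A" "Poly_Mapping.keys F \<subseteq> A"
  shows "ev p F = (\<Sum>\<mu>\<in>A. Poly_Mapping.lookup F \<mu> * monom_at p \<mu>)"
  unfolding insertion_def
  by (rule sum.mono_neutral_left) (use assms in \<open>auto simp: in_keys_iff\<close>)

lemma monom_at_superset:
  assumes "finite A" "Poly_Mapping.keys \<mu> \<subseteq> A"
  shows "monom_at p \<mu> = (\<Prod>k\<in>A. p k ^ Poly_Mapping.lookup \<mu> k)"
  by (rule prod.mono_neutral_left) (use assms in \<open>auto simp: in_keys_iff\<close>)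

lemma ev_zero [simp]: "ev p 0 = 0"
  by (simp add: insertion_def)

lemma ev_single: "ev p (Poly_Mapping.single \<mu> c) = c * monom_at p \<mu>"
  by (subst insertion_superset[of "{\<mu>}"]) auto

lemma ev_add: "ev p (P + Q) = ev p P + ev p Q"
proof -
  let ?A = "Poly_Mapping.keys P \<union> Poly_Mapping.keys Q"
  show ?thesis
    using Poly_Mapping.keys_add[of P Q]
    by (simp add: insertion_superset[of ?A] lookup_add distrib_right sum.distrib)
qed

lemma ev_sum: "ev p (\<Sum>i\<in>I. P i) = (\<Sum>i\<in>I. ev p (P i))"
  by (induction I rule: infinite_finite_induct) (auto simp: ev_add)

lemma cpoly_eq_sum_monomials:
  fixes P :: "'a \<Rightarrow>\<^sub>0 'b::comm_monoid_add"
  shows "P = (\<Sum>\<mu>\<in>Poly_Mapping.keys P. Poly_Mapping.single \<mu> (Poly_Mapping.lookup P \<mu>))"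
proof (rule poly_mapping_eqI)
  fix \<nu>
  show "Poly_Mapping.lookup P \<nu> =
    Poly_Mapping.lookup (\<Sum>\<mu>\<in>Poly_Mapping.keys P. Poly_Mapping.single \<mu> (Poly_Mapping.lookup P \<mu>)) \<nu>"
    by (simp add: lookup_sum lookup_single when_def in_keys_iff)
qed

lemma monom_at_add: "monom_at p (\<mu> + \<nu>) = monom_at p \<mu> * monom_at p \<nu>"
proof -
  let ?A = "Poly_Mapping.keys \<mu> \<union> Poly_Mapping.keys \<nu>"
  show ?thesis
    unfolding monom_at_superset[of ?A "\<mu> + \<nu>", OF _ Poly_Mapping.keys_add, simplified]
    by (simp add: monom_at_superset[of ?A] lookup_add power_add prod.distrib del: keys_eq_empty)
qed

lemma ev_mult: "ev p (P * Q) = ev p P * ev p Q"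
proof -
  have "ev p (P * Q) = ev p ((\<Sum>\<mu>\<in>Poly_Mapping.keys P. Poly_Mapping.single \<mu> (Poly_Mapping.lookup P \<mu>)) *
      (\<Sum>\<nu>\<in>Poly_Mapping.keys Q. Poly_Mapping.single \<nu> (Poly_Mapping.lookup Q \<nu>)))"
    using cpoly_eq_sum_monomials[of P] cpoly_eq_sum_monomials[of Q] by simp
  also have "\<dots> = ev p P * ev p Q"
    unfolding insertion_def[of _ _ P] insertion_def[of _ _ Q]
    by (simp add: sum_product ev_sum mult_single ev_single monom_at_add mult_ac)
  finally show ?thesis .
qed

lemma ev_one [simp]: "ev p 1 = 1"
  using ev_single[of p 0 1] by simp

lemma ev_power: "ev p (P ^ e) = ev p P ^ e"
  by (induction e) (auto simp: ev_mult)

lemma ev_prod: "ev p (\<Prod>i\<in>I. P i) = (\<Prod>i\<in>I. ev p (P i))"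
  by (induction I rule: infinite_finite_induct) (auto simp: ev_mult)

text \<open>Turns invariance of \<open>F\<close> as a formal polynomial into invariance of the
  function \<open>eval_at\<close>; membership in \<open>Aut\<close> is exploited only in this
  form.\<close>

lemma eval_at_mat_subst:
  assumes "is_form r d F" "A \<in> carrier_mat r r" "v \<in> carrier_vec r"
  shows "eval_at v (mat_subst r A F) = eval_at (A *\<^sub>v v) F"
proof -
  have k: "ev (\<lambda>k. v $ k) (\<Sum>i<r. poly_const (A $$ (k, i)) * poly_var i) = (A *\<^sub>v v) $ k" if "k < r" for k
    using assms(2,3) that
    by (auto simp: ev_sum ev_mult poly_const_def poly_var_def ev_single scalar_prod_def
        lessThan_atLeast0 intro!: sum.cong)
  have "ev (\<lambda>k. v $ k) (mat_subst r A F) = (\<Sum>\<mu>\<in>Poly_Mapping.keys F. Poly_Mapping.lookup F \<mu> *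
      (\<Prod>k\<in>Poly_Mapping.keys \<mu>. ev (\<lambda>k. v $ k) (\<Sum>i<r. poly_const (A $$ (k, i)) * poly_var i) ^ Poly_Mapping.lookup \<mu> k))"
    unfolding mat_subst_def insertion_def[of poly_const]
    by (simp add: ev_sum ev_mult ev_prod ev_power) (simp add: poly_const_def ev_single)
  also have "\<dots> = ev (\<lambda>k. (A *\<^sub>v v) $ k) F"
    unfolding insertion_def[of _ _ F] using assms(1)
    by (intro sum.cong refl arg_cong2[of _ _ _ _ "(*)"] prod.cong arg_cong2[of _ _ _ _ "(^)"] k)
      (auto simp: is_form_def)
  finally show ?thesis unfolding eval_at_def .
qed

lemma eval_at_form:
  assumes "is_form r d F"
  shows "eval_at v F = (\<Sum>\<mu>\<in>Poly_Mapping.keys F. Poly_Mapping.lookup F \<mu> * (\<Prod>k<r. (v $ k) ^ Poly_Mapping.lookup \<mu> k))"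
  unfolding eval_at_def insertion_def using assms
  by (intro sum.cong refl arg_cong2[of _ _ _ _ "(*)"] monom_at_superset) (auto simp: is_form_def)

lemma eval_at_partial:
  assumes "is_form r d F"
  shows "eval_at v (partial q F) = (\<Sum>\<mu>\<in>Poly_Mapping.keys F.
    of_nat (Poly_Mapping.lookup \<mu> q) * Poly_Mapping.lookup F \<mu> *
      (\<Prod>k<r. (v $ k) ^ (Poly_Mapping.lookup \<mu> k - (if k = q then 1 else 0))))"
proof -
  have "monom_at (\<lambda>k. v $ k) (\<mu> - Poly_Mapping.single q 1) =
      (\<Prod>k<r. (v $ k) ^ (Poly_Mapping.lookup \<mu> k - (if k = q then 1 else 0)))"
    if "\<mu> \<in> Poly_Mapping.keys F" for \<mu>
  proof -
    have "Poly_Mapping.keys (\<mu> - Poly_Mapping.single q 1) \<subseteq> {..<r}"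
    proof
      fix k assume "k \<in> Poly_Mapping.keys (\<mu> - Poly_Mapping.single q 1)"
      then have "k \<in> Poly_Mapping.keys \<mu>" by (auto simp: in_keys_iff lookup_minus)
      then show "k \<in> {..<r}" using assms that unfolding is_form_def by blast
    qed
    then have "monom_at (\<lambda>k. v $ k) (\<mu> - Poly_Mapping.single q 1) =
      (\<Prod>k<r. (v $ k) ^ Poly_Mapping.lookup (\<mu> - Poly_Mapping.single q 1) k)"
      by (rule monom_at_superset[OF finite_lessThan])
    also have "\<dots> = (\<Prod>k<r. (v $ k) ^ (Poly_Mapping.lookup \<mu> k - (if k = q then 1 else 0)))"
      by (intro prod.cong refl) (auto simp: lookup_minus lookup_single when_def)
    finally show ?thesis .
  qed
  then show ?thesis
    unfolding eval_at_def partial_def by (simp add: ev_sum ev_single)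
qed

text \<open>Product rule, by induction on the number of variables. The truncated exponent
  \<open>e k - 1\<close> only occurs next to the factor \<open>e q\<close>, which vanishes whenever
  truncation happens.\<close>

lemma DERIV_monomial:
  fixes x y :: "nat \<Rightarrow> complex"
  shows "((\<lambda>t. \<Prod>k<r. (x k + t * y k) ^ e k) has_field_derivative
    (\<Sum>q<r. y q * (of_nat (e q) * (\<Prod>k<r. x k ^ (e k - (if k = q then 1 else 0)))))) (at 0)"
proof (induction r)
  case 0
  then show ?case by simp
next
  case (Suc r)
  let ?P = "\<lambda>q s. \<Prod>k<s. x k ^ (e k - (if k = q then 1 else 0))"
  have r: "?P r r = (\<Prod>k<r. x k ^ e k)" by (intro prod.cong) auto
  have "((\<lambda>t. (\<Prod>k<r. (x k + t * y k) ^ e k) * (x r + t * y r) ^ e r) has_field_derivative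
    (\<Sum>q<r. y q * (of_nat (e q) * ?P q r)) * x r ^ e r +
     (of_nat (e r) * x r ^ (e r - 1) * y r) * (\<Prod>k<r. x k ^ e k)) (at 0)"
    by (rule derivative_eq_intros Suc.IH refl)+ auto
  also have "(\<Sum>q<r. y q * (of_nat (e q) * ?P q r)) * x r ^ e r = (\<Sum>q<r. y q * (of_nat (e q) * ?P q (Suc r)))"
    by (auto simp: sum_distrib_left mult_ac intro!: sum.cong)
  finally show ?case by (simp add: r mult_ac)
qed

text \<open>Expressing the gradient in direction \<open>y\<close> as an ordinary derivative at 0
  lets uniqueness of derivatives replace a chain rule in several variables.\<close>

lemma DERIV_eval_at_line:
  assumes "is_form r d F" "x \<in> carrier_vec r" "y \<in> carrier_vec r"
  shows "((\<lambda>t. eval_at (x + t \<cdot>\<^sub>v y) F) has_field_derivative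
    (\<Sum>q<r. y $ q * eval_at x (partial q F))) (at 0)"
proof -
  have "eval_at (x + t \<cdot>\<^sub>v y) F = (\<Sum>\<mu>\<in>Poly_Mapping.keys F. Poly_Mapping.lookup F \<mu> *
      (\<Prod>k<r. (x $ k + t * y $ k) ^ Poly_Mapping.lookup \<mu> k))" for t
    unfolding eval_at_form[OF assms(1)] using assms(2,3) by simp
  moreover have "(\<Sum>q<r. y $ q * eval_at x (partial q F)) =
     (\<Sum>\<mu>\<in>Poly_Mapping.keys F. Poly_Mapping.lookup F \<mu> * (\<Sum>q<r. y $ q * (of_nat (Poly_Mapping.lookup \<mu> q) *
       (\<Prod>k<r. (x $ k) ^ (Poly_Mapping.lookup \<mu> k - (if k = q then 1 else 0))))))"
    unfolding eval_at_partial[OF assms(1)] sum_distrib_left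
    by (subst sum.swap) (simp add: mult_ac)
  ultimately show ?thesis
    by (simp only:) (intro DERIV_sum DERIV_cmult DERIV_monomial)
qed

text \<open>A polynomial function that is zero everywhere has zero coefficients. The index
  \<open>\<mu>\<close> need not be determined by its exponents \<open>e \<mu>\<close>, so the
  coefficient of a monomial is a sum over all indices sharing these exponents. The induction splits
  off one variable at a time.\<close>

lemma polyfun_zero_coeffs:
  fixes a :: "'b \<Rightarrow> complex" and e :: "'b \<Rightarrow> nat \<Rightarrow> nat"
  assumes "finite C" "finite A" "\<And>x :: nat \<Rightarrow> complex. (\<Sum>\<mu>\<in>A. a \<mu> * (\<Prod>k\<in>C. x k ^ e \<mu> k)) = 0"
  shows "(\<Sum>\<mu> | \<mu> \<in> A \<and> (\<forall>k\<in>C. e \<mu> k = \<nu> k). a \<mu>) = 0"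
  using assms
proof (induction C arbitrary: A)
  case empty
  then show ?case by simp
next
  case (insert c C)
  \<comment> \<open>A bound for the degree in the variable \<open>c\<close>; the inserted 0 keeps
    \<open>Max\<close> meaningful for empty \<open>A\<close>.\<close>
  define N where "N = Max (insert 0 ((\<lambda>\<mu>. e \<mu> c) ` A))"
  have N: "e \<mu> c \<le> N" if "\<mu> \<in> A" for \<mu>
    unfolding N_def using insert.prems(1) that by (intro Max_ge) auto
  let ?B = "{\<mu> \<in> A. e \<mu> c = \<nu> c}"
  have "(\<Sum>\<mu>\<in>?B. a \<mu> * (\<Prod>k\<in>C. x k ^ e \<mu> k)) = 0" for x
  proof (cases "\<nu> c \<le> N")
    case True
    \<comment> \<open>With the other variables frozen at \<open>x\<close>, these are the
      coefficients of a polynomial in \<open>z\<close> alone; it is zero everywhere, so each of them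
      vanishes.\<close>
    define co where "co i = (\<Sum>\<mu> | \<mu> \<in> A \<and> e \<mu> c = i. a \<mu> * (\<Prod>k\<in>C. x k ^ e \<mu> k))" for i
    have "(\<Sum>i\<le>N. co i * z ^ i) = 0" for z
    proof -
      have "(\<Sum>i\<le>N. co i * z ^ i) = (\<Sum>i\<le>N. \<Sum>\<mu> | \<mu> \<in> A \<and> e \<mu> c = i. a \<mu> * (z ^ e \<mu> c * (\<Prod>k\<in>C. x k ^ e \<mu> k)))"
        by (auto simp: co_def sum_distrib_left mult_ac intro!: sum.cong)
      also have "\<dots> = (\<Sum>\<mu>\<in>A. a \<mu> * (z ^ e \<mu> c * (\<Prod>k\<in>C. x k ^ e \<mu> k)))"
        using insert.prems(1) N by (intro sum.group) auto
      also have "\<dots> = (\<Sum>\<mu>\<in>A. a \<mu> * (\<Prod>k\<in>insert c C. (x(c := z)) k ^ e \<mu> k))"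
      proof (intro sum.cong refl arg_cong2[of _ _ _ _ "(*)"])
        fix \<mu>
        have "(\<Prod>k\<in>C. (x(c := z)) k ^ e \<mu> k) = (\<Prod>k\<in>C. x k ^ e \<mu> k)"
          using insert.hyps by (intro prod.cong) auto
        then show "z ^ e \<mu> c * (\<Prod>k\<in>C. x k ^ e \<mu> k) = (\<Prod>k\<in>insert c C. (x(c := z)) k ^ e \<mu> k)"
          using insert.hyps by simp
      qed
      also have "\<dots> = 0" by (rule insert.prems(2))
      finally show ?thesis .
    qed
    then have "co (\<nu> c) = 0" using True polyfun_eq_0[of co N] by auto
    then show ?thesis by (simp add: co_def)
  next
    case False
    then have "?B = {}" using N by force
    then show ?thesis by (simp only: sum.empty)
  qed
  from insert.IH[OF _ this] insert.prems(1)
  have "(\<Sum>\<mu> | \<mu> \<in> ?B \<and> (\<forall>k\<in>C. e \<mu> k = \<nu> k). a \<mu>) = 0" by simp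
  moreover have "{\<mu>. \<mu> \<in> ?B \<and> (\<forall>k\<in>C. e \<mu> k = \<nu> k)} = {\<mu>. \<mu> \<in> A \<and> (\<forall>k\<in>insert c C. e \<mu> k = \<nu> k)}"
    by auto
  ultimately show ?case by simp
qed

text \<open>Otherwise the gradient of \<open>F\<close> vanishes at the \<open>p\<close>-th vector of the standard basis.\<close>

lemma smooth_form_monomial:
  assumes "is_form r d F" "smooth r F" "p < r" "d \<ge> 1"
  obtains \<mu> q where "\<mu> \<in> Poly_Mapping.keys F" "q < r"
    "\<And>k. Poly_Mapping.lookup \<mu> k = (if k = p then d - 1 else 0) + (if k = q then 1 else 0)"
proof -
  have "unit_vec r p \<noteq> (0\<^sub>v r :: complex vec)"
    using assms(3) by (metis index_unit_vec(1) index_zero_vec(1) zero_neq_one)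
  then obtain q where q: "q < r" "eval_at (unit_vec r p) (partial q F) \<noteq> 0"
    using assms(2) unit_vec_carrier[of r p, where 'a = complex] unfolding smooth_def by blast
  then obtain \<mu> where \<mu>: "\<mu> \<in> Poly_Mapping.keys F" and
    nz: "of_nat (Poly_Mapping.lookup \<mu> q) * Poly_Mapping.lookup F \<mu> *
      (\<Prod>k<r. (unit_vec r p $ k :: complex) ^ (Poly_Mapping.lookup \<mu> k - (if k = q then 1 else 0))) \<noteq> 0"
    unfolding eval_at_partial[OF assms(1)] by (metis (no_types, lifting) sum.neutral)
  have q1: "Poly_Mapping.lookup \<mu> q \<ge> 1" using nz by (cases "Poly_Mapping.lookup \<mu> q") auto
  \<comment> \<open>At the \<open>p\<close>-th basis vector a coordinate \<open>k \<noteq> p\<close>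
    contributes a power of 0, which is nonzero only for exponent 0. So after differentiation only a
    power of \<open>x\<^sub>p\<close> is left.\<close>
  have k0: "Poly_Mapping.lookup \<mu> k = (if k = q then 1 else 0)" if "k \<noteq> p" for k
  proof (cases "k < r")
    case True
    then have "(unit_vec r p $ k :: complex) ^ (Poly_Mapping.lookup \<mu> k - (if k = q then 1 else 0)) \<noteq> 0"
      using nz by auto
    then have "Poly_Mapping.lookup \<mu> k - (if k = q then 1 else 0) = 0"
      using True that assms(3) by (auto simp: power_0_left split: if_splits)
    then show ?thesis using q1 by (auto split: if_splits)
  next
    case False
    then have "k \<notin> Poly_Mapping.keys \<mu>" using assms(1) \<mu> unfolding is_form_def by auto
    then show ?thesis using False q by (auto simp: in_keys_iff)
  qed
  \<comment> \<open>The degree fixes the remaining exponent. The case \<open>q = p\<close> is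
    allowed and yields the pure power \<open>x\<^sub>p ^ d\<close>.\<close>
  have "(\<Sum>k<r. Poly_Mapping.lookup \<mu> k) = d" using assms(1) \<mu> unfolding is_form_def by auto
  then have "d = Poly_Mapping.lookup \<mu> p + (\<Sum>k\<in>{..<r}-{p}. Poly_Mapping.lookup \<mu> k)"
    using assms(3) by (simp add: sum.remove)
  also have "(\<Sum>k\<in>{..<r}-{p}. Poly_Mapping.lookup \<mu> k) = (\<Sum>k\<in>{..<r}-{p}. if k = q then 1 else 0)"
    using k0 by (intro sum.cong) auto
  also have "\<dots> = (if p = q then 0 else 1)"
    using q by (auto simp: sum.delta)
  finally have "Poly_Mapping.lookup \<mu> k = (if k = p then d - 1 else 0) + (if k = q then 1 else 0)" for k
    using k0[of k] q1 assms(4) by (auto split: if_splits)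
  with \<mu> q show ?thesis by (intro that)
qed

subsection \<open>Commuting families in primitive groups\<close>

lemma vec_ne_zero_index:
  assumes "v \<in> carrier_vec n" "v \<noteq> 0\<^sub>v n"
  obtains p where "p < n" "v $ p \<noteq> 0"
  using assms by (metis carrier_vecD eq_vecI index_zero_vec)

text \<open>Some \<open>m\<close>-th root of unity \<open>z\<close> is not a zero of the polynomial of degree \<open>m - 1\<close> whose coefficients are
  the \<open>p\<close>-th coordinates of the vectors \<open>A ^ (m - 1 - j) v\<close>. Then \<open>\<Sum> z ^ j A ^ (m - 1 - j) v\<close> is an eigenvector.\<close>

lemma finite_order_eigenvector:
  assumes U: "is_subspace n U" and A: "A \<in> carrier_mat n n"
    and inv: "\<And>u. u \<in> U \<Longrightarrow> A *\<^sub>v u \<in> U"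
    and m: "m > 0" and ord: "(((*\<^sub>v) A) ^^ m) v = v"
    and v: "v \<in> U" "v \<noteq> 0\<^sub>v n"
  shows "\<exists>w z. w \<in> U \<and> w \<noteq> 0\<^sub>v n \<and> z ^ m = 1 \<and> A *\<^sub>v w = z \<cdot>\<^sub>v w"
proof -
  have it: "(((*\<^sub>v) A) ^^ j) v \<in> U" for j by (induction j) (use v inv in auto)
  have itc: "(((*\<^sub>v) A) ^^ j) v \<in> carrier_vec n" for j
    using it U subspace_carrier by blast
  obtain p where p: "p < n" "v $ p \<noteq> 0"
    using v subspace_carrier[OF U] vec_ne_zero_index by metis
  \<comment> \<open>The powers of \<open>A\<close> descend, so that the top coefficient
    \<open>c (m - 1)\<close> is \<open>v $ p\<close>, which is nonzero.\<close>
  define c where "c j = (((*\<^sub>v) A ^^ (m - 1 - j)) v) $ p" for j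
  have "c (m - 1) \<noteq> 0" using p by (simp add: c_def)
  then have fin: "finite {z. (\<Sum>i\<le>m-1. c i * z^i) = 0}" and le: "card {z. (\<Sum>i\<le>m-1. c i * z^i) = 0} \<le> m - 1"
    using polyfun_rootbound[of c "m - 1" "m - 1"] by auto
  have "\<not> {z::complex. z ^ m = 1} \<subseteq> {z. (\<Sum>i\<le>m-1. c i * z^i) = 0}"
  proof
    assume "{z::complex. z ^ m = 1} \<subseteq> {z. (\<Sum>i\<le>m-1. c i * z^i) = 0}"
    from card_mono[OF fin this] show False using le card_roots_unity_eq[OF m] m by simp
  qed
  then obtain z where z: "z ^ m = 1" "(\<Sum>i\<le>m-1. c i * z^i) \<noteq> 0" by blast
  define w where "w = vsum n (\<lambda>j. z ^ j \<cdot>\<^sub>v (((*\<^sub>v) A ^^ (m - 1 - j)) v)) {..m-1}"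
  have idx: "w $ q = (\<Sum>j\<le>m-1. z ^ j * (((*\<^sub>v) A ^^ (m - 1 - j)) v) $ q)" if "q < n" for q
  proof -
    have d: "dim_vec ((((*\<^sub>v) A) ^^ j) v) = n" for j using itc[of j] by auto
    show ?thesis
      unfolding w_def using that itc by (subst vsum_index) (auto simp: d)
  qed
  have wU: "w \<in> U" unfolding w_def using U it by (intro vsum_in_subspace subspace_smult) auto
  then have wc: "w \<in> carrier_vec n" using U subspace_carrier by blast
  have "w $ p \<noteq> 0" using z(2) idx[OF p(1)] by (simp add: c_def mult.commute)
  then have w0: "w \<noteq> 0\<^sub>v n" using p by auto
  have "A *\<^sub>v w = z \<cdot>\<^sub>v w"
  proof (rule eq_vecI)
    show "dim_vec (A *\<^sub>v w) = dim_vec (z \<cdot>\<^sub>v w)" using A wc by auto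
    fix q assume "q < dim_vec (z \<cdot>\<^sub>v w)"
    then have q: "q < n" using wc by auto
    let ?a = "\<lambda>j. (((*\<^sub>v) A ^^ j) v) $ q"
    have Aw: "A *\<^sub>v w = vsum n (\<lambda>j. A *\<^sub>v (z ^ j \<cdot>\<^sub>v (((*\<^sub>v) A ^^ (m - 1 - j)) v))) {..m-1}"
      unfolding w_def using itc A by (intro mult_mat_vsum) auto
    have "(A *\<^sub>v w) $ q = (\<Sum>j\<le>m-1. (A *\<^sub>v (z ^ j \<cdot>\<^sub>v (((*\<^sub>v) A ^^ (m - 1 - j)) v))) $ q)"
      unfolding Aw using itc A q by (subst vsum_index) auto
    also have "\<dots> = (\<Sum>j\<le>m-1. z ^ j * ?a (m - j))"
    proof (intro sum.cong refl)
      fix j assume "j \<in> {..m-1}"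
      then have "m - j = Suc (m - 1 - j)" using m by auto
      then have "?a (m - j) = (A *\<^sub>v (((*\<^sub>v) A ^^ (m - 1 - j)) v)) $ q" by simp
      then show "(A *\<^sub>v (z ^ j \<cdot>\<^sub>v (((*\<^sub>v) A ^^ (m - 1 - j)) v))) $ q = z ^ j * ?a (m - j)"
        using itc[of "m - 1 - j"] A q by (subst mult_mat_vec[of A n n]) auto
    qed
    also have "\<dots> = (\<Sum>j<m. z ^ j * ?a (m - j))"
      using m by (intro sum.cong) auto
    \<comment> \<open>Cyclic shift of the sum: the term that leaves at 0 comes from A^m v = v, the
      one that enters at m is z^m v = v.\<close>
    also have "\<dots> = (\<Sum>j<m. z ^ Suc j * ?a (m - Suc j))"
    proof -
      have "?a m + (\<Sum>j<m. z ^ Suc j * ?a (m - Suc j)) = (\<Sum>j<Suc m. z ^ j * ?a (m - j))"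
        by (subst sum.lessThan_Suc_shift) simp
      also have "\<dots> = (\<Sum>j<m. z ^ j * ?a (m - j)) + z ^ m * ?a 0" by simp
      finally show ?thesis using z ord by simp
    qed
    also have "\<dots> = (z \<cdot>\<^sub>v w) $ q"
    proof -
      have "(\<Sum>j<m. z ^ Suc j * ?a (m - Suc j)) = (\<Sum>j\<le>m-1. z ^ Suc j * ?a (m - Suc j))"
        using m by (intro sum.cong) auto
      then show ?thesis
        using idx[OF q] wc q by (simp add: sum_distrib_left mult_ac)
    qed
    finally show "(A *\<^sub>v w) $ q = (z \<cdot>\<^sub>v w) $ q" .
  qed
  with wU w0 z(1) show ?thesis by blast
qed

text \<open>Only the values of \<open>\<chi>\<close> on \<open>C\<close> matter, so many functions
  \<open>\<chi>\<close> name the same space. For this reason the spaces themselves, not the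
  \<open>\<chi>\<close>, serve as index set of the decomposition below.\<close>

definition joint_eigenspace :: "complex mat set \<Rightarrow> complex vec set \<Rightarrow> (complex mat \<Rightarrow> complex) \<Rightarrow> complex vec set" where
  "joint_eigenspace C W \<chi> = {v \<in> W. \<forall>A\<in>C. A *\<^sub>v v = \<chi> A \<cdot>\<^sub>v v}"

lemma joint_eigenspace_subspace:
  assumes W: "is_subspace n W" and C: "\<And>A. A \<in> C \<Longrightarrow> A \<in> carrier_mat n n"
  shows "is_subspace n (joint_eigenspace C W \<chi>)"
proof -
  have c: "v \<in> carrier_vec n" if "v \<in> W" for v using W that subspace_carrier by blast
  have zero: "A *\<^sub>v 0\<^sub>v n = 0\<^sub>v n" if "A \<in> C" for A
    using C[OF that] by (intro eq_vecI) (auto simp: scalar_prod_def)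
  have add: "A *\<^sub>v (u + v) = A *\<^sub>v u + A *\<^sub>v v" "z \<cdot>\<^sub>v (u + v) = z \<cdot>\<^sub>v u + z \<cdot>\<^sub>v v"
    and smult: "A *\<^sub>v (z \<cdot>\<^sub>v v) = z \<cdot>\<^sub>v (A *\<^sub>v v)"
    if "A \<in> C" "u \<in> W" "v \<in> W" for A u v z
    using C[OF that(1)] c that by (auto simp: mult_add_distrib_mat_vec smult_add_distrib_vec[of _ n] mult_mat_vec)
  show ?thesis
    unfolding is_subspace_iff joint_eigenspace_def using W c zero add smult
    by (auto simp: subspace_zero subspace_add subspace_smult smult_smult_assoc mult.commute)
qed

text \<open>An eigenspace of one operator inside \<open>U\<close> is stable under all operators that
  commute with it, so the remaining ones can be treated there. Finite order is what supplies the
  eigenvector in each step.\<close>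

lemma joint_eigenvector:
  assumes "finite C" and "is_subspace n U" and "v \<in> U" "v \<noteq> 0\<^sub>v n"
    and "\<And>A. A \<in> C \<Longrightarrow> A \<in> carrier_mat n n"
    and "\<And>A u. A \<in> C \<Longrightarrow> u \<in> U \<Longrightarrow> A *\<^sub>v u \<in> U"
    and "\<And>A. A \<in> C \<Longrightarrow> \<exists>m>0. \<forall>u\<in>U. (((*\<^sub>v) A) ^^ m) u = u"
    and "\<And>A B u. A \<in> C \<Longrightarrow> B \<in> C \<Longrightarrow> u \<in> U \<Longrightarrow> A *\<^sub>v (B *\<^sub>v u) = B *\<^sub>v (A *\<^sub>v u)"
  shows "\<exists>w\<in>U. w \<noteq> 0\<^sub>v n \<and> (\<forall>A\<in>C. \<exists>z. A *\<^sub>v w = z \<cdot>\<^sub>v w)"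
  using assms
proof (induction C arbitrary: U v)
  case empty
  then show ?case by blast
next
  case (insert A C)
  obtain m where m: "m > 0" "\<forall>u\<in>U. (((*\<^sub>v) A) ^^ m) u = u" using insert.prems(6)[of A] by blast
  obtain w z where w: "w \<in> U" "w \<noteq> 0\<^sub>v n" "A *\<^sub>v w = z \<cdot>\<^sub>v w"
    using finite_order_eigenvector[of U n A m v] insert.prems m by (metis insertI1)
  let ?U = "{v \<in> U. A *\<^sub>v v = z \<cdot>\<^sub>v v}"
  have c: "u \<in> carrier_vec n" if "u \<in> U" for u using insert.prems(1) that subspace_carrier by blast
  have "\<exists>w\<in>?U. w \<noteq> 0\<^sub>v n \<and> (\<forall>A\<in>C. \<exists>z. A *\<^sub>v w = z \<cdot>\<^sub>v w)"
  proof (rule insert.IH)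
    show "is_subspace n ?U"
      using joint_eigenspace_subspace[OF insert.prems(1), of "{A}" "\<lambda>_. z"] insert.prems(4)
      by (simp add: joint_eigenspace_def)
    show "w \<in> ?U" "w \<noteq> 0\<^sub>v n" using w by auto
    show "\<And>A. A \<in> C \<Longrightarrow> A \<in> carrier_mat n n" using insert.prems by auto
    show "\<exists>m>0. \<forall>u\<in>?U. (((*\<^sub>v) B) ^^ m) u = u" if B: "B \<in> C" for B
      using insert.prems(6)[of B] B by blast
    show "B *\<^sub>v u \<in> ?U" if B: "B \<in> C" "u \<in> ?U" for B u
    proof -
      have "A *\<^sub>v (B *\<^sub>v u) = B *\<^sub>v (A *\<^sub>v u)" using insert.prems(7)[of A B u] B by auto
      also have "\<dots> = z \<cdot>\<^sub>v (B *\<^sub>v u)"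
        using B insert.prems(4)[of B] c by (auto simp: mult_mat_vec)
      finally show ?thesis using insert.prems(5)[of B u] B by auto
    qed
    show "A *\<^sub>v (B *\<^sub>v u) = B *\<^sub>v (A *\<^sub>v u)" if "A \<in> C" "B \<in> C" "u \<in> ?U" for A B u
      using insert.prems(7)[of A B u] that by auto
  qed
  then show ?case by blast
qed

lemma smult_vec_right_cancel:
  fixes v :: "'a::field vec"
  assumes "v \<in> carrier_vec n" "v \<noteq> 0\<^sub>v n" "a \<cdot>\<^sub>v v = b \<cdot>\<^sub>v v"
  shows "a = b"
proof -
  obtain p where "p < n" "v $ p \<noteq> 0"
    using assms(1,2) by (metis carrier_vecD eq_vecI index_zero_vec)
  moreover have "(a \<cdot>\<^sub>v v) $ p = (b \<cdot>\<^sub>v v) $ p" using assms by simp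
  ultimately show ?thesis using assms(1) by simp
qed

text \<open>A single nonzero common vector determines the eigenvalue of every member of
  \<open>C\<close>.\<close>

lemma joint_eigenspace_eqI:
  assumes "is_subspace n W" "v \<noteq> 0\<^sub>v n"
    "v \<in> joint_eigenspace C W \<chi>" "v \<in> joint_eigenspace C W \<psi>"
  shows "joint_eigenspace C W \<chi> = joint_eigenspace C W \<psi>"
proof -
  have "\<chi> A = \<psi> A" if "A \<in> C" for A
  proof (rule smult_vec_right_cancel)
    show "v \<in> carrier_vec n" "v \<noteq> 0\<^sub>v n"
      using assms subspace_carrier[OF assms(1)] by (auto simp: joint_eigenspace_def)
    show "\<chi> A \<cdot>\<^sub>v v = \<psi> A \<cdot>\<^sub>v v"
      using assms(3,4) that unfolding joint_eigenspace_def by (metis (mono_tags, lifting) mem_Collect_eq)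
  qed
  then show ?thesis unfolding joint_eigenspace_def by auto
qed

text \<open>To kill the component in \<open>U\<close>, choose \<open>A\<close> in \<open>C\<close>
  on which the eigenvalues of \<open>U\<close> and of the new space \<open>U0\<close> differ, and
  apply \<open>A - \<chi>0 A\<close> to the vanishing sum. The \<open>U0\<close> component
  disappears, the induction hypothesis covers the rest, and the factor on \<open>U\<close> is
  nonzero.\<close>

lemma joint_eigenspaces_independent:
  assumes W: "is_subspace n W" and C: "\<And>A. A \<in> C \<Longrightarrow> A \<in> carrier_mat n n"
    and "finite X" "X \<subseteq> range (joint_eigenspace C W)"
    and "\<And>U. U \<in> X \<Longrightarrow> u U \<in> U" "vsum n u X = 0\<^sub>v n"
  shows "\<forall>U\<in>X. u U = 0\<^sub>v n"
  using assms(3-6)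
proof (induction X arbitrary: u)
  case empty
  then show ?case by simp
next
  case (insert U0 X)
  obtain \<chi>0 where \<chi>0: "U0 = joint_eigenspace C W \<chi>0" using insert.prems(1) by auto
  have W': "u U \<in> W" if U: "U \<in> insert U0 X" for U
  proof -
    obtain \<chi> where "U = joint_eigenspace C W \<chi>" using insert.prems(1) U by blast
    then show ?thesis using insert.prems(2)[OF U] unfolding joint_eigenspace_def by blast
  qed
  then have uc: "u U \<in> carrier_vec n" if "U \<in> insert U0 X" for U
    using that subspace_carrier[OF W] by blast
  have sub: "is_subspace n U" if "U \<in> insert U0 X" for U
  proof -
    have "U \<in> range (joint_eigenspace C W)" using insert.prems(1) that by blast
    then show ?thesis using joint_eigenspace_subspace[OF W C] by auto
  qed
  have X0: "u U = 0\<^sub>v n" if U: "U \<in> X" for U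
  proof -
    obtain \<chi> where \<chi>: "U = joint_eigenspace C W \<chi>" using insert.prems(1) U by auto
    have "U \<noteq> U0" using insert.hyps U by auto
    then obtain A where A: "A \<in> C" "\<chi> A \<noteq> \<chi>0 A" unfolding \<chi> \<chi>0 joint_eigenspace_def by force
    have ex: "\<exists>z. \<forall>v\<in>U'. A *\<^sub>v v = z \<cdot>\<^sub>v v" if "U' \<in> insert U0 X" for U'
    proof -
      have "U' \<in> range (joint_eigenspace C W)" using insert.prems(1) that by blast
      then show ?thesis using A(1) unfolding joint_eigenspace_def by blast
    qed
    then obtain z where z: "\<And>U' v. U' \<in> insert U0 X \<Longrightarrow> v \<in> U' \<Longrightarrow> A *\<^sub>v v = z U' \<cdot>\<^sub>v v" by metis
    let ?u = "\<lambda>U'. (z U' - \<chi>0 A) \<cdot>\<^sub>v u U'"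
    have "vsum n ?u X = 0\<^sub>v n"
    proof (rule eq_vecI)
      show "dim_vec (vsum n ?u X) = dim_vec (0\<^sub>v n)" using vsum_closed[of X ?u n] uc by auto
      fix p assume "p < dim_vec (0\<^sub>v n)"
      then have p: "p < n" by simp
      have U0: "A *\<^sub>v u U0 = \<chi>0 A \<cdot>\<^sub>v u U0"
        using insert.prems(2)[of U0] A(1) unfolding \<chi>0 joint_eigenspace_def by blast
      have "A *\<^sub>v vsum n u (insert U0 X) = 0\<^sub>v n"
        unfolding insert.prems(3) using C[OF A(1)] by (intro eq_vecI) auto
      moreover have "A *\<^sub>v vsum n u (insert U0 X) = vsum n (\<lambda>U'. A *\<^sub>v u U') (insert U0 X)"
        using insert.hyps uc C[OF A(1)] by (intro mult_mat_vsum) auto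
      ultimately have "vsum n (\<lambda>U'. A *\<^sub>v u U') (insert U0 X) $ p = 0" using p by simp
      moreover have "A *\<^sub>v u U' \<in> carrier_vec n" if "U' \<in> insert U0 X" for U'
        using uc[OF that] C[OF A(1)] by auto
      ultimately have "(\<Sum>U'\<in>insert U0 X. (A *\<^sub>v u U') $ p) = 0"
        using insert.hyps p by (subst (asm) vsum_index) auto
      then have "\<chi>0 A * u U0 $ p + (\<Sum>U'\<in>X. (A *\<^sub>v u U') $ p) = 0"
        using insert.hyps U0 uc[of U0] p by simp
      moreover have "(\<Sum>U'\<in>X. (A *\<^sub>v u U') $ p) = (\<Sum>U'\<in>X. z U' * u U' $ p)"
      proof (intro sum.cong refl)
        fix U' assume "U' \<in> X"
        then show "(A *\<^sub>v u U') $ p = z U' * u U' $ p"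
          using z[of U' "u U'"] insert.prems(2)[of U'] uc[of U'] p by auto
      qed
      moreover have "u U0 $ p + (\<Sum>U'\<in>X. u U' $ p) = 0"
      proof -
        have "vsum n u (insert U0 X) $ p = 0" using insert.prems(3) p by simp
        then show ?thesis using insert.hyps uc p by (subst (asm) vsum_index) auto
      qed
      ultimately have "(\<Sum>U'\<in>X. z U' * u U' $ p) - \<chi>0 A * (\<Sum>U'\<in>X. u U' $ p) = 0"
        by (metis add_eq_0_iff minus_mult_right eq_neg_iff_add_eq_0 add.inverse_inverse diff_self)
      moreover have "vsum n ?u X $ p = (\<Sum>U'\<in>X. (z U' - \<chi>0 A) * u U' $ p)"
      proof -
        have d: "dim_vec (u U') = n" if "U' \<in> X" for U' using uc[of U'] that by auto
        show ?thesis using insert.hyps uc p by (subst vsum_index) (auto simp: d)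
      qed
      ultimately show "vsum n ?u X $ p = 0\<^sub>v n $ p"
        using p by (simp add: sum_distrib_left sum_subtractf left_diff_distrib)
    qed
    moreover have "?u U' \<in> U'" if "U' \<in> X" for U'
      using insert.prems(2)[of U'] that sub[of U'] by (intro subspace_smult) auto
    ultimately have "?u U = 0\<^sub>v n" using insert.IH[of ?u] insert.prems(1) U by auto
    moreover have "z U \<noteq> \<chi>0 A \<or> u U = 0\<^sub>v n"
    proof (cases "u U = 0\<^sub>v n")
      case False
      have uU: "u U \<in> U" using insert.prems(2) U by auto
      have "z U \<cdot>\<^sub>v u U = \<chi> A \<cdot>\<^sub>v u U"
        using z[of U "u U"] U uU A(1) unfolding \<chi> joint_eigenspace_def by force
      then have "z U = \<chi> A" using smult_vec_right_cancel[OF uc False] U by auto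
      then show ?thesis using A by auto
    qed simp
    ultimately show ?thesis
      using smult_vec_right_cancel[OF uc, of U "z U - \<chi>0 A" 0] U uc[of U] by fastforce
  qed
  have "u U0 = 0\<^sub>v n"
  proof (rule eq_vecI)
    show "dim_vec (u U0) = dim_vec (0\<^sub>v n)" using uc[of U0] by auto
    fix p assume "p < dim_vec (0\<^sub>v n)"
    then have p: "p < n" by simp
    have "vsum n u (insert U0 X) $ p = 0" using insert.prems(3) p by simp
    then have "u U0 $ p + (\<Sum>U'\<in>X. u U' $ p) = 0"
      using insert.hyps uc p by (subst (asm) vsum_index) auto
    moreover have "(\<Sum>U'\<in>X. u U' $ p) = 0" using X0 p by (intro sum.neutral) auto
    ultimately show "u U0 $ p = 0\<^sub>v n $ p" using p by simp
  qed
  with X0 show ?case by auto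
qed

lemma funpow_eigenvector:
  assumes "A \<in> carrier_mat n n" "v \<in> carrier_vec n" "A *\<^sub>v v = z \<cdot>\<^sub>v (v :: complex vec)"
  shows "(((*\<^sub>v) A) ^^ m) v = z ^ m \<cdot>\<^sub>v v"
  by (induction m) (use assms in \<open>auto simp: mult_mat_vec smult_smult_assoc mult.commute\<close>)

text \<open>\<open>S\<close> permutes the joint eigenspaces of \<open>C\<close>. Their sum is direct, and it is \<open>W\<close> by irreducibility; so by
  primitivity one of them is \<open>W\<close>.\<close>

lemma primitive_commuting_scalar:
  assumes prim: "acts_primitively n S W"
    and S: "\<And>s. s \<in> S \<Longrightarrow> s \<in> carrier_mat n n"
    and inv: "\<And>s. s \<in> S \<Longrightarrow> \<exists>t\<in>S. \<forall>v\<in>W. t *\<^sub>v (s *\<^sub>v v) = v \<and> s *\<^sub>v (t *\<^sub>v v) = v"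
    and fin: "finite C" and C: "\<And>A. A \<in> C \<Longrightarrow> A \<in> carrier_mat n n"
    and CW: "\<And>A v. A \<in> C \<Longrightarrow> v \<in> W \<Longrightarrow> A *\<^sub>v v \<in> W"
    and ord: "\<And>A. A \<in> C \<Longrightarrow> \<exists>m>0. \<forall>v\<in>W. (((*\<^sub>v) A) ^^ m) v = v"
    and comm: "\<And>A B v. A \<in> C \<Longrightarrow> B \<in> C \<Longrightarrow> v \<in> W \<Longrightarrow> A *\<^sub>v (B *\<^sub>v v) = B *\<^sub>v (A *\<^sub>v v)"
    and conj: "\<And>s A. s \<in> S \<Longrightarrow> A \<in> C \<Longrightarrow> \<exists>B\<in>C. \<forall>v\<in>W. A *\<^sub>v (s *\<^sub>v v) = s *\<^sub>v (B *\<^sub>v v)"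
    and A: "A \<in> C"
  shows "\<exists>z. \<forall>v\<in>W. A *\<^sub>v v = z \<cdot>\<^sub>v v"
proof -
  note irr = prim[unfolded acts_primitively_def acts_irreducibly_def]
  have W: "is_subspace n W" and W0: "W \<noteq> {0\<^sub>v n}" and sW: "\<And>s. s \<in> S \<Longrightarrow> translate s W = W"
    using irr by auto
  have Wc: "v \<in> carrier_vec n" if "v \<in> W" for v using W that subspace_carrier by blast
  have sWm: "s *\<^sub>v v \<in> W" if "s \<in> S" "v \<in> W" for s v using sW[OF that(1)] that(2) unfolding translate_def by blast
  let ?E = "joint_eigenspace C W"
  \<comment> \<open>The zero space is excluded so that every member has a nonzero vector, by which
    it can be recognised.\<close>
  define P where "P = range ?E - {{0\<^sub>v n}}"
  have Esub: "is_subspace n U" if "U \<in> P" for U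
    using that joint_eigenspace_subspace[OF W C] unfolding P_def by blast
  have EW: "U \<subseteq> W" if "U \<in> P" for U using that unfolding P_def joint_eigenspace_def by blast
  have nz: "\<exists>v\<in>U. v \<noteq> 0\<^sub>v n" if "U \<in> P" for U
    using subspace_zero[OF Esub[OF that]] that unfolding P_def by blast
  \<comment> \<open>Operators of finite order have roots of unity as eigenvalues, which leaves
    finitely many choices of \<open>\<chi>\<close> on \<open>C\<close>.\<close>
  have finP: "finite P"
  proof -
    obtain m where m: "\<And>A. A \<in> C \<Longrightarrow> m A > 0 \<and> (\<forall>v\<in>W. (((*\<^sub>v) A) ^^ m A) v = v)" using ord by metis
    have "P \<subseteq> ?E ` (\<Pi>\<^sub>E A\<in>C. {z. z ^ m A = 1})"
    proof
      fix U assume U: "U \<in> P"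
      then obtain \<chi> where \<chi>: "U = ?E \<chi>" unfolding P_def by auto
      obtain v where v: "v \<in> U" "v \<noteq> 0\<^sub>v n" using nz[OF U] by blast
      have vW: "v \<in> W" using v EW[OF U] by auto
      have "\<chi> A ^ m A = 1" if "A \<in> C" for A
      proof (rule smult_vec_right_cancel[OF Wc[OF vW] v(2)])
        have "A *\<^sub>v v = \<chi> A \<cdot>\<^sub>v v" using v that unfolding \<chi> joint_eigenspace_def by auto
        from funpow_eigenvector[OF C[OF that] Wc[OF vW] this, of "m A"]
        show "\<chi> A ^ m A \<cdot>\<^sub>v v = 1 \<cdot>\<^sub>v v" using m[OF that] vW by auto
      qed
      moreover have "U = ?E (restrict \<chi> C)" unfolding \<chi> joint_eigenspace_def by auto
      ultimately show "U \<in> ?E ` (\<Pi>\<^sub>E A\<in>C. {z. z ^ m A = 1})" by auto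
    qed
    moreover have "finite {z::complex. z ^ m A = 1}" if "A \<in> C" for A
      using m[OF that] by (intro finite_roots_unity) auto
    ultimately show ?thesis using fin by (meson finite_PiE finite_imageI finite_subset)
  qed
  \<comment> \<open>\<open>B A\<close> plays the role of the conjugate of \<open>A\<close> by the
    inverse of \<open>s\<close>; thus \<open>s\<close> maps eigenvectors for \<open>\<chi>\<close>
    to eigenvectors for \<open>\<chi> \<circ> B\<close>.\<close>
  have move: "\<exists>\<psi>. translate s (?E \<chi>) \<subseteq> ?E \<psi>" if s: "s \<in> S" for s \<chi>
  proof -
    obtain B where B: "\<And>A. A \<in> C \<Longrightarrow> B A \<in> C \<and> (\<forall>v\<in>W. A *\<^sub>v (s *\<^sub>v v) = s *\<^sub>v (B A *\<^sub>v v))"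
      using conj[OF s] by metis
    have "translate s (?E \<chi>) \<subseteq> ?E (\<lambda>A. \<chi> (B A))"
    proof
      fix w assume "w \<in> translate s (?E \<chi>)"
      then obtain v where v: "v \<in> ?E \<chi>" "w = s *\<^sub>v v" unfolding translate_def by auto
      have vW: "v \<in> W" using v unfolding joint_eigenspace_def by auto
      have "A *\<^sub>v w = \<chi> (B A) \<cdot>\<^sub>v w" if "A \<in> C" for A
      proof -
        have "A *\<^sub>v w = s *\<^sub>v (B A *\<^sub>v v)" using B[OF that] vW v by auto
        also have "B A *\<^sub>v v = \<chi> (B A) \<cdot>\<^sub>v v" using v(1) B[OF that] unfolding joint_eigenspace_def by auto
        finally show ?thesis using v(2) S[OF s] Wc[OF vW] by (simp add: mult_mat_vec)
      qed
      then show "w \<in> ?E (\<lambda>A. \<chi> (B A))" using sWm[OF s vW] v unfolding joint_eigenspace_def by auto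
    qed
    then show ?thesis by blast
  qed
  have zero: "s *\<^sub>v 0\<^sub>v n = 0\<^sub>v n" if "s \<in> S" for s using S[OF that] by (intro eq_vecI) auto
  \<comment> \<open>So far \<open>s\<close> only maps into another eigenspace. Coming back with the
    inverse \<open>t\<close> ends in \<open>U\<close> again, as witnessed by one nonzero vector, and
    this forces equality.\<close>
  have perm: "translate s U \<in> P" if s: "s \<in> S" and U: "U \<in> P" for s U
  proof -
    obtain t where t: "t \<in> S" "\<And>v. v \<in> W \<Longrightarrow> t *\<^sub>v (s *\<^sub>v v) = v" "\<And>v. v \<in> W \<Longrightarrow> s *\<^sub>v (t *\<^sub>v v) = v"
      using inv[OF s] by blast
    obtain \<chi> where \<chi>: "U = ?E \<chi>" using U unfolding P_def by auto
    obtain \<psi> where \<psi>: "translate s U \<subseteq> ?E \<psi>" using move[OF s] \<chi> by blast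
    obtain \<omega> where \<omega>: "translate t (?E \<psi>) \<subseteq> ?E \<omega>" using move[OF t(1)] by blast
    obtain v where v: "v \<in> U" "v \<noteq> 0\<^sub>v n" using nz[OF U] by blast
    have vW: "v \<in> W" using v EW[OF U] by auto
    have "s *\<^sub>v v \<in> ?E \<psi>" using \<psi> v unfolding translate_def by blast
    then have "t *\<^sub>v (s *\<^sub>v v) \<in> ?E \<omega>" using \<omega> unfolding translate_def by blast
    then have "v \<in> ?E \<omega>" using t(2)[OF vW] by simp
    then have eq: "?E \<omega> = U" using joint_eigenspace_eqI[OF W v(2)] v(1) \<chi> by blast
    have "?E \<psi> \<subseteq> translate s U"
    proof
      fix w assume w: "w \<in> ?E \<psi>"
      then have "t *\<^sub>v w \<in> U" using \<omega> eq unfolding translate_def by blast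
      moreover have "w \<in> W" using w unfolding joint_eigenspace_def by blast
      ultimately show "w \<in> translate s U" using t(3)[of w] unfolding translate_def by (metis image_eqI)
    qed
    with \<psi> have "translate s U = ?E \<psi>" by blast
    moreover have "?E \<psi> \<noteq> {0\<^sub>v n}"
    proof
      assume "?E \<psi> = {0\<^sub>v n}"
      then have "s *\<^sub>v v = 0\<^sub>v n" using \<psi> v unfolding translate_def by blast
      then have "t *\<^sub>v (s *\<^sub>v v) = 0\<^sub>v n" using zero[OF t(1)] by simp
      then show False using t(2)[OF vW] v by simp
    qed
    ultimately show ?thesis unfolding P_def by blast
  qed
  define T where "T = family_sum n P (\<lambda>U. U)"
  have T_iff: "v \<in> T \<longleftrightarrow> (\<exists>u. (\<forall>U\<in>P. u U \<in> U) \<and> v = vsum n u P)" for v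
    unfolding T_def using finP Esub by (rule family_sum_iff)
  have Tsub: "is_subspace n T" unfolding T_def using finP Esub by (rule family_sum_subspace)
  have uc: "u U \<in> carrier_vec n" if "\<forall>U\<in>P. u U \<in> U" "U \<in> P" for u U
    using that EW Wc by blast
  have TW: "T \<subseteq> W"
  proof
    fix v assume "v \<in> T"
    then obtain u where "\<forall>U\<in>P. u U \<in> U" "v = vsum n u P" unfolding T_iff by blast
    then show "v \<in> W" using finP EW by (auto intro!: vsum_in_subspace[OF W])
  qed
  have PT: "v \<in> T" if "U \<in> P" "v \<in> U" for U v
  proof -
    have "v \<in> carrier_vec n" using that EW Wc by blast
    from vsum_single[OF finP that(1) this] show ?thesis
      unfolding T_iff using that subspace_zero[OF Esub]
      by (intro exI[of _ "\<lambda>V. if V = U then v else 0\<^sub>v n"]) auto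
  qed
  have Tinv1: "s *\<^sub>v a \<in> T" if "s \<in> S" and a: "a \<in> T" for s a
  proof -
    obtain u where u: "a = vsum n u P" "\<forall>U\<in>P. u U \<in> U" using a unfolding T_iff by blast
    have "s *\<^sub>v a = vsum n (\<lambda>U. s *\<^sub>v u U) P"
      unfolding u(1) using finP uc[OF u(2)] S[OF \<open>s \<in> S\<close>] by (intro mult_mat_vsum) auto
    moreover have "s *\<^sub>v u U \<in> T" if "U \<in> P" for U
      using PT[OF perm[OF \<open>s \<in> S\<close> that]] u(2) that unfolding translate_def by blast
    ultimately show ?thesis using vsum_in_subspace[OF Tsub finP] by simp
  qed
  have "translate s T = T" if s: "s \<in> S" for s
  proof
    show "translate s T \<subseteq> T" using Tinv1[OF s] unfolding translate_def by blast
    obtain t where t: "t \<in> S" "\<And>v. v \<in> W \<Longrightarrow> s *\<^sub>v (t *\<^sub>v v) = v" using inv[OF s] by blast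
    show "T \<subseteq> translate s T"
    proof
      fix a assume a: "a \<in> T"
      then have "a = s *\<^sub>v (t *\<^sub>v a)" using t TW by auto
      then show "a \<in> translate s T" unfolding translate_def using Tinv1[OF t(1) a] by blast
    qed
  qed
  moreover have "T \<noteq> {0\<^sub>v n}"
  proof -
    obtain v where "v \<in> W" "v \<noteq> 0\<^sub>v n" using W0 subspace_zero[OF W] by blast
    then have "\<exists>w\<in>W. w \<noteq> 0\<^sub>v n \<and> (\<forall>A\<in>C. \<exists>z. A *\<^sub>v w = z \<cdot>\<^sub>v w)"
      by (intro joint_eigenvector[OF fin W]) (use C CW ord comm in auto)
    then obtain w where w: "w \<in> W" "w \<noteq> 0\<^sub>v n" "\<forall>A\<in>C. \<exists>z. A *\<^sub>v w = z \<cdot>\<^sub>v w"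
      by blast
    then obtain \<chi> where "\<forall>A\<in>C. A *\<^sub>v w = \<chi> A \<cdot>\<^sub>v w" by metis
    then have "w \<in> ?E \<chi>" unfolding joint_eigenspace_def using w by auto
    then have "w \<in> T" using PT[of "?E \<chi>" w] w unfolding P_def by blast
    then show ?thesis using w by auto
  qed
  ultimately have TW': "T = W" using irr Tsub TW by blast
  have "is_direct_sum n W P (\<lambda>U. U)"
  proof (rule is_direct_sumI[OF finP W Esub EW])
    show "\<exists>u. (\<forall>U\<in>P. u U \<in> U) \<and> w = vsum n u P" if "w \<in> W" for w
      using that unfolding TW'[symmetric] T_iff .
    show "u U = 0\<^sub>v n" if "\<And>U. U \<in> P \<Longrightarrow> u U \<in> U" "vsum n u P = 0\<^sub>v n" "U \<in> P" for u U
      using joint_eigenspaces_independent[OF W C finP _ that(1,2)] that(3) unfolding P_def by blast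
  qed auto
  then have "\<not> (\<forall>U\<in>P. U \<subset> W)" using prim perm unfolding acts_primitively_def by blast
  then obtain U where "U \<in> P" "U = W" using EW by blast
  then obtain \<chi> where "W = ?E \<chi>" unfolding P_def by blast
  then have "\<forall>v\<in>W. A *\<^sub>v v = \<chi> A \<cdot>\<^sub>v v" using A unfolding joint_eigenspace_def by blast
  then show ?thesis by blast
qed

subsection \<open>Matrix groups\<close>

text \<open>A group given as a bare set with the multiplication and identity of matrices, so that
  the rules for matrices apply directly. It is instantiated with \<open>G\<close>, with stabilizers,
  with \<open>kernel\<close>, and with the matrices of an action on a block.\<close>

locale matrix_group =
  fixes n :: nat and \<Gamma> :: "complex mat set"
  assumes carrier: "\<Gamma> \<subseteq> carrier_mat n n"
    and one: "1\<^sub>m n \<in> \<Gamma>"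
    and mult: "g \<in> \<Gamma> \<Longrightarrow> h \<in> \<Gamma> \<Longrightarrow> g * h \<in> \<Gamma>"
    and inverse: "g \<in> \<Gamma> \<Longrightarrow> \<exists>h\<in>\<Gamma>. g * h = 1\<^sub>m n \<and> h * g = 1\<^sub>m n"
begin

lemma in_carrier: "g \<in> \<Gamma> \<Longrightarrow> g \<in> carrier_mat n n"
  using carrier by auto

lemma dims [simp]: "g \<in> \<Gamma> \<Longrightarrow> dim_row g = n" "g \<in> \<Gamma> \<Longrightarrow> dim_col g = n"
  using in_carrier by auto

lemma mult_vec_carrier [simp]: "g \<in> \<Gamma> \<Longrightarrow> g *\<^sub>v v \<in> carrier_vec n"
  by (metis carrier_vec_dim_vec dim_mult_mat_vec dims(1))

lemma mult_vec_zero [simp]: "g \<in> \<Gamma> \<Longrightarrow> g *\<^sub>v 0\<^sub>v n = 0\<^sub>v n"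
  by (intro eq_vecI) (auto simp: scalar_prod_def)

definition minv :: "complex mat \<Rightarrow> complex mat" where
  "minv g = (SOME h. h \<in> \<Gamma> \<and> g * h = 1\<^sub>m n \<and> h * g = 1\<^sub>m n)"

lemma minv:
  assumes "g \<in> \<Gamma>"
  shows "minv g \<in> \<Gamma>" "g * minv g = 1\<^sub>m n" "minv g * g = 1\<^sub>m n"
proof -
  have "\<exists>h. h \<in> \<Gamma> \<and> g * h = 1\<^sub>m n \<and> h * g = 1\<^sub>m n"
    using inverse[OF assms] by auto
  from someI_ex[OF this]
  show "minv g \<in> \<Gamma>" "g * minv g = 1\<^sub>m n" "minv g * g = 1\<^sub>m n"
    unfolding minv_def by auto
qed

lemma mult_vec: "g \<in> \<Gamma> \<Longrightarrow> h \<in> \<Gamma> \<Longrightarrow> v \<in> carrier_vec n \<Longrightarrow> (g * h) *\<^sub>v v = g *\<^sub>v (h *\<^sub>v v)"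
  by (intro assoc_mult_mat_vec[of _ n n _ n] in_carrier)

lemma minv_mult_vec:
  assumes "g \<in> \<Gamma>" "v \<in> carrier_vec n"
  shows "minv g *\<^sub>v (g *\<^sub>v v) = v" "g *\<^sub>v (minv g *\<^sub>v v) = v"
  using assms minv[OF assms(1)] by (simp_all flip: mult_vec)

lemma mult_assoc: "g \<in> \<Gamma> \<Longrightarrow> h \<in> \<Gamma> \<Longrightarrow> k \<in> \<Gamma> \<Longrightarrow> g * h * k = g * (h * k)"
  by (intro assoc_mult_mat[of _ n n _ n _ n] in_carrier)

lemma left_cancel:
  assumes "g \<in> \<Gamma>" "h \<in> \<Gamma>" "k \<in> \<Gamma>" "g * h = g * k"
  shows "h = k"
proof -
  have "minv g * (g * h) = minv g * (g * k)" using assms by simp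
  then show ?thesis using assms minv[OF assms(1)]
    by (metis in_carrier left_mult_one_mat mult_assoc)
qed

text \<open>Two powers coincide by the pigeonhole principle, and cancellation leaves a power equal
  to 1. Iterates on vectors are the form required by the eigenvector argument.\<close>

lemma finite_order:
  assumes "finite \<Gamma>" "g \<in> \<Gamma>"
  shows "\<exists>m>0. \<forall>v\<in>carrier_vec n. (((*\<^sub>v) g) ^^ m) v = v"
proof -
  have pow: "g ^\<^sub>m i \<in> \<Gamma>" for i
    by (induction i) (use assms one mult in \<open>auto simp: dims\<close>)
  have pow_add: "g ^\<^sub>m i * g ^\<^sub>m k = g ^\<^sub>m (i + k)" for i k
    by (induction k) (use assms pow in \<open>auto simp flip: mult_assoc intro!: right_mult_one_mat in_carrier\<close>)
  have "\<not> inj (\<lambda>i. g ^\<^sub>m i)"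
    using assms(1) pow by (metis finite_subset image_subset_iff infinite_UNIV_nat finite_imageD)
  then obtain i j where "i \<noteq> j" "g ^\<^sub>m i = g ^\<^sub>m j" unfolding inj_def by blast
  then obtain i j where ij: "i < j" "g ^\<^sub>m i = g ^\<^sub>m j" by (metis linorder_neqE_nat)
  have "g ^\<^sub>m i * g ^\<^sub>m (j - i) = g ^\<^sub>m i * 1\<^sub>m n"
    using ij pow_add[of i "j - i"] in_carrier[OF pow[of i]] by auto
  then have eq: "g ^\<^sub>m (j - i) = 1\<^sub>m n" using left_cancel pow one by blast
  have it: "(((*\<^sub>v) g) ^^ k) v = g ^\<^sub>m k *\<^sub>v v" if "v \<in> carrier_vec n" for k v
    using that
  proof (induction k arbitrary: v)
    case (Suc k)
    then show ?case
      using assms(2) pow[of k] by (simp add: funpow_Suc_right mult_vec del: funpow.simps)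
  qed (use assms(2) in simp)
  show ?thesis using ij eq it by (intro exI[of _ "j - i"]) auto
qed

end

lemma matrix_group_subgroup_GL:
  assumes "subgroup G (GL n)"
  shows "matrix_group n G"
proof -
  interpret subgroup G "GL n" by (rule assms)
  have U: "x \<in> Units (ring_mat TYPE(complex) n ())" if "x \<in> G" for x
    using mem_carrier[OF that] unfolding GL_def units_of_def by simp
  have mult: "mult (GL n) = (*)" "monoid.one (GL n) = 1\<^sub>m n"
    unfolding GL_def units_of_def by (auto simp: ring_mat_simps)
  interpret R: ring "ring_mat TYPE(complex) n ()" by (rule ring_mat)
  have gr: "group (GL n)" unfolding GL_def by (rule R.units_group)
  show ?thesis
  proof
    show "G \<subseteq> carrier_mat n n" using U by (auto simp: Units_def ring_mat_simps)
    show "1\<^sub>m n \<in> G" using one_closed mult by simp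
    show "g * h \<in> G" if "g \<in> G" "h \<in> G" for g h using m_closed[OF that] mult by simp
    show "\<exists>h\<in>G. g * h = 1\<^sub>m n \<and> h * g = 1\<^sub>m n" if "g \<in> G" for g
      using m_inv_closed[OF that] group.r_inv[OF gr mem_carrier[OF that]]
        group.l_inv[OF gr mem_carrier[OF that]] mult by auto
  qed
qed

section \<open>Coordinates in which a finite irreducible group has bounded entries\<close>

lemma det_nonzero_inverse:
  fixes A :: "'a::field mat"
  assumes "A \<in> carrier_mat n n" "det A \<noteq> 0"
  obtains B where "B \<in> carrier_mat n n" "B * A = 1\<^sub>m n" "A * B = 1\<^sub>m n"
  using det_non_zero_imp_unit[OF assms, of "()"] unfolding Units_def by (auto simp: ring_mat_simps)

text \<open>With \<open>B\<close> the inverse of a basis matrix, this is the hyperplane where the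
  \<open>k\<close>-th coordinate in that basis vanishes. A spanning orbit cannot lie inside
  it.\<close>

lemma kernel_coordinate_subspace:
  assumes "B \<in> carrier_mat n n" "k < n"
  shows "is_subspace n {b \<in> carrier_vec n. (B *\<^sub>v b) $ k = 0}"
  unfolding is_subspace_iff using assms
  by (auto simp: mult_add_distrib_mat_vec mult_mat_vec simp del: index_mult_mat_vec)
    (auto simp: scalar_prod_def)

lemma col_replace_col:
  assumes "A \<in> carrier_mat n n" "b \<in> carrier_vec n" "k < n" "j < n"
  shows "col (replace_col A b k) j = (if j = k then b else col A j)"
  using assms unfolding replace_col_def by (intro eq_vecI) auto

text \<open>Among the bases contained in an orbit we choose one whose determinant has maximal absolute
  value. By Cramer's rule, all vectors of the orbit have coordinates of absolute value at most 1
  with respect to it.\<close>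

lemma (in matrix_group) bounded_conjugate:
  assumes fin: "finite \<Gamma>" and irr: "acts_irreducibly n \<Gamma> (carrier_vec n)"
  obtains A B where "A \<in> carrier_mat n n" "B \<in> carrier_mat n n" "A * B = 1\<^sub>m n" "B * A = 1\<^sub>m n"
    "\<And>g i j. g \<in> \<Gamma> \<Longrightarrow> i < n \<Longrightarrow> j < n \<Longrightarrow> cmod ((B * g * A) $$ (i, j)) \<le> 1"
proof -
  obtain v :: "complex vec" where v: "v \<in> carrier_vec n" "v \<noteq> 0\<^sub>v n"
    using irr unfolding acts_irreducibly_def by (metis (no_types, lifting) singletonI subsetI subset_antisym subset_singletonD zero_carrier_vec singleton_iff empty_iff)
  define Orb where "Orb = (\<lambda>g. g *\<^sub>v v) ` \<Gamma>"
  have Oc: "w \<in> carrier_vec n" if "w \<in> Orb" for w using that v unfolding Orb_def by auto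
  have full: "U = carrier_vec n" if U: "is_subspace n U" "Orb \<subseteq> U" for U
  proof -
    \<comment> \<open>The largest stable subset of \<open>U\<close>. It contains the nonzero vector
      \<open>v\<close> because the whole orbit lies in \<open>U\<close>, so irreducibility makes it
      the full space.\<close>
    let ?T = "{u \<in> carrier_vec n. \<forall>g\<in>\<Gamma>. g *\<^sub>v u \<in> U}"
    have "is_subspace n ?T"
      unfolding is_subspace_iff
    proof (intro conjI ballI allI)
      show "0\<^sub>v n \<in> ?T" using subspace_zero[OF U(1)] by auto
    qed (use U(1) in \<open>auto simp: mult_add_distrib_mat_vec[OF in_carrier] mult_mat_vec[OF in_carrier]
          intro!: subspace_add[OF U(1)] subspace_smult[OF U(1)]\<close>)
    moreover have inv_in: "translate g ?T \<subseteq> ?T" if g: "g \<in> \<Gamma>" for g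
      using g mult by (auto simp: translate_def simp flip: mult_vec)
    have "translate g ?T = ?T" if g: "g \<in> \<Gamma>" for g
    proof
      show "?T \<subseteq> translate g ?T"
      proof
        fix u assume u: "u \<in> ?T"
        then have "minv g *\<^sub>v u \<in> ?T" using inv_in[OF minv(1)[OF g]] unfolding translate_def by blast
        then have "g *\<^sub>v (minv g *\<^sub>v u) \<in> translate g ?T" unfolding translate_def by blast
        then show "u \<in> translate g ?T" using minv_mult_vec(2)[OF g, of u] u by auto
      qed
    qed (rule inv_in[OF g])
    moreover have "v \<in> ?T" using v U(2) unfolding Orb_def by auto
    ultimately have "?T = carrier_vec n" using irr v(2) unfolding acts_irreducibly_def by blast
    then have "\<forall>u\<in>carrier_vec n. 1\<^sub>m n *\<^sub>v u \<in> U" using one by blast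
    then show ?thesis using subspace_carrier[OF U(1)] by auto
  qed
  define M where "M = {A \<in> carrier_mat n n. \<forall>j<n. col A j \<in> Orb}"
  \<comment> \<open>Exchange argument: starting from the identity matrix, columns are replaced by
    orbit vectors one at a time with nonzero determinant throughout; a suitable vector exists
    because the orbit spans.\<close>
  have "\<exists>A\<in>carrier_mat n n. det A \<noteq> 0 \<and> (\<forall>j<k. col A j \<in> Orb)" if "k \<le> n" for k
    using that
  proof (induction k)
    case 0
    then show ?case by (intro bexI[of _ "1\<^sub>m n"]) auto
  next
    case (Suc k)
    then obtain A where A: "A \<in> carrier_mat n n" "det A \<noteq> 0" "\<forall>j<k. col A j \<in> Orb" by auto
    obtain B where B: "B \<in> carrier_mat n n" "B * A = 1\<^sub>m n" "A * B = 1\<^sub>m n"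
      using det_nonzero_inverse A(1,2) by blast
    have k: "k < n" using Suc by simp
    let ?U = "{b \<in> carrier_vec n. (B *\<^sub>v b) $ k = 0}"
    have "?U \<noteq> carrier_vec n"
    proof
      assume U: "?U = carrier_vec n"
      have "A *\<^sub>v unit_vec n k \<in> carrier_vec n" using A by auto
      then have "(B *\<^sub>v (A *\<^sub>v unit_vec n k)) $ k = 0" using U by blast
      moreover have "B *\<^sub>v (A *\<^sub>v unit_vec n k) = unit_vec n k"
        using A B by (simp flip: assoc_mult_mat_vec)
      ultimately show False using k by simp
    qed
    then have "\<not> Orb \<subseteq> ?U" using full[OF kernel_coordinate_subspace[OF B(1) k]] by blast
    then obtain b where b: "b \<in> Orb" "(B *\<^sub>v b) $ k \<noteq> 0" using Oc by blast
    have "A *\<^sub>v (B *\<^sub>v b) = b" using A B Oc[OF b(1)] by (simp flip: assoc_mult_mat_vec)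
    then have "det (replace_col A b k) = (B *\<^sub>v b) $ k * det A"
      using cramer_lemma_mat[OF A(1) _ k, of "B *\<^sub>v b"] B Oc[OF b(1)] by auto
    moreover have "col (replace_col A b k) j \<in> Orb" if "j < Suc k" for j
      using col_replace_col[OF A(1) Oc[OF b(1)] k, of j] A(3) b(1) k that by simp
    moreover have "replace_col A b k \<in> carrier_mat n n" using A unfolding replace_col_def by auto
    ultimately show ?case using b A(2) by (intro bexI[of _ "replace_col A b k"]) auto
  qed
  from this[of n] obtain A0 where A0: "A0 \<in> M" "det A0 \<noteq> 0" unfolding M_def by auto
  have "finite Orb" unfolding Orb_def using fin by simp
  moreover have "inj_on (\<lambda>A. \<lambda>j\<in>{..<n}. col A j) M"
  proof (rule inj_onI)
    fix A B assume AB: "A \<in> M" "B \<in> M" "(\<lambda>j\<in>{..<n}. col A j) = (\<lambda>j\<in>{..<n}. col B j)"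
    have "col A j = col B j" if "j < n" for j using fun_cong[OF AB(3), of j] that by auto
    then show "A = B" using AB(1,2) unfolding M_def by (intro mat_col_eqI) auto
  qed
  moreover have "(\<lambda>A. \<lambda>j\<in>{..<n}. col A j) ` M \<subseteq> (\<Pi>\<^sub>E j\<in>{..<n}. Orb)" unfolding M_def by auto
  ultimately have "finite M" by (meson finite_PiE finite_lessThan finite_subset finite_imageD)
  then obtain A where A: "A \<in> M" "\<And>A'. A' \<in> M \<Longrightarrow> cmod (det A') \<le> cmod (det A)"
    using A0(1) obtains_MAX[of M "\<lambda>A. cmod (det A)"] by (metis Max_ge empty_iff finite_imageI image_eqI)
  have Ac: "A \<in> carrier_mat n n" using A unfolding M_def by auto
  have dA: "det A \<noteq> 0" using A(2)[OF A0(1)] A0(2) by auto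
  obtain B where B: "B \<in> carrier_mat n n" "B * A = 1\<^sub>m n" "A * B = 1\<^sub>m n"
    using det_nonzero_inverse Ac dA by blast
  have le: "cmod ((B *\<^sub>v b) $ k) \<le> 1" if b: "b \<in> Orb" and k: "k < n" for b k
  proof -
    have "A *\<^sub>v (B *\<^sub>v b) = b" using Ac B Oc[OF b(1)] by (simp flip: assoc_mult_mat_vec)
    then have "det (replace_col A b k) = (B *\<^sub>v b) $ k * det A"
      using cramer_lemma_mat[OF Ac _ k, of "B *\<^sub>v b"] B Oc[OF b(1)] by auto
    moreover have "replace_col A b k \<in> M"
      using col_replace_col[OF Ac Oc[OF b] k] A(1) Ac b unfolding M_def by (auto simp: replace_col_def)
    ultimately have "cmod ((B *\<^sub>v b) $ k) * cmod (det A) \<le> 1 * cmod (det A)"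
      using A(2)[of "replace_col A b k"] by (simp add: norm_mult)
    then show ?thesis using dA by simp
  qed
  show ?thesis
  proof (rule that[OF Ac B(1,3,2)])
    fix g i j assume g: "g \<in> \<Gamma>" and ij: "i < n" "j < n"
    \<comment> \<open>This entry is the \<open>i\<close>-th coordinate, in the basis
      \<open>A\<close>, of the image under \<open>g\<close> of the \<open>j\<close>-th basis vector,
      which is again an orbit vector.\<close>
    have "(B * g * A) $$ (i, j) = col (B * (g * A)) j $ i"
      using g ij Ac B in_carrier[OF g] by (simp add: assoc_mult_mat[of B n n g n A n] del: index_mult_mat(1))
    also have "col (B * (g * A)) j = B *\<^sub>v (g *\<^sub>v col A j)"
      using ij Ac B in_carrier[OF g] by (simp only: col_mult2[of B n n _ n] col_mult2[of g n n A n] mult_carrier_mat)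
    finally have "(B * g * A) $$ (i, j) = (B *\<^sub>v (g *\<^sub>v col A j)) $ i" .
    moreover have "g *\<^sub>v col A j \<in> Orb"
    proof -
      have "col A j \<in> Orb" using A ij unfolding M_def by auto
      then obtain h where h: "h \<in> \<Gamma>" "col A j = h *\<^sub>v v" unfolding Orb_def by auto
      then have "g *\<^sub>v col A j = (g * h) *\<^sub>v v" using g v by (simp add: mult_vec)
      then show ?thesis unfolding Orb_def using mult[OF g h(1)] by blast
    qed
    ultimately show "cmod ((B * g * A) $$ (i, j)) \<le> 1" using le ij by simp
  qed
qed

text \<open>The powers of a nontrivial \<open>n\<close>-th root of unity sum to 0. But each of the
  \<open>n\<close> summands is within \<open>n * cmod (z - 1)\<close> of 1, so the sum would stay
  away from 0; this explains the square in the hypothesis.\<close>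

lemma root_of_unity_near_one:
  fixes z :: complex
  assumes "z ^ n = 1" "n > 0" "real n ^ 2 * cmod (z - 1) < 1"
  shows "z = 1"
proof (rule ccontr)
  assume "z \<noteq> 1"
  have "cmod z ^ n = 1" using assms(1) by (metis norm_one norm_power)
  then have nz: "cmod z = 1" using assms(2) power_eq_iff_eq_base[of n "cmod z" 1] by simp
  have j: "cmod (z ^ j - 1) \<le> real j * cmod (z - 1)" for j
  proof (induction j)
    case (Suc j)
    have eq: "z ^ Suc j - 1 = z * (z ^ j - 1) + (z - 1)" by (simp add: algebra_simps)
    have "cmod (z ^ Suc j - 1) \<le> cmod (z ^ j - 1) + cmod (z - 1)"
      using norm_triangle_ineq[of "z * (z ^ j - 1)" "z - 1"] nz unfolding eq norm_mult by simp
    then show ?case using Suc by (simp add: algebra_simps)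
  qed simp
  have "(z - 1) * (\<Sum>j<n. z ^ j) = z ^ n - 1" by (simp add: power_diff_1_eq)
  then have "(\<Sum>j<n. z ^ j) = 0" using \<open>z \<noteq> 1\<close> assms(1) by simp
  then have "(\<Sum>j<n. z ^ j - 1) = - of_nat n" by (simp add: sum_subtractf)
  then have "real n = cmod (\<Sum>j<n. z ^ j - 1)" by simp
  also have "\<dots> \<le> (\<Sum>j<n. real n * cmod (z - 1))"
  proof (rule order_trans[OF norm_sum sum_mono])
    fix i assume "i \<in> {..<n}"
    then show "cmod (z ^ i - 1) \<le> real n * cmod (z - 1)"
      using j[of i] by (meson lessThan_iff less_imp_le mult_right_mono norm_ge_zero of_nat_mono order_trans)
  qed
  also have "\<dots> = real n ^ 2 * cmod (z - 1)" by (simp add: power2_eq_square)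
  finally show False using assms by simp
qed

section \<open>Entrywise size of matrices and the commutator estimate\<close>

abbreviation entries_le :: "nat \<Rightarrow> complex mat \<Rightarrow> real \<Rightarrow> bool" where
  "entries_le n M c \<equiv> \<forall>i<n. \<forall>j<n. cmod (M $$ (i, j)) \<le> c"

lemma entries_le_mult:
  assumes "M \<in> carrier_mat n n" "N \<in> carrier_mat n n" "entries_le n M a" "entries_le n N b"
  shows "entries_le n (M * N) (real n * a * b)"
proof (intro allI impI)
  fix i j assume ij: "i < n" "j < n"
  have "cmod ((M * N) $$ (i, j)) = cmod (\<Sum>k<n. M $$ (i, k) * N $$ (k, j))"
    using assms ij by (simp add: scalar_prod_def lessThan_atLeast0)
  also have "\<dots> \<le> (\<Sum>k<n. a * b)"
    using assms(3,4) ij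
    by (intro order_trans[OF norm_sum sum_mono]) (auto simp: norm_mult intro!: mult_mono intro: order_trans[OF norm_ge_zero])
  finally show "cmod ((M * N) $$ (i, j)) \<le> real n * a * b" by simp
qed

lemma mat_eq_smult_one:
  fixes A :: "'a::comm_ring_1 mat"
  assumes "A \<in> carrier_mat n n" "\<And>v. v \<in> carrier_vec n \<Longrightarrow> A *\<^sub>v v = z \<cdot>\<^sub>v v"
  shows "A = z \<cdot>\<^sub>m 1\<^sub>m n"
proof (rule eq_matI)
  fix i j assume "i < dim_row (z \<cdot>\<^sub>m 1\<^sub>m n)" "j < dim_col (z \<cdot>\<^sub>m 1\<^sub>m n :: 'a mat)"
  then have ij: "i < n" "j < n" by auto
  have "(A *\<^sub>v unit_vec n j) $ i = A $$ (i, j)" using assms(1) ij by simp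
  then show "A $$ (i, j) = (z \<cdot>\<^sub>m 1\<^sub>m n) $$ (i, j)"
    using assms(2)[of "unit_vec n j"] ij by auto
qed (use assms in auto)

text \<open>Since the identity commutes with everything, the additive commutator is bilinear in the
  deviations from 1, hence of second order for matrices near 1.\<close>

lemma mult_minus_commutator:
  fixes P Q :: "'a::comm_ring_1 mat"
  assumes "P \<in> carrier_mat n n" "Q \<in> carrier_mat n n"
  shows "P * Q - Q * P = (P - 1\<^sub>m n) * (Q - 1\<^sub>m n) - (Q - 1\<^sub>m n) * (P - 1\<^sub>m n)"
proof -
  have *: "(X - 1\<^sub>m n) * (Y - 1\<^sub>m n) = X * Y - Y - (X - 1\<^sub>m n)"
    if "X \<in> carrier_mat n n" "Y \<in> carrier_mat n n" for X Y :: "'a mat"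
  proof -
    have "(X - 1\<^sub>m n) * (Y - 1\<^sub>m n) = (X - 1\<^sub>m n) * Y - (X - 1\<^sub>m n) * 1\<^sub>m n"
      using that by (intro mult_minus_distrib_mat[of _ n n _ n]) auto
    then show ?thesis using that by (simp add: minus_mult_distrib_mat[of _ n n _ _ n])
  qed
  show ?thesis
    unfolding *[OF assms] *[OF assms(2,1)] using assms
    by (intro eq_matI) (auto simp del: index_mult_mat(1))
qed

lemma conjugate_mult:
  fixes A B X Y :: "'a::comm_ring_1 mat"
  assumes "A \<in> carrier_mat n n" "B \<in> carrier_mat n n" "A * B = 1\<^sub>m n"
    "X \<in> carrier_mat n n" "Y \<in> carrier_mat n n"
  shows "B * (X * Y) * A = B * X * A * (B * Y * A)"
proof -
  have "B * X * A * (B * Y * A) = B * X * (A * (B * Y * A))"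
    using assms by (intro assoc_mult_mat[of _ n n _ n _ n]) auto
  also have "A * (B * Y * A) = A * (B * (Y * A))"
    using assms by (simp add: assoc_mult_mat[of B n n Y n A n])
  also have "\<dots> = (A * B) * (Y * A)"
    using assms by (intro assoc_mult_mat[symmetric, of _ n n _ n _ n]) auto
  also have "\<dots> = Y * A" using assms by simp
  also have "B * X * (Y * A) = B * X * Y * A"
    using assms by (intro assoc_mult_mat[symmetric, of _ n n _ n _ n]) auto
  also have "B * X * Y = B * (X * Y)"
    using assms by (intro assoc_mult_mat[of _ n n _ n _ n]) auto
  finally show ?thesis ..
qed

context matrix_group
begin

lemma minv_cancel [simp]:
  assumes "x \<in> \<Gamma>" "y \<in> \<Gamma>"
  shows "x * (minv x * y) = y" "minv x * (x * y) = y"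
  using assms minv[of x] by (metis in_carrier left_mult_one_mat mult_assoc)+

text \<open>Conjugation of the hypothesis by \<open>x\<close>. It reduces commutation of two
  conjugates of \<open>g\<close> to commutation of \<open>g\<close> itself with one
  conjugate.\<close>

lemma conj_commute:
  assumes "g \<in> \<Gamma>" "b \<in> \<Gamma>" "x \<in> \<Gamma>" "g * (minv x * b * x) = minv x * b * x * g"
  shows "x * g * minv x * b = b * (x * g * minv x)"
proof -
  note [simp] = mult minv(1)
  have "x * g * minv x * b = x * (g * (minv x * b * x)) * minv x"
    using assms(1-3) by (simp add: mult_assoc minv(2) right_mult_one_mat[OF in_carrier])
  also have "\<dots> = x * (minv x * b * x * g) * minv x" using assms(4) by simp
  also have "\<dots> = b * (x * g * minv x)" using assms(1-3) by (simp add: mult_assoc)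
  finally show ?thesis .
qed

text \<open>Let \<open>g\<close> be a non-scalar element as close to 1 as possible. The commutator of \<open>g\<close> with
  one of its conjugates is closer to 1, hence scalar, hence (a root of unity near 1) trivial. So
  the conjugates of \<open>g\<close> commute, and \<open>g\<close> is scalar by primitivity.\<close>

lemma near_one_scalar:
  assumes fin: "finite \<Gamma>" and prim: "acts_primitively n \<Gamma> (carrier_vec n)" and n: "n > 0"
    and A: "A \<in> carrier_mat n n" and B: "B \<in> carrier_mat n n" and AB: "A * B = 1\<^sub>m n" "B * A = 1\<^sub>m n"
    and bd: "\<And>g. g \<in> \<Gamma> \<Longrightarrow> entries_le n (B * g * A) 1"
    and g: "g \<in> \<Gamma>" and near: "entries_le n (B * g * A - 1\<^sub>m n) e" and e: "2 * real n ^ 4 * e < 1"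
  shows "\<exists>z. g = z \<cdot>\<^sub>m 1\<^sub>m n"
proof (rule ccontr)
  assume nsc: "\<nexists>z. g = z \<cdot>\<^sub>m 1\<^sub>m n"
  define \<rho> where "\<rho> g = B * g * A" for g
  define \<delta> where "\<delta> g = Max ((\<lambda>(i, j). cmod ((\<rho> g - 1\<^sub>m n) $$ (i, j))) ` ({..<n} \<times> {..<n}))" for g
  have \<delta>: "entries_le n (\<rho> g - 1\<^sub>m n) (\<delta> g)" for g
  proof (intro allI impI)
    fix i j assume "i < n" "j < n"
    then show "cmod ((\<rho> g - 1\<^sub>m n) $$ (i, j)) \<le> \<delta> g"
      unfolding \<delta>_def by (intro Max_ge) (auto intro!: image_eqI[of _ _ "(i, j)"] simp del: index_minus_mat)
  qed
  have \<delta>_le: "\<delta> g \<le> c" if "entries_le n (\<rho> g - 1\<^sub>m n) c" for g c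
    unfolding \<delta>_def using that n by (subst Max_le_iff) auto
  have \<rho>c: "\<rho> g \<in> carrier_mat n n" if "g \<in> \<Gamma>" for g
    using that A B in_carrier[OF that] unfolding \<rho>_def by auto
  have b\<rho>: "entries_le n (\<rho> g) 1" if "g \<in> \<Gamma>" for g
    using bd[OF that] unfolding \<rho>_def .
  have \<rho>_mult: "\<rho> (x * y) = \<rho> x * \<rho> y" if "x \<in> \<Gamma>" "y \<in> \<Gamma>" for x y
    unfolding \<rho>_def using A B AB(1) in_carrier[OF that(1)] in_carrier[OF that(2)] by (rule conjugate_mult)
  have \<rho>_scalar: "\<rho> (z \<cdot>\<^sub>m 1\<^sub>m n) = z \<cdot>\<^sub>m 1\<^sub>m n" for z
    unfolding \<rho>_def using A B AB by (simp add: mult_smult_distrib[of B n n _ n] mult_smult_assoc_mat[of B n n _ n])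
  have \<rho>_one: "\<rho> (1\<^sub>m n) = 1\<^sub>m n" unfolding \<rho>_def using A B AB by simp
  let ?N = "{g \<in> \<Gamma>. \<nexists>z. g = z \<cdot>\<^sub>m 1\<^sub>m n}"
  have N: "finite ?N" "?N \<noteq> {}" using fin g nsc by auto
  define g0 where "g0 = arg_min_on \<delta> ?N"
  have g0: "g0 \<in> ?N" "\<And>h. h \<in> ?N \<Longrightarrow> \<delta> g0 \<le> \<delta> h"
    using arg_min_if_finite[OF N, of \<delta>] unfolding g0_def by (auto simp: not_less)
  have g0\<Gamma>: "g0 \<in> \<Gamma>" using g0 by auto
  have small: "2 * real n ^ 4 * \<delta> g0 < 1"
  proof -
    have "\<delta> g0 \<le> e" using g0(2)[of g] \<delta>_le[of g e] near g nsc unfolding \<rho>_def by auto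
    then have "2 * real n ^ 4 * \<delta> g0 \<le> 2 * real n ^ 4 * e" by (intro mult_left_mono) auto
    then show ?thesis using e by simp
  qed
  have comm0: "g0 * (x * g0 * minv x) = x * g0 * minv x * g0" if x: "x \<in> \<Gamma>" for x
  proof -
    note [simp] = mult minv(1)
    define h where "h = x * g0 * minv x"
    have h: "h \<in> \<Gamma>" unfolding h_def using g0\<Gamma> x by simp
    define c where "c = g0 * h * (minv g0 * minv h)"
    have c: "c \<in> \<Gamma>" unfolding c_def using g0\<Gamma> h by simp
    define X where "X = \<rho> g0 - 1\<^sub>m n"
    define Y where "Y = \<rho> h - 1\<^sub>m n"
    have XY: "X \<in> carrier_mat n n" "Y \<in> carrier_mat n n"
      unfolding X_def Y_def using \<rho>c g0\<Gamma> h by auto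
    have bX: "entries_le n X (\<delta> g0)" unfolding X_def by (rule \<delta>)
    have \<delta>0: "\<delta> g0 \<ge> 0" using bX n by (meson norm_ge_zero order_trans)
    \<comment> \<open>Conjugation multiplies the deviation from 1 by two matrices with entries of
      absolute value at most 1, at the cost of a factor \<open>n\<close> each.\<close>
    have "Y = \<rho> x * X * \<rho> (minv x)"
    proof -
      have "\<rho> x * X * \<rho> (minv x) = (\<rho> x * \<rho> g0 - \<rho> x * 1\<^sub>m n) * \<rho> (minv x)"
        unfolding X_def using \<rho>c[OF x] \<rho>c[OF g0\<Gamma>] by (simp add: mult_minus_distrib_mat[of _ n n _ n])
      also have "\<dots> = \<rho> x * \<rho> g0 * \<rho> (minv x) - \<rho> x * 1\<^sub>m n * \<rho> (minv x)"
        using \<rho>c[OF x] \<rho>c[OF g0\<Gamma>] \<rho>c[OF minv(1)[OF x]] by (intro minus_mult_distrib_mat[of _ n n _ _ n]) auto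
      also have "\<rho> x * 1\<^sub>m n * \<rho> (minv x) = 1\<^sub>m n"
        using \<rho>c[OF x] x by (simp add: minv(2) \<rho>_one flip: \<rho>_mult)
      also have "\<rho> x * \<rho> g0 * \<rho> (minv x) = \<rho> h"
        unfolding h_def using x g0\<Gamma> by (simp add: \<rho>_mult)
      finally show ?thesis unfolding Y_def ..
    qed
    moreover have "entries_le n (\<rho> x * X) (real n * 1 * \<delta> g0)"
      by (rule entries_le_mult[OF \<rho>c[OF x] XY(1) b\<rho>[OF x] bX])
    then have "entries_le n (\<rho> x * X * \<rho> (minv x)) (real n * (real n * 1 * \<delta> g0) * 1)"
      by (rule entries_le_mult[OF mult_carrier_mat[OF \<rho>c[OF x] XY(1)] \<rho>c[OF minv(1)[OF x]] _ b\<rho>[OF minv(1)[OF x]]])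
    ultimately have bY: "entries_le n Y (real n ^ 2 * \<delta> g0)"
      by (simp only: power2_eq_square mult.assoc mult_1_left mult_1_right mult_1)
    have "entries_le n (X * Y) (real n * \<delta> g0 * (real n ^ 2 * \<delta> g0))"
      by (intro entries_le_mult XY bX bY)
    moreover have "entries_le n (Y * X) (real n * (real n ^ 2 * \<delta> g0) * \<delta> g0)"
      by (intro entries_le_mult XY bX bY)
    ultimately have "entries_le n (X * Y - Y * X) (2 * real n ^ 3 * \<delta> g0 ^ 2)"
    proof (intro allI impI)
      fix i j assume ij: "i < n" "j < n"
        and 1: "entries_le n (X * Y) (real n * \<delta> g0 * (real n ^ 2 * \<delta> g0))"
        and 2: "entries_le n (Y * X) (real n * (real n ^ 2 * \<delta> g0) * \<delta> g0)"
      have "(X * Y - Y * X) $$ (i, j) = (X * Y) $$ (i, j) - (Y * X) $$ (i, j)"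
        using XY ij by (simp del: index_mult_mat(1))
      also have "cmod \<dots> \<le> cmod ((X * Y) $$ (i, j)) + cmod ((Y * X) $$ (i, j))"
        by (rule norm_triangle_ineq4)
      also have "\<dots> \<le> real n * \<delta> g0 * (real n ^ 2 * \<delta> g0) + real n * (real n ^ 2 * \<delta> g0) * \<delta> g0"
        using 1 2 ij by (intro add_mono) blast+
      also have "\<dots> = 2 * real n ^ 3 * \<delta> g0 ^ 2"
        by (simp add: power2_eq_square power3_eq_cube)
      finally show "cmod ((X * Y - Y * X) $$ (i, j)) \<le> 2 * real n ^ 3 * \<delta> g0 ^ 2" .
    qed
    \<comment> \<open>Multiplication by the inverse of \<open>h * g0\<close> turns the additive
      commutator into \<open>c - 1\<close> and costs a further factor \<open>n\<close>. The
      resulting \<open>2 * n ^ 4 * \<delta> g0 ^ 2\<close> explains the threshold in the hypothesis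
      on \<open>e\<close>, which makes it smaller than \<open>\<delta> g0\<close>.\<close>
    then have "entries_le n ((X * Y - Y * X) * \<rho> (minv g0 * minv h)) (real n * (2 * real n ^ 3 * \<delta> g0 ^ 2) * 1)"
      using XY g0\<Gamma> h by (intro entries_le_mult[OF _ \<rho>c _ b\<rho>]) (simp_all only: mult minv(1) minus_carrier_mat mult_carrier_mat[of _ n n _ n])
    moreover have "(X * Y - Y * X) * \<rho> (minv g0 * minv h) = \<rho> c - 1\<^sub>m n"
    proof -
      have "X * Y - Y * X = \<rho> (g0 * h) - \<rho> (h * g0)"
        unfolding X_def Y_def using \<rho>c[OF h] \<rho>c[OF g0\<Gamma>] h g0\<Gamma>
        by (simp add: \<rho>_mult flip: mult_minus_commutator)
      also have "(\<rho> (g0 * h) - \<rho> (h * g0)) * \<rho> (minv g0 * minv h) =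
          \<rho> (g0 * h) * \<rho> (minv g0 * minv h) - \<rho> (h * g0) * \<rho> (minv g0 * minv h)"
        using h g0\<Gamma> by (intro minus_mult_distrib_mat[of _ n n _ _ n] \<rho>c) auto
      also have "\<rho> (h * g0) * \<rho> (minv g0 * minv h) = \<rho> (h * g0 * (minv g0 * minv h))"
        using h g0\<Gamma> by (intro \<rho>_mult[symmetric]) auto
      also have "h * g0 * (minv g0 * minv h) = 1\<^sub>m n"
        using h g0\<Gamma> by (simp add: mult_assoc minv(2))
      also have "\<rho> (g0 * h) * \<rho> (minv g0 * minv h) = \<rho> c"
        unfolding c_def using h g0\<Gamma> by (intro \<rho>_mult[symmetric]) auto
      finally show ?thesis by (simp add: \<rho>_one)
    qed
    ultimately have bc: "entries_le n (\<rho> c - 1\<^sub>m n) (2 * real n ^ 4 * \<delta> g0 * \<delta> g0)"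
      by (simp add: power2_eq_square power_numeral_reduce mult_ac)
    \<comment> \<open>Required for the strict decrease below; distance 0 would make
      \<open>g0\<close> the identity, which is scalar.\<close>
    have "\<delta> g0 \<noteq> 0"
    proof
      assume "\<delta> g0 = 0"
      then have z: "(\<rho> g0 - 1\<^sub>m n) $$ (i, j) = 0" if "i < n" "j < n" for i j
        using \<delta>[of g0] that by auto
      have "\<rho> g0 = 1\<^sub>m n"
        using z \<rho>c[OF g0\<Gamma>] by (intro eq_matI) auto
      then have "A * (B * g0 * A) * B = A * 1\<^sub>m n * B" unfolding \<rho>_def by simp
      moreover have "A * (B * g0 * A) * B = g0"
      proof -
        note c = A B in_carrier[OF g0\<Gamma>]
        have "A * (B * g0 * A) = (A * B) * (g0 * A)"
          using c by (simp add: assoc_mult_mat[of _ n n _ n _ n])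
        then have "A * (B * g0 * A) * B = g0 * A * B" using c AB by simp
        also have "\<dots> = g0 * (A * B)" using c by (intro assoc_mult_mat[of _ n n _ n _ n]) auto
        finally show ?thesis using c AB by simp
      qed
      ultimately have "g0 = 1 \<cdot>\<^sub>m 1\<^sub>m n" using A AB by auto
      then show False using g0(1) by blast
    qed
    then have "2 * real n ^ 4 * \<delta> g0 * \<delta> g0 < 1 * \<delta> g0"
      using small \<delta>0 by (intro mult_strict_right_mono) auto
    then have lt: "\<delta> c < \<delta> g0" using \<delta>_le[OF bc] by simp
    then obtain z where z: "c = z \<cdot>\<^sub>m 1\<^sub>m n" using g0(2)[of c] c by fastforce
    have "c * (h * g0) = g0 * h"
      unfolding c_def using h g0\<Gamma> by (simp add: mult_assoc) (simp add: minv(3) right_mult_one_mat[OF in_carrier] flip: mult_assoc)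
    then have gh: "g0 * h = z \<cdot>\<^sub>m (h * g0)"
      unfolding z using in_carrier[of "h * g0"] h g0\<Gamma> by (simp add: mult_smult_assoc_mat[of _ n n])
    \<comment> \<open>Comparing determinants in \<open>g0 * h = z (h * g0)\<close> shows that
      \<open>z\<close> is an \<open>n\<close>-th root of unity, and
      \<open>\<delta> c < \<delta> g0\<close> puts it close to 1.\<close>
    have "z = 1"
    proof (rule root_of_unity_near_one)
      have "det g0 * det h = z ^ n * (det h * det g0)"
        using arg_cong[OF gh, of det] in_carrier[OF h] in_carrier[OF g0\<Gamma>] by (simp add: det_mult)
      moreover have "det g0 \<noteq> 0" "det h \<noteq> 0"
        using arg_cong[OF minv(2)[OF g0\<Gamma>], of det] arg_cong[OF minv(2)[OF h], of det]
          in_carrier[OF h] in_carrier[OF g0\<Gamma>] in_carrier[OF minv(1)[OF h]] in_carrier[OF minv(1)[OF g0\<Gamma>]]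
        by (auto simp: det_mult)
      ultimately show "z ^ n = 1" by simp
      have "(\<rho> c - 1\<^sub>m n) $$ (0, 0) = z - 1" using n by (simp add: z \<rho>_scalar)
      then have "cmod (z - 1) \<le> \<delta> g0" using \<delta>[of c] n lt by (metis less_imp_le order_trans)
      then have "real n ^ 2 * cmod (z - 1) \<le> 2 * real n ^ 4 * \<delta> g0"
      proof (intro mult_mono)
        have "real n ^ 2 \<le> real n ^ 4" using n by (intro power_increasing) auto
        then show "real n ^ 2 \<le> 2 * real n ^ 4" using zero_le_power[of "real n" 4] by linarith
      qed auto
      then show "real n ^ 2 * cmod (z - 1) < 1" using small by simp
    qed (rule n)
    moreover have "(1 :: complex) \<cdot>\<^sub>m M = M" for M by (intro eq_matI) auto
    ultimately have "g0 * h = h * g0" using gh by (simp only:)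
    then show ?thesis unfolding h_def .
  qed
  let ?C = "(\<lambda>x. x * g0 * minv x) ` \<Gamma>"
  have C: "a \<in> \<Gamma>" if "a \<in> ?C" for a using that g0\<Gamma> by (auto intro!: mult minv(1))
  have conjC: "minv s * a * s \<in> ?C" if s: "s \<in> \<Gamma>" and a: "a \<in> ?C" for s a
  proof -
    note [simp] = mult minv(1)
    obtain x where x: "x \<in> \<Gamma>" "a = x * g0 * minv x" using a by auto
    have "(minv s * x) * (minv x * s) = 1\<^sub>m n" using s x by (simp add: mult_assoc minv(3))
    moreover have "(minv s * x) * minv (minv s * x) = 1\<^sub>m n" using s x by (simp add: minv(2))
    ultimately have "(minv s * x) * (minv x * s) = (minv s * x) * minv (minv s * x)" by simp
    then have eq: "minv x * s = minv (minv s * x)"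
      by (rule left_cancel[rotated 3]) (simp_all only: s x(1) mult minv(1))
    have "minv s * a * s = (minv s * x) * g0 * (minv x * s)"
      unfolding x(2) using s x(1) g0\<Gamma> by (simp add: mult_assoc)
    then have "minv s * a * s = (minv s * x) * g0 * minv (minv s * x)"
      unfolding eq .
    moreover have "minv s * x \<in> \<Gamma>" using s x(1) by simp
    ultimately show ?thesis by blast
  qed
  have "\<exists>z. \<forall>v\<in>carrier_vec n. g0 *\<^sub>v v = z \<cdot>\<^sub>v v"
  proof (rule primitive_commuting_scalar[OF prim, of ?C])
    show "finite ?C" using fin by simp
    show "\<exists>t\<in>\<Gamma>. \<forall>v\<in>carrier_vec n. t *\<^sub>v (s *\<^sub>v v) = v \<and> s *\<^sub>v (t *\<^sub>v v) = v" if "s \<in> \<Gamma>" for s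
      using that minv(1) minv_mult_vec by blast
    show "\<exists>m>0. \<forall>v\<in>carrier_vec n. ((*\<^sub>v) a ^^ m) v = v" if "a \<in> ?C" for a
      using finite_order[OF fin C[OF that]] .
    show "a *\<^sub>v (b *\<^sub>v v) = b *\<^sub>v (a *\<^sub>v v)" if a: "a \<in> ?C" and b: "b \<in> ?C" and v: "v \<in> carrier_vec n" for a b v
    proof -
      obtain x where x: "x \<in> \<Gamma>" "a = x * g0 * minv x" using a by auto
      \<comment> \<open>Conjugating \<open>b\<close> back by \<open>x\<close> gives another
        conjugate of \<open>g0\<close>, with which \<open>g0\<close> commutes by
        \<open>comm0\<close>.\<close>
      obtain y where y: "y \<in> \<Gamma>" "minv x * b * x = y * g0 * minv y" using conjC[OF x(1) b] by auto
      have "a * b = b * a"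
        unfolding x(2) using x(1) g0\<Gamma> C[OF b] comm0[OF y(1)] y(2) by (intro conj_commute) auto
      then show ?thesis using C[OF a] C[OF b] v by (simp flip: mult_vec)
    qed
    show "\<exists>b\<in>?C. \<forall>v\<in>carrier_vec n. a *\<^sub>v (s *\<^sub>v v) = s *\<^sub>v (b *\<^sub>v v)" if s: "s \<in> \<Gamma>" and a: "a \<in> ?C" for s a
    proof (intro bexI[OF _ conjC[OF s a]] ballI)
      fix v :: "complex vec" assume v: "v \<in> carrier_vec n"
      have "s * (minv s * a * s) = a * s" using s C[OF a] by (simp add: mult_assoc mult minv(1))
      then show "a *\<^sub>v (s *\<^sub>v v) = s *\<^sub>v ((minv s * a * s) *\<^sub>v v)"
        using s C[OF a] v by (simp add: mult minv(1) flip: mult_vec)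
    qed
    show "g0 \<in> ?C"
    proof -
      have "minv (1\<^sub>m n) = 1\<^sub>m n" using minv(1,2)[OF one] in_carrier by (metis left_mult_one_mat)
      then show ?thesis using one in_carrier[OF g0\<Gamma>] by (intro image_eqI[of _ _ "1\<^sub>m n"]) auto
    qed
  qed (use C in_carrier in auto)
  then have "\<exists>z. g0 = z \<cdot>\<^sub>m 1\<^sub>m n" using mat_eq_smult_one[OF in_carrier[OF g0\<Gamma>]] by blast
  then show False using g0(1) by blast
qed

end

text \<open>The last hypothesis makes \<open>f a\<close> a function of \<open>f' (h a)\<close>.
  Projective groups are images of sets of matrices, so this compares their sizes without
  constructing homomorphisms between quotients.\<close>

lemma card_image_le_image:
  assumes "finite (f' ` B)" "\<And>a. a \<in> A \<Longrightarrow> h a \<in> B"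
    "\<And>a b. a \<in> A \<Longrightarrow> b \<in> A \<Longrightarrow> f' (h a) = f' (h b) \<Longrightarrow> f a = f b"
  shows "finite (f ` A)" "card (f ` A) \<le> card (f' ` B)"
proof -
  have "f ` A \<subseteq> (\<lambda>y. f (SOME a. a \<in> A \<and> f' (h a) = y)) ` (f' ` B)"
  proof
    fix z assume "z \<in> f ` A"
    then obtain a where a: "a \<in> A" "z = f a" by auto
    let ?b = "SOME b. b \<in> A \<and> f' (h b) = f' (h a)"
    have "?b \<in> A \<and> f' (h ?b) = f' (h a)" by (rule someI[of _ a]) (use a in auto)
    then have "f ?b = f a" using assms(3) a by blast
    then show "z \<in> (\<lambda>y. f (SOME a. a \<in> A \<and> f' (h a) = y)) ` (f' ` B)"
      using a assms(2)[OF a(1)] by (intro image_eqI[of _ _ "f' (h a)"]) auto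
  qed
  then show "finite (f ` A)" "card (f ` A) \<le> card (f' ` B)"
    using assms(1) finite_surj surj_card_le by blast+
qed

subsection \<open>Bounds for primitive groups\<close>

text \<open>A mesh of \<open>1 / (8 n\<^sup>5)\<close> suffices: equal cells differ entrywise by at most \<open>2 / (8 n\<^sup>5)\<close>, and a factor \<open>n\<close> from
  matrix multiplication leaves \<open>1 / (4 n\<^sup>4)\<close>, below the threshold \<open>1 / (2 n\<^sup>4)\<close> of \<open>near_one_scalar\<close>.\<close>

definition grid :: "nat \<Rightarrow> (nat \<times> nat \<Rightarrow> int \<times> int) set" where
  "grid n = ({..<n} \<times> {..<n}) \<rightarrow>\<^sub>E ({- int (8 * n ^ 5)..int (8 * n ^ 5)} \<times> {- int (8 * n ^ 5)..int (8 * n ^ 5)})"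

lemma finite_grid: "finite (grid n)"
  unfolding grid_def by (intro finite_PiE) auto

lemma floor_eq_imp_close:
  fixes x y :: real
  assumes "\<lfloor>N * x\<rfloor> = \<lfloor>N * y\<rfloor>" "N > 0"
  shows "\<bar>x - y\<bar> \<le> 1 / N"
proof -
  have "\<bar>N * x - N * y\<bar> < 1" using assms(1) by linarith
  then have "N * \<bar>x - y\<bar> < 1" using assms(2) by (simp add: abs_mult flip: right_diff_distrib)
  then show ?thesis using assms(2) by (simp add: field_simps)
qed

text \<open>If \<open>g\<close> and \<open>h\<close> share a cell, the deviation of
  \<open>minv g * h\<close> from 1 is a bounded matrix times the small difference of
  \<open>h\<close> and \<open>g\<close> (all conjugated), so \<open>minv g * h\<close> is scalar.
  The grid depends on \<open>n\<close> alone, which makes the resulting bound uniform over all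
  groups.\<close>

lemma (in matrix_group) primitive_grid:
  assumes fin: "finite \<Gamma>" and prim: "acts_primitively n \<Gamma> (carrier_vec n)" and n: "n > 0"
  obtains f where "f ` \<Gamma> \<subseteq> grid n"
    "\<And>g h. g \<in> \<Gamma> \<Longrightarrow> h \<in> \<Gamma> \<Longrightarrow> f g = f h \<Longrightarrow> \<exists>z. z \<noteq> 0 \<and> h = z \<cdot>\<^sub>m g"
proof -
  have irr: "acts_irreducibly n \<Gamma> (carrier_vec n)" using prim unfolding acts_primitively_def by auto
  obtain A B where A: "A \<in> carrier_mat n n" and B: "B \<in> carrier_mat n n" and AB: "A * B = 1\<^sub>m n" "B * A = 1\<^sub>m n"
    and bd0: "\<And>g i j. g \<in> \<Gamma> \<Longrightarrow> i < n \<Longrightarrow> j < n \<Longrightarrow> cmod ((B * g * A) $$ (i, j)) \<le> 1"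
    using bounded_conjugate[OF fin irr] by blast
  have bd: "entries_le n (B * g * A) 1" if "g \<in> \<Gamma>" for g using bd0[OF that] by blast
  define N where "N = real (8 * n ^ 5)"
  have N: "N > 0" using n unfolding N_def by simp
  define f where "f g = (\<lambda>p\<in>{..<n} \<times> {..<n}. (\<lfloor>N * Re ((B * g * A) $$ p)\<rfloor>, \<lfloor>N * Im ((B * g * A) $$ p)\<rfloor>))" for g
  show ?thesis
  proof (rule that)
    have fl: "\<lfloor>N * x\<rfloor> \<in> {- int (8 * n ^ 5)..int (8 * n ^ 5)}" if "\<bar>x\<bar> \<le> 1" for x
    proof -
      have "- N \<le> N * x" "N * x \<le> N" using that N mult_left_mono[of "-1" x N] mult_left_mono[of x 1 N] by linarith+
      then have "- int (8 * n ^ 5) \<le> \<lfloor>N * x\<rfloor>" "\<lfloor>N * x\<rfloor> \<le> int (8 * n ^ 5)"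
        unfolding N_def by linarith+
      then show ?thesis by (simp only: atLeastAtMost_iff)
    qed
    show "f ` \<Gamma> \<subseteq> grid n"
    proof
      fix x assume "x \<in> f ` \<Gamma>"
      then obtain g where g: "g \<in> \<Gamma>" "x = f g" by blast
      have "\<bar>Re ((B * g * A) $$ p)\<bar> \<le> 1" "\<bar>Im ((B * g * A) $$ p)\<bar> \<le> 1" if "p \<in> {..<n} \<times> {..<n}" for p
        using that bd0[OF g(1), of "fst p" "snd p"] abs_Re_le_cmod[of "(B * g * A) $$ p"]
          abs_Im_le_cmod[of "(B * g * A) $$ p"] by (auto simp del: index_mult_mat)
      then show "x \<in> grid n"
        unfolding g(2) f_def grid_def using fl
        by (intro restrict_PiE_iff[THEN iffD2] ballI SigmaI) blast+
    qed
  next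
    fix g h assume g: "g \<in> \<Gamma>" and h: "h \<in> \<Gamma>" and eq: "f g = f h"
    have "cmod ((B * h * A - B * g * A) $$ (i, j)) \<le> 2 / N" if ij: "i < n" "j < n" for i j
    proof -
      let ?d = "(B * h * A) $$ (i, j) - (B * g * A) $$ (i, j)"
      have "(\<lfloor>N * Re ((B * g * A) $$ (i, j))\<rfloor>, \<lfloor>N * Im ((B * g * A) $$ (i, j))\<rfloor>) =
            (\<lfloor>N * Re ((B * h * A) $$ (i, j))\<rfloor>, \<lfloor>N * Im ((B * h * A) $$ (i, j))\<rfloor>)"
        using fun_cong[OF eq, of "(i, j)"] ij unfolding f_def by auto
      then have "\<bar>Re ?d\<bar> \<le> 1 / N" "\<bar>Im ?d\<bar> \<le> 1 / N"
        using floor_eq_imp_close[OF _ N] by (metis fst_conv minus_complex.simps(1) snd_conv minus_complex.simps(2))+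
      then have "cmod ?d \<le> 2 / N" using cmod_le[of ?d] by simp
      then show ?thesis using ij A B in_carrier[OF g] in_carrier[OF h] by (simp del: index_mult_mat(1))
    qed
    then have d: "entries_le n (B * h * A - B * g * A) (2 / N)" by blast
    have g': "minv g \<in> \<Gamma>" using minv(1)[OF g] .
    note c = A B in_carrier[OF g] in_carrier[OF h] in_carrier[OF g']
    have "B * (minv g * h) * A - 1\<^sub>m n = B * minv g * A * (B * h * A - B * g * A)"
    proof -
      have "B * minv g * A * (B * h * A - B * g * A) = B * minv g * A * (B * h * A) - B * minv g * A * (B * g * A)"
        using c by (intro mult_minus_distrib_mat[of _ n n _ n]) auto
      also have "B * minv g * A * (B * h * A) = B * (minv g * h) * A"
        using c AB by (intro conjugate_mult[symmetric, of A n B])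
      also have "B * minv g * A * (B * g * A) = B * (minv g * g) * A"
        using c AB by (intro conjugate_mult[symmetric, of A n B])
      also have "\<dots> = 1\<^sub>m n" using minv(3)[OF g] c AB by simp
      finally show ?thesis ..
    qed
    moreover have "entries_le n (B * minv g * A * (B * h * A - B * g * A)) (real n * 1 * (2 / N))"
      using c by (intro entries_le_mult d bd g') auto
    ultimately have "\<exists>z. minv g * h = z \<cdot>\<^sub>m 1\<^sub>m n"
    proof (intro near_one_scalar[OF fin prim n A B AB bd])
      have "2 * real n ^ 4 * (real n * 1 * (2 / N)) = 1 / 2"
        using n unfolding N_def by (simp add: field_simps power_numeral_reduce)
      then show "2 * real n ^ 4 * (real n * 1 * (2 / N)) < 1" by simp
    qed (auto intro: mult g' h)
    then obtain z where z: "minv g * h = z \<cdot>\<^sub>m 1\<^sub>m n" by blast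
    have "h = g * (minv g * h)" using g h by simp
    also have "\<dots> = z \<cdot>\<^sub>m g"
      unfolding z using c by (simp add: mult_smult_distrib[of g n n _ n] right_mult_one_mat[of g n n])
    finally have hz: "h = z \<cdot>\<^sub>m g" .
    have "z \<noteq> 0"
    proof
      assume "z = 0"
      then have "h * minv h = 0 \<cdot>\<^sub>m (g * minv h)"
        using hz c in_carrier[OF minv(1)[OF h]] by (metis mult_smult_assoc_mat)
      then have "(1\<^sub>m n :: complex mat) = 0 \<cdot>\<^sub>m (g * minv h)" using minv(2)[OF h] by simp
      then have "(1\<^sub>m n :: complex mat) $$ (0, 0) = (0 \<cdot>\<^sub>m (g * minv h)) $$ (0, 0)" by simp
      then show False using n g minv(1)[OF h] by (simp del: index_mult_mat(1))
    qed
    with hz show "\<exists>z. z \<noteq> 0 \<and> h = z \<cdot>\<^sub>m g" by blast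
  qed
qed

subsection \<open>Projective groups\<close>

lemma GL_space_carrier:
  "f \<in> carrier (GL_space n W) \<longleftrightarrow> f \<in> Bij W \<and> (\<forall>u\<in>W. \<forall>v\<in>W. f (u + v) = f u + f v) \<and>
     (\<forall>c. \<forall>v\<in>W. f (c \<cdot>\<^sub>v v) = c \<cdot>\<^sub>v f v)"
  unfolding GL_space_def LinearCombinations.module_hom_def
  by (auto simp: module_vec_simps class_ring_simps dest: Bij_imp_funcset)

lemma GL_space_mult:
  "f \<in> Bij W \<Longrightarrow> g \<in> Bij W \<Longrightarrow> f \<otimes>\<^bsub>GL_space n W\<^esub> g = compose W f g"
  unfolding GL_space_def BijGroup_def by simp

lemma subgroup_GL_space:
  assumes "is_subspace n W"
  shows "subgroup (carrier (GL_space n W)) (BijGroup W)"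
proof (rule group.subgroupI[OF group_BijGroup])
  let ?L = "carrier (GL_space n W)"
  note add = subspace_add[OF assms] and smult = subspace_smult[OF assms]
  show "?L \<subseteq> carrier (BijGroup W)" by (auto simp: GL_space_carrier BijGroup_def)
  have "(\<lambda>x\<in>W. x) \<in> ?L" using add smult by (auto simp: GL_space_carrier id_Bij)
  then show "?L \<noteq> {}" by blast
  show "a \<otimes>\<^bsub>BijGroup W\<^esub> b \<in> ?L" if "a \<in> ?L" "b \<in> ?L" for a b
    using that add smult Bij_imp_funcset[of b W]
    by (auto simp: GL_space_carrier BijGroup_def compose_Bij compose_eq Pi_iff)
  show "inv\<^bsub>BijGroup W\<^esub> f \<in> ?L" if f: "f \<in> ?L" for f
  proof -
    have fB: "f \<in> Bij W" using f by (simp add: GL_space_carrier)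
    then have bij: "bij_betw f W W" by (simp add: Bij_def)
    let ?i = "inv_into W f"
    have i: "?i v \<in> W" "f (?i v) = v" if "v \<in> W" for v
      using bij that by (auto simp: bij_betw_def inv_into_into f_inv_into_f)
    have u: "?i v = w" if "w \<in> W" "f w = v" for v w
      using bij that by (auto simp: bij_betw_def)
    have "?i (v + w) = ?i v + ?i w" if "v \<in> W" "w \<in> W" for v w
      using i[OF that(1)] i[OF that(2)] f add by (intro u) (auto simp: GL_space_carrier)
    moreover have "?i (c \<cdot>\<^sub>v v) = c \<cdot>\<^sub>v ?i v" if "v \<in> W" for c v
      using i[OF that] f smult by (intro u) (auto simp: GL_space_carrier)
    ultimately show ?thesis
      using fB restrict_inv_into_Bij[OF fB] add smult by (auto simp: inv_BijGroup GL_space_carrier)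
  qed
qed

lemma group_GL_space:
  assumes "is_subspace n W"
  shows "group (GL_space n W)"
proof -
  have "(BijGroup W)\<lparr>carrier := carrier (GL_space n W)\<rparr> = GL_space n W"
    unfolding GL_space_def by simp
  then show ?thesis
    using subgroup.subgroup_is_group[OF subgroup_GL_space[OF assms] group_BijGroup] by simp
qed

lemma scalar_in_GL_space:
  assumes "is_subspace n W" "c \<noteq> 0"
  shows "(\<lambda>v\<in>W. c \<cdot>\<^sub>v v) \<in> carrier (GL_space n W)"
proof -
  note add = subspace_add[OF assms(1)] and smult = subspace_smult[OF assms(1)]
  have "bij_betw (\<lambda>v\<in>W. c \<cdot>\<^sub>v v) W W"
    by (rule bij_betwI[where g = "\<lambda>v. (1 / c) \<cdot>\<^sub>v v"]) (use assms(2) smult in \<open>auto simp: smult_smult_assoc\<close>)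
  then show ?thesis
    using add smult subspace_carrier[OF assms(1)]
    by (auto simp: GL_space_carrier Bij_def smult_add_distrib_vec[of _ n] smult_smult_assoc mult.commute)
qed

lemma r_coset_scalars:
  assumes "is_subspace n W" "f \<in> carrier (GL_space n W)"
  shows "scalars W #>\<^bsub>GL_space n W\<^esub> f = {(\<lambda>v\<in>W. c \<cdot>\<^sub>v f v) | c. c \<noteq> 0}"
proof -
  have f: "f \<in> Bij W" "f \<in> W \<rightarrow> W" using assms(2) Bij_imp_funcset by (auto simp: GL_space_carrier)
  have "(\<lambda>v\<in>W. c \<cdot>\<^sub>v v) \<otimes>\<^bsub>GL_space n W\<^esub> f = (\<lambda>v\<in>W. c \<cdot>\<^sub>v f v)" if "c \<noteq> 0" for c
    using f scalar_in_GL_space[OF assms(1) that]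
    by (subst GL_space_mult) (auto simp: GL_space_carrier compose_def Pi_iff intro!: restrict_ext)
  then show ?thesis unfolding r_coset_def scalars_def by (auto simp: Setcompr_eq_image)
qed

text \<open>Scalars are central because the maps in \<open>GL_space\<close> are linear: the left and
  right cosets of \<open>f\<close> both consist of its nonzero multiples.\<close>

lemma scalars_normal:
  assumes "is_subspace n W"
  shows "scalars W \<lhd> GL_space n W"
proof -
  interpret group "GL_space n W" by (rule group_GL_space[OF assms])
  have one: "\<one>\<^bsub>GL_space n W\<^esub> = (\<lambda>v\<in>W. v)" unfolding GL_space_def BijGroup_def by simp
  have mult: "(\<lambda>v\<in>W. a \<cdot>\<^sub>v v) \<otimes>\<^bsub>GL_space n W\<^esub> (\<lambda>v\<in>W. b \<cdot>\<^sub>v v) = (\<lambda>v\<in>W. (a * b) \<cdot>\<^sub>v v)"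
    if "a \<noteq> 0" "b \<noteq> 0" for a b
  proof -
    have "(\<lambda>v\<in>W. a \<cdot>\<^sub>v v) \<in> Bij W" "(\<lambda>v\<in>W. b \<cdot>\<^sub>v v) \<in> Bij W"
      using that scalar_in_GL_space[OF assms] unfolding GL_space_carrier by blast+
    then show ?thesis
      using subspace_smult[OF assms]
      by (subst GL_space_mult) (auto simp: compose_def smult_smult_assoc intro!: restrict_ext)
  qed
  have sub: "subgroup (scalars W) (GL_space n W)"
  proof (rule subgroupI)
    show "scalars W \<subseteq> carrier (GL_space n W)"
      unfolding scalars_def using scalar_in_GL_space[OF assms] by blast
    have "(\<lambda>v\<in>W. 1 \<cdot>\<^sub>v v) \<in> scalars W"
      unfolding scalars_def by (intro CollectI exI[of _ 1] conjI refl one_neq_zero)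
    then show "scalars W \<noteq> {}" by blast
    show "a \<otimes>\<^bsub>GL_space n W\<^esub> b \<in> scalars W" if "a \<in> scalars W" "b \<in> scalars W" for a b
    proof -
      obtain x y where xy: "x \<noteq> 0" "y \<noteq> 0" "a = (\<lambda>v\<in>W. x \<cdot>\<^sub>v v)" "b = (\<lambda>v\<in>W. y \<cdot>\<^sub>v v)"
        using \<open>a \<in> scalars W\<close> \<open>b \<in> scalars W\<close> unfolding scalars_def by auto
      then have "x * y \<noteq> 0" by simp
      then show ?thesis unfolding xy(3,4) mult[OF xy(1,2)] scalars_def by blast
    qed
    show "inv\<^bsub>GL_space n W\<^esub> a \<in> scalars W" if a: "a \<in> scalars W" for a
    proof -
      obtain x where x: "x \<noteq> 0" "a = (\<lambda>v\<in>W. x \<cdot>\<^sub>v v)" using a unfolding scalars_def by auto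
      have x': "1 / x \<noteq> 0" using x by simp
      have "inv\<^bsub>GL_space n W\<^esub> a = (\<lambda>v\<in>W. (1 / x) \<cdot>\<^sub>v v)"
      proof (rule inv_equality)
        show "(\<lambda>v\<in>W. (1 / x) \<cdot>\<^sub>v v) \<otimes>\<^bsub>GL_space n W\<^esub> a = \<one>\<^bsub>GL_space n W\<^esub>"
          unfolding x(2) mult[OF x' x(1)] one using x(1) by (auto intro!: ext)
      qed (use x x' scalar_in_GL_space[OF assms] in auto)
      then show ?thesis unfolding scalars_def using x' by blast
    qed
  qed
  show ?thesis
  proof (rule normalI[OF sub], intro ballI)
    fix f assume f: "f \<in> carrier (GL_space n W)"
    have fB: "f \<in> Bij W" using f by (simp add: GL_space_carrier)
    have "f \<otimes>\<^bsub>GL_space n W\<^esub> (\<lambda>v\<in>W. c \<cdot>\<^sub>v v) = (\<lambda>v\<in>W. c \<cdot>\<^sub>v f v)" if "c \<noteq> 0" for c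
      using fB scalar_in_GL_space[OF assms that] f
      by (subst GL_space_mult) (auto simp: GL_space_carrier compose_def)
    then have "f <#\<^bsub>GL_space n W\<^esub> scalars W = {(\<lambda>v\<in>W. c \<cdot>\<^sub>v f v) | c. c \<noteq> 0}"
      unfolding l_coset_def scalars_def by (auto simp: Setcompr_eq_image)
    then show "scalars W #>\<^bsub>GL_space n W\<^esub> f = f <#\<^bsub>GL_space n W\<^esub> scalars W"
      using r_coset_scalars[OF assms f] by simp
  qed
qed

context matrix_group
begin

lemma act_in_GL_space:
  assumes W: "is_subspace n W" and g: "g \<in> \<Gamma>" "translate g W = W"
  shows "(\<lambda>v\<in>W. g *\<^sub>v v) \<in> carrier (GL_space n W)"
proof -
  have Wc: "v \<in> carrier_vec n" if "v \<in> W" for v using that subspace_carrier[OF W] by blast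
  have "inj_on ((*\<^sub>v) g) W" using minv_mult_vec(1)[OF g(1)] Wc by (intro inj_on_inverseI[of _ "(*\<^sub>v) (minv g)"]) auto
  then have "bij_betw (\<lambda>v\<in>W. g *\<^sub>v v) W W"
    using g(2) unfolding translate_def bij_betw_def by (simp add: inj_on_restrict_eq cong: image_cong)
  then show ?thesis
    using in_carrier[OF g(1)] Wc subspace_add[OF W] subspace_smult[OF W]
    by (auto simp: GL_space_carrier Bij_def mult_add_distrib_mat_vec mult_mat_vec)
qed

abbreviation "proj_coset W g \<equiv> scalars W #>\<^bsub>GL_space n W\<^esub> (\<lambda>v\<in>W. g *\<^sub>v v)"

text \<open>Cosets are replaced by proportionality of actions; every comparison of projective images
  below goes through this criterion.\<close>

lemma proj_coset_eq_iff:
  assumes W: "is_subspace n W" and g: "g \<in> \<Gamma>" "translate g W = W" and h: "h \<in> \<Gamma>" "translate h W = W"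
  shows "proj_coset W g = proj_coset W h \<longleftrightarrow> (\<exists>c. c \<noteq> 0 \<and> (\<forall>v\<in>W. h *\<^sub>v v = c \<cdot>\<^sub>v (g *\<^sub>v v)))"
proof -
  have r: "proj_coset W x = {(\<lambda>v\<in>W. c \<cdot>\<^sub>v (x *\<^sub>v v)) | c. c \<noteq> 0}" if "x \<in> \<Gamma>" "translate x W = W" for x
  proof -
    have "(\<lambda>v\<in>W. c \<cdot>\<^sub>v ((\<lambda>v\<in>W. x *\<^sub>v v) v)) = (\<lambda>v\<in>W. c \<cdot>\<^sub>v (x *\<^sub>v v))" for c by auto
    then show ?thesis using r_coset_scalars[OF W act_in_GL_space[OF W that]] by simp
  qed
  show ?thesis
  proof
    assume eq: "proj_coset W g = proj_coset W h"
    have "(\<lambda>v\<in>W. 1 \<cdot>\<^sub>v (h *\<^sub>v v)) \<in> proj_coset W h" unfolding r[OF h]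
      by (intro CollectI exI[of _ 1]) simp
    then obtain c where c: "c \<noteq> 0" "(\<lambda>v\<in>W. 1 \<cdot>\<^sub>v (h *\<^sub>v v)) = (\<lambda>v\<in>W. c \<cdot>\<^sub>v (g *\<^sub>v v))"
      unfolding eq[symmetric] r[OF g] by blast
    have "h *\<^sub>v v = c \<cdot>\<^sub>v (g *\<^sub>v v)" if "v \<in> W" for v
      using fun_cong[OF c(2), of v] that by simp
    with c(1) show "\<exists>c. c \<noteq> 0 \<and> (\<forall>v\<in>W. h *\<^sub>v v = c \<cdot>\<^sub>v (g *\<^sub>v v))" by blast
  next
    assume "\<exists>c. c \<noteq> 0 \<and> (\<forall>v\<in>W. h *\<^sub>v v = c \<cdot>\<^sub>v (g *\<^sub>v v))"
    then obtain c where c: "c \<noteq> 0" "\<And>v. v \<in> W \<Longrightarrow> h *\<^sub>v v = c \<cdot>\<^sub>v (g *\<^sub>v v)" by blast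
    have a: "(\<lambda>v\<in>W. a \<cdot>\<^sub>v (h *\<^sub>v v)) = (\<lambda>v\<in>W. (a * c) \<cdot>\<^sub>v (g *\<^sub>v v))" for a
      using c by (auto simp: smult_smult_assoc)
    have b: "(\<lambda>v\<in>W. a \<cdot>\<^sub>v (g *\<^sub>v v)) = (\<lambda>v\<in>W. (a / c) \<cdot>\<^sub>v (h *\<^sub>v v))" for a
      using c by (auto simp: smult_smult_assoc)
    show "proj_coset W g = proj_coset W h"
      unfolding r[OF g] r[OF h]
    proof (intro equalityI subsetI)
      fix f assume "f \<in> {(\<lambda>v\<in>W. a \<cdot>\<^sub>v (g *\<^sub>v v)) | a. a \<noteq> 0}"
      then obtain a where "a \<noteq> 0" "f = (\<lambda>v\<in>W. (a / c) \<cdot>\<^sub>v (h *\<^sub>v v))" using b by auto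
      then show "f \<in> {(\<lambda>v\<in>W. a \<cdot>\<^sub>v (h *\<^sub>v v)) | a. a \<noteq> 0}" using c(1) by (intro CollectI exI[of _ "a / c"]) simp
    next
      fix f assume "f \<in> {(\<lambda>v\<in>W. a \<cdot>\<^sub>v (h *\<^sub>v v)) | a. a \<noteq> 0}"
      then obtain a where "a \<noteq> 0" "f = (\<lambda>v\<in>W. (a * c) \<cdot>\<^sub>v (g *\<^sub>v v))" using a by auto
      then show "f \<in> {(\<lambda>v\<in>W. a \<cdot>\<^sub>v (g *\<^sub>v v)) | a. a \<noteq> 0}" using c(1) by (intro CollectI exI[of _ "a * c"]) simp
    qed
  qed
qed

lemma translate_carrier_vec:
  assumes "g \<in> \<Gamma>"
  shows "translate g (carrier_vec n) = carrier_vec n"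
  unfolding translate_def using assms minv_mult_vec(2)[OF assms] minv(1)[OF assms]
  by (force intro: image_eqI[OF sym])

text \<open>The action on vectors followed by the quotient map; both respect products, so subgroups
  are carried along.\<close>

lemma proj_image_subgroup:
  "subgroup (proj_image n \<Gamma> (carrier_vec n)) (PGL n)"
proof -
  let ?V = "carrier_vec n :: complex vec set"
  have V: "is_subspace n ?V" unfolding is_subspace_iff by auto
  interpret L: group "GL_space n ?V" by (rule group_GL_space[OF V])
  interpret N: normal "scalars ?V" "GL_space n ?V" by (rule scalars_normal[OF V])
  let ?act = "\<lambda>g. \<lambda>v\<in>?V. g *\<^sub>v v"
  have act: "?act g \<in> carrier (GL_space n ?V)" if "g \<in> \<Gamma>" for g
    by (rule act_in_GL_space[OF V that translate_carrier_vec[OF that]])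
  have mult_act: "?act g \<otimes>\<^bsub>GL_space n ?V\<^esub> ?act h = ?act (g * h)" if "g \<in> \<Gamma>" "h \<in> \<Gamma>" for g h
    using act[OF that(1)] act[OF that(2)] that
    by (subst GL_space_mult) (auto simp: GL_space_carrier compose_def mult_vec intro!: ext)
  have "subgroup (?act ` \<Gamma>) (GL_space n ?V)"
  proof (rule L.subgroupI)
    show "?act ` \<Gamma> \<subseteq> carrier (GL_space n ?V)" using act by blast
    show "?act ` \<Gamma> \<noteq> {}" using one by blast
    show "a \<otimes>\<^bsub>GL_space n ?V\<^esub> b \<in> ?act ` \<Gamma>" if "a \<in> ?act ` \<Gamma>" "b \<in> ?act ` \<Gamma>" for a b
      using that mult_act mult by auto
    show "inv\<^bsub>GL_space n ?V\<^esub> a \<in> ?act ` \<Gamma>" if a: "a \<in> ?act ` \<Gamma>" for a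
    proof -
      obtain g where g: "g \<in> \<Gamma>" "a = ?act g" using a by blast
      have "?act (1\<^sub>m n) = \<one>\<^bsub>GL_space n ?V\<^esub>" unfolding GL_space_def BijGroup_def by (auto intro!: ext)
      then have "inv\<^bsub>GL_space n ?V\<^esub> a = ?act (minv g)"
        using g minv[OF g(1)] mult_act[of "minv g" g] act by (intro L.inv_equality) auto
      then show ?thesis using minv(1)[OF g(1)] by blast
    qed
  qed
  moreover have "group_hom (GL_space n ?V) (PGL n) (\<lambda>a. scalars ?V #>\<^bsub>GL_space n ?V\<^esub> a)"
    unfolding group_hom_def group_hom_axioms_def PGL_space_def
    using L.is_group N.factorgroup_is_group N.r_coset_hom_Mod by blast
  ultimately have "subgroup ((\<lambda>a. scalars ?V #>\<^bsub>GL_space n ?V\<^esub> a) ` (?act ` \<Gamma>)) (PGL n)"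
    using group_hom.subgroup_img_is_subgroup by blast
  then show ?thesis unfolding proj_image_def by (simp add: image_image)
qed

text \<open>The way back from bare sets of matrices: needed to exhibit the action on a block as a
  group of the kind over which \<open>JC\<close> is taken.\<close>

lemma subgroup_GL: "subgroup \<Gamma> (GL n)"
proof -
  interpret R: ring "ring_mat TYPE(complex) n ()" by (rule ring_mat)
  have gr: "group (GL n)" unfolding GL_def by (rule R.units_group)
  have mult_GL: "mult (GL n) = (*)" "monoid.one (GL n) = 1\<^sub>m n"
    unfolding GL_def units_of_def by (auto simp: ring_mat_simps)
  have U: "g \<in> carrier (GL n)" if "g \<in> \<Gamma>" for g
    unfolding GL_def units_of_def Units_def
    using that minv[OF that] in_carrier[OF that] in_carrier[OF minv(1)[OF that]] by (auto simp: ring_mat_simps)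
  show ?thesis
  proof (rule group.subgroupI[OF gr])
    show "inv\<^bsub>GL n\<^esub> g \<in> \<Gamma>" if "g \<in> \<Gamma>" for g
    proof -
      have "inv\<^bsub>GL n\<^esub> g = minv g"
        using that minv[OF that] U by (intro group.inv_equality[OF gr]) (auto simp: mult_GL)
      then show ?thesis using minv(1)[OF that] by simp
    qed
  qed (use U one mult in \<open>auto simp: mult_GL\<close>)
qed

lemma primitive_in_PGL_proj_image:
  assumes "finite \<Gamma>" "acts_primitively n \<Gamma> (carrier_vec n)"
  shows "primitive_in_PGL n (proj_image n \<Gamma> (carrier_vec n))"
  unfolding primitive_in_PGL_def
  using assms proj_image_subgroup subgroup_GL by (auto simp: proj_image_def)

end

text \<open>Elements in one cell are proportional, so \<open>H\<close> has at most as many elements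
  as there are cells in use. What matters is that the bound does not depend on
  \<open>H\<close>.\<close>

lemma primitive_in_PGL_card_le_grid:
  assumes "primitive_in_PGL n H" "n > 0"
  shows "card H \<le> card (grid n)"
proof -
  obtain \<Gamma> where \<Gamma>: "subgroup \<Gamma> (GL n)" "finite \<Gamma>" "acts_primitively n \<Gamma> (carrier_vec n)"
    and H: "H = proj_image n \<Gamma> (carrier_vec n)"
    using assms(1) unfolding primitive_in_PGL_def by blast
  interpret matrix_group n \<Gamma> by (rule matrix_group_subgroup_GL[OF \<Gamma>(1)])
  obtain f where f: "f ` \<Gamma> \<subseteq> grid n"
    "\<And>g h. g \<in> \<Gamma> \<Longrightarrow> h \<in> \<Gamma> \<Longrightarrow> f g = f h \<Longrightarrow> \<exists>z. z \<noteq> 0 \<and> h = z \<cdot>\<^sub>m g"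
    using primitive_grid[OF \<Gamma>(2,3) assms(2)] by blast
  have V: "is_subspace n (carrier_vec n :: complex vec set)" unfolding is_subspace_iff by auto
  have "card H \<le> card (f ` \<Gamma>)"
    unfolding H proj_image_def
  proof (rule card_image_le_image(2)[where h = "\<lambda>g. g"])
    fix g h assume g: "g \<in> \<Gamma>" and h: "h \<in> \<Gamma>" and eq: "f g = f h"
    obtain z where z: "z \<noteq> 0" "h = z \<cdot>\<^sub>m g" using f(2)[OF g h eq] by blast
    have "h *\<^sub>v v = z \<cdot>\<^sub>v (g *\<^sub>v v)" if "v \<in> carrier_vec n" for v
      unfolding z(2) using in_carrier[OF g] that by (intro eq_vecI) (auto simp: scalar_prod_def sum_distrib_left mult_ac)
    then show "proj_coset (carrier_vec n) g = proj_coset (carrier_vec n) h"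
      using proj_coset_eq_iff[OF V g translate_carrier_vec[OF g] h translate_carrier_vec[OF h]] z(1) by blast
  qed (use \<Gamma>(2) in auto)
  also have "\<dots> \<le> card (grid n)" using f(1) finite_grid by (rule card_mono[rotated])
  finally show ?thesis .
qed

text \<open>\<open>Max\<close> is an upper bound only for a finite set; the grid bound supplies this
  finiteness.\<close>

lemma card_le_JC:
  assumes "primitive_in_PGL n H" "n > 0"
  shows "card H \<le> JC n"
proof -
  have "{card H | H. primitive_in_PGL n H} \<subseteq> {..card (grid n)}"
    using primitive_in_PGL_card_le_grid assms(2) by auto
  then have "finite {card H | H. primitive_in_PGL n H}" by (rule finite_subset) simp
  then show ?thesis unfolding JC_def using assms(1) by (intro Max_ge) auto
qed

subsection \<open>Coordinates on subspaces\<close>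

lemma vsum_reindex:
  assumes "inj_on f I" "finite I" "\<And>i. i \<in> I \<Longrightarrow> u (f i) \<in> carrier_vec n"
  shows "vsum n u (f ` I) = vsum n (\<lambda>i. u (f i)) I"
proof (rule eq_vecI)
  have c: "vsum n u (f ` I) \<in> carrier_vec n" "vsum n (\<lambda>i. u (f i)) I \<in> carrier_vec n"
    using assms by (auto intro!: vsum_closed)
  then show "dim_vec (vsum n u (f ` I)) = dim_vec (vsum n (\<lambda>i. u (f i)) I)" by simp
  fix p assume "p < dim_vec (vsum n (\<lambda>i. u (f i)) I)"
  then have p: "p < n" using c by simp
  show "vsum n u (f ` I) $ p = vsum n (\<lambda>i. u (f i)) I $ p"
    using assms p by (subst (1 2) vsum_index) (auto simp: sum.reindex)
qed

text \<open>The columns of \<open>E\<close> form a basis of \<open>W\<close>, and \<open>P\<close> computes coordinates.\<close>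

definition frame :: "nat \<Rightarrow> nat \<Rightarrow> complex vec set \<Rightarrow> complex mat \<Rightarrow> complex mat \<Rightarrow> bool" where
  "frame r k W E P \<longleftrightarrow> E \<in> carrier_mat r k \<and> P \<in> carrier_mat k r \<and> P * E = 1\<^sub>m k \<and>
     (\<forall>x\<in>carrier_vec k. E *\<^sub>v x \<in> W) \<and> (\<forall>v\<in>W. E *\<^sub>v (P *\<^sub>v v) = v)"

lemma frameD:
  assumes "frame r k W E P"
  shows "E \<in> carrier_mat r k" "P \<in> carrier_mat k r"
    and "x \<in> carrier_vec k \<Longrightarrow> E *\<^sub>v x \<in> W"
    and "x \<in> carrier_vec k \<Longrightarrow> P *\<^sub>v (E *\<^sub>v x) = x"
    and "v \<in> W \<Longrightarrow> E *\<^sub>v (P *\<^sub>v v) = v"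
    and "P *\<^sub>v w \<in> carrier_vec k"
proof -
  show E: "E \<in> carrier_mat r k" and P: "P \<in> carrier_mat k r" using assms unfolding frame_def by auto
  show "x \<in> carrier_vec k \<Longrightarrow> E *\<^sub>v x \<in> W" "v \<in> W \<Longrightarrow> E *\<^sub>v (P *\<^sub>v v) = v"
    using assms unfolding frame_def by auto
  show "P *\<^sub>v (E *\<^sub>v x) = x" if "x \<in> carrier_vec k"
    using assoc_mult_mat_vec[OF P E that] that assms unfolding frame_def by simp
  show "P *\<^sub>v w \<in> carrier_vec k" using P by (auto intro!: carrier_vecI)
qed

lemma vspan_unit_vecs:
  "vspan r (unit_vec r ` C) = {v \<in> carrier_vec r. \<forall>p<r. p \<notin> C \<longrightarrow> v $ p = 0}"
  if "C \<subseteq> {..<r}"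
proof
  interpret vec_space "TYPE(complex)" r .
  note finsum_vec [simp del]
  let ?T = "{v \<in> carrier_vec r. \<forall>p<r. p \<notin> C \<longrightarrow> v $ p = (0::complex)}"
  have T: "is_subspace r ?T" unfolding is_subspace_iff by auto
  have U: "unit_vec r ` C \<subseteq> (carrier_vec r :: complex vec set)" by auto
  show "vspan r (unit_vec r ` C) \<subseteq> ?T"
    using that T by (intro span_is_subset) (auto simp: subspace_def)
  have S: "is_subspace r (vspan r (unit_vec r ` C))"
    using span_is_subspace[OF U[folded module_vec_simps(3)]] by simp
  show "?T \<subseteq> vspan r (unit_vec r ` C)"
  proof
    fix v assume v: "v \<in> ?T"
    have fin: "finite C" using that finite_subset by blast
    have "v = vec r (\<lambda>p. if p \<in> C then v $ p else 0)" using v by (intro eq_vecI) auto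
    also have "\<dots> = vsum r (\<lambda>p. (v $ p) \<cdot>\<^sub>v unit_vec r p) C"
      by (rule vec_eq_vsum_unit_vecs[OF that])
    also have "\<dots> \<in> vspan r (unit_vec r ` C)"
    proof (intro vsum_in_subspace[OF S fin] subspace_smult[OF S])
      fix p assume "p \<in> C"
      then show "unit_vec r p \<in> vspan r (unit_vec r ` C)"
        using in_own_span[OF U[folded module_vec_simps(3)]] by auto
    qed
    finally show "v \<in> vspan r (unit_vec r ` C)" .
  qed
qed

lemma coordinate_frame:
  assumes "vspan r (unit_vec r ` coords r W) = W"
  shows "\<exists>E P. frame r (card (coords r W)) W E P"
proof -
  define C where "C = coords r W"
  define k where "k = card C"
  have C: "C \<subseteq> {..<r}" unfolding C_def coords_def by auto
  then have "finite C" using finite_subset by blast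
  then obtain \<beta> where \<beta>: "bij_betw \<beta> {0..<k} C" using ex_bij_betw_nat_finite unfolding k_def by blast
  have \<beta>C: "\<beta> a \<in> C" if "a < k" for a using \<beta> that by (auto simp: bij_betw_def)
  have \<beta>r: "\<beta> a < r" if "a < k" for a using \<beta>C[OF that] C by auto
  have \<beta>i: "\<beta> a = \<beta> b \<longleftrightarrow> a = b" if "a < k" "b < k" for a b
    using \<beta> that by (auto simp: bij_betw_def inj_on_def)
  have W: "W = {v \<in> carrier_vec r. \<forall>p<r. p \<notin> C \<longrightarrow> v $ p = 0}"
    using vspan_unit_vecs[OF C] assms by (simp add: C_def)
  \<comment> \<open>The inclusion of the coordinates enumerated by \<open>\<beta>\<close> and the
    projection onto them, as matrices of zeros and ones.\<close>
  define E :: "complex mat" where "E = mat r k (\<lambda>(p, a). if p = \<beta> a then 1 else 0)"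
  define P :: "complex mat" where "P = mat k r (\<lambda>(a, p). if p = \<beta> a then 1 else 0)"
  have E: "E \<in> carrier_mat r k" and P: "P \<in> carrier_mat k r" unfolding E_def P_def by auto
  have Px: "(P *\<^sub>v v) $ a = v $ \<beta> a" if "v \<in> carrier_vec r" "a < k" for v a
    using that \<beta>r[OF that(2)] mult_mat_vec_index[OF P that]
    by (simp add: P_def if_distrib[of "\<lambda>x. x * _"] sum.delta cong: if_cong)
  have Ex: "(E *\<^sub>v x) $ p = (\<Sum>a<k. if p = \<beta> a then x $ a else 0)" if "x \<in> carrier_vec k" "p < r" for x p
    using that mult_mat_vec_index[OF E that] by (auto simp: E_def intro!: sum.cong)
  have Ex\<beta>: "(E *\<^sub>v x) $ \<beta> a = x $ a" if "x \<in> carrier_vec k" "a < k" for x a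
  proof -
    have "(E *\<^sub>v x) $ \<beta> a = (\<Sum>b<k. if b = a then x $ b else 0)"
      unfolding Ex[OF that(1) \<beta>r[OF that(2)]] using \<beta>i[OF that(2)] by (intro sum.cong) auto
    then show ?thesis using that by simp
  qed
  have Exc: "E *\<^sub>v x \<in> carrier_vec r" for x using E by (auto intro!: carrier_vecI)
  have PE: "P *\<^sub>v (E *\<^sub>v x) = x" if "x \<in> carrier_vec k" for x
    using that P Px[OF Exc] Ex\<beta> by (intro eq_vecI) auto
  have "P * E = 1\<^sub>m k"
  proof -
    have "P * E = 1 \<cdot>\<^sub>m 1\<^sub>m k"
      using E P PE by (intro mat_eq_smult_one) auto
    then show ?thesis by auto
  qed
  moreover have "E *\<^sub>v x \<in> W" if x: "x \<in> carrier_vec k" for x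
    unfolding W using Exc Ex[OF x] \<beta>C by (auto intro!: sum.neutral)
  moreover have "E *\<^sub>v (P *\<^sub>v v) = v" if v: "v \<in> W" for v
  proof (rule eq_vecI)
    have vc: "v \<in> carrier_vec r" using v W by auto
    then show "dim_vec (E *\<^sub>v (P *\<^sub>v v)) = dim_vec v" using E by auto
    have Pv: "P *\<^sub>v v \<in> carrier_vec k" using P by (auto intro!: carrier_vecI)
    fix p assume "p < dim_vec v"
    then have p: "p < r" using vc by auto
    show "(E *\<^sub>v (P *\<^sub>v v)) $ p = v $ p"
    proof (cases "p \<in> C")
      case True
      then obtain a where "a < k" "p = \<beta> a" using \<beta> by (auto simp: bij_betw_def)
      then show ?thesis using Ex\<beta>[OF Pv] Px[OF vc] by simp
    next
      case False
      then have "(E *\<^sub>v (P *\<^sub>v v)) $ p = 0"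
        unfolding Ex[OF Pv p] using \<beta>C by (auto intro!: sum.neutral)
      then show ?thesis using False v p W by auto
    qed
  qed
  ultimately show ?thesis using E P unfolding frame_def k_def C_def by blast
qed

text \<open>\<open>E\<close> is a linear bijection from \<open>k\<close>-dimensional space onto
  \<open>W\<close>. In particular the width of a frame does not depend on the frame.\<close>

lemma frame_sdim:
  assumes W: "is_subspace r W" and fr: "frame r k W E P"
  shows "sdim r W = k"
proof -
  note f = frameD[OF fr]
  interpret K: vec_space "TYPE(complex)" k .
  have Wvs: "vectorspace class_ring (subspace_vs r W)"
    using subspace.vs[OF W] vectorspace.subspace_is_vs[OF vec_vs W] by simp
  interpret W: vectorspace class_ring "subspace_vs r W" by (rule Wvs)
  have hom: "(*\<^sub>v) E \<in> LinearCombinations.module_hom class_ring (module_vec TYPE(complex) k) (subspace_vs r W)"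
    using f(1,3) unfolding LinearCombinations.module_hom_def
    by (auto simp: module_vec_simps class_ring_simps mult_add_distrib_mat_vec mult_mat_vec)
  interpret L: linear_map class_ring "module_vec TYPE(complex) k" "subspace_vs r W" "(*\<^sub>v) E"
    by unfold_locales (rule hom)
  have "inj_on ((*\<^sub>v) E) (carrier_vec k)" using f(4) by (intro inj_on_inverseI[of _ "(*\<^sub>v) P"])
  moreover have "(*\<^sub>v) E ` carrier_vec k = W"
    using f(3,5,6) by (metis image_eqI image_subsetI subsetI subset_antisym)
  ultimately have "K.dim = W.dim"
    using K.fin_dim by (intro L.dim_eq) (auto simp: module_vec_simps)
  then show ?thesis using K.dim_is_n by simp
qed

lemma mat_eqI_mult_vec:
  fixes A B :: "'a::comm_ring_1 mat"
  assumes "A \<in> carrier_mat m n" "B \<in> carrier_mat m n" "\<And>v. v \<in> carrier_vec n \<Longrightarrow> A *\<^sub>v v = B *\<^sub>v v"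
  shows "A = B"
proof (rule eq_matI)
  fix i j assume "i < dim_row B" "j < dim_col B"
  then have ij: "i < m" "j < n" using assms(2) by auto
  have "(A *\<^sub>v unit_vec n j) $ i = (B *\<^sub>v unit_vec n j) $ i" using assms(3)[of "unit_vec n j"] by simp
  then show "A $$ (i, j) = B $$ (i, j)" using assms(1,2) ij by simp
qed (use assms in auto)

context matrix_group
begin

text \<open>Transport of a basis along the group; it will show that blocks in one orbit have equal
  dimension.\<close>

lemma frame_translate:
  assumes W: "is_subspace n W" and fr: "frame n k W E P" and g: "g \<in> \<Gamma>" "translate g W = W'"
  shows "frame n k W' (g * E) (P * minv g)"
proof -
  note f = frameD[OF fr]
  note c = f(1,2) in_carrier[OF g(1)] in_carrier[OF minv(1)[OF g(1)]]
  have Wc: "v \<in> carrier_vec n" if "v \<in> W" for v using that subspace_carrier[OF W] by blast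
  have "P * minv g * (g * E) = P * (minv g * (g * E))"
    using c by (intro assoc_mult_mat[of _ k n _ n _ k]) auto
  also have "minv g * (g * E) = minv g * g * E"
    using c by (intro assoc_mult_mat[symmetric, of _ n n _ n _ k]) auto
  also have "\<dots> = E" using c minv(3)[OF g(1)] by simp
  also have "P * E = 1\<^sub>m k" using fr unfolding frame_def by simp
  finally have "P * minv g * (g * E) = 1\<^sub>m k" .
  moreover have "(g * E) *\<^sub>v x \<in> W'" if "x \<in> carrier_vec k" for x
  proof -
    have "(g * E) *\<^sub>v x = g *\<^sub>v (E *\<^sub>v x)" using c that by (intro assoc_mult_mat_vec)
    then show ?thesis using f(3)[OF that] g(2) unfolding translate_def by auto
  qed
  moreover have "(g * E) *\<^sub>v ((P * minv g) *\<^sub>v v) = v" if v: "v \<in> W'" for v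
  proof -
    obtain w where w: "w \<in> W" "v = g *\<^sub>v w" using v g(2) unfolding translate_def by auto
    have "(P * minv g) *\<^sub>v v = P *\<^sub>v (minv g *\<^sub>v v)"
      using c w(2) g(1) by (intro assoc_mult_mat_vec[of _ k n _ n]) auto
    also have "\<dots> = P *\<^sub>v w" using minv_mult_vec(1)[OF g(1) Wc[OF w(1)]] w(2) by simp
    finally have "(g * E) *\<^sub>v ((P * minv g) *\<^sub>v v) = (g * E) *\<^sub>v (P *\<^sub>v w)" by simp
    also have "\<dots> = g *\<^sub>v (E *\<^sub>v (P *\<^sub>v w))"
      using c f(6) by (intro assoc_mult_mat_vec[of _ n n _ k]) auto
    finally show ?thesis using f(5)[OF w(1)] w(2) by simp
  qed
  ultimately show ?thesis using c unfolding frame_def by auto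
qed

lemma stabilizer_matrix_group:
  assumes "is_subspace n W"
  shows "matrix_group n (stabilizer \<Gamma> W)"
proof
  have Wc: "v \<in> carrier_vec n" if "v \<in> W" for v using that subspace_carrier[OF assms] by blast
  have comp: "translate (g * h) W = translate g (translate h W)" if "g \<in> \<Gamma>" "h \<in> \<Gamma>" for g h
    unfolding translate_def image_image using Wc that by (intro image_cong) (auto simp: mult_vec)
  have id: "translate (1\<^sub>m n) W = W" unfolding translate_def using Wc by force
  show "stabilizer \<Gamma> W \<subseteq> carrier_mat n n" unfolding stabilizer_def using carrier by auto
  show "1\<^sub>m n \<in> stabilizer \<Gamma> W" unfolding stabilizer_def using one id by simp
  show "g * h \<in> stabilizer \<Gamma> W" if "g \<in> stabilizer \<Gamma> W" "h \<in> stabilizer \<Gamma> W" for g h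
    using that mult comp unfolding stabilizer_def by auto
  show "\<exists>h\<in>stabilizer \<Gamma> W. g * h = 1\<^sub>m n \<and> h * g = 1\<^sub>m n" if "g \<in> stabilizer \<Gamma> W" for g
  proof -
    have g: "g \<in> \<Gamma>" "translate g W = W" using that unfolding stabilizer_def by auto
    have "translate (minv g) W = W" using comp[OF minv(1)[OF g(1)] g(1)] g(2) minv(3)[OF g(1)] id by simp
    then have "minv g \<in> stabilizer \<Gamma> W" unfolding stabilizer_def using minv(1)[OF g(1)] by simp
    then show ?thesis using minv(2,3)[OF g(1)] by blast
  qed
qed

text \<open>\<open>JC k\<close> speaks of groups of \<open>k\<close> by \<open>k\<close> matrices on
  the full space, whereas here \<open>\<Gamma>\<close> acts on a subspace of a larger space. In
  frame coordinates the action becomes the matrix group of all \<open>P * g * E\<close>; since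
  \<open>E\<close> matches the subspaces of \<open>k\<close>-space with those of \<open>W\<close>,
  compatibly with translation, primitivity carries over.\<close>

lemma card_proj_image_le_JC:
  assumes fin: "finite \<Gamma>" and W: "is_subspace n W" and fr: "frame n k W E P" and k: "k > 0"
    and prim: "acts_primitively n \<Gamma> W"
  shows "card (proj_image n \<Gamma> W) \<le> JC k"
proof -
  note f = frameD[OF fr]
  have Wc: "v \<in> carrier_vec n" if "v \<in> W" for v using that subspace_carrier[OF W] by blast
  have trW: "translate g W = W" if "g \<in> \<Gamma>" for g
    using prim that unfolding acts_primitively_def acts_irreducibly_def by blast
  have gW: "g *\<^sub>v v \<in> W" if "g \<in> \<Gamma>" "v \<in> W" for g v using trW[OF that(1)] that(2) unfolding translate_def by blast
  define \<gamma> where "\<gamma> g = P * g * E" for g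
  have \<gamma>c: "\<gamma> g \<in> carrier_mat k k" if "g \<in> \<Gamma>" for g
    unfolding \<gamma>_def using f(1,2) in_carrier[OF that] by auto
  have \<gamma>v: "\<gamma> g *\<^sub>v x = P *\<^sub>v (g *\<^sub>v (E *\<^sub>v x))" if "g \<in> \<Gamma>" "x \<in> carrier_vec k" for g x
  proof -
    note c = f(1,2) in_carrier[OF that(1)] that(2)
    have "\<gamma> g *\<^sub>v x = (P * g) *\<^sub>v (E *\<^sub>v x)"
      unfolding \<gamma>_def using c by (intro assoc_mult_mat_vec[of _ k n _ k]) auto
    also have "\<dots> = P *\<^sub>v (g *\<^sub>v (E *\<^sub>v x))"
      using c by (intro assoc_mult_mat_vec[of _ k n _ n]) auto
    finally show ?thesis .
  qed
  \<comment> \<open>\<open>E\<close> intertwines the two actions. Multiplicativity of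
    \<open>\<gamma>\<close> and the transfer of stable subspaces both rest on this identity.\<close>
  have E\<gamma>: "E *\<^sub>v (\<gamma> g *\<^sub>v x) = g *\<^sub>v (E *\<^sub>v x)" if "g \<in> \<Gamma>" "x \<in> carrier_vec k" for g x
    using \<gamma>v[OF that] f(5)[OF gW[OF that(1) f(3)[OF that(2)]]] by simp
  have \<gamma>_mult: "\<gamma> (g * h) = \<gamma> g * \<gamma> h" if g: "g \<in> \<Gamma>" and h: "h \<in> \<Gamma>" for g h
  proof (rule mat_eqI_mult_vec)
    show "\<gamma> (g * h) \<in> carrier_mat k k" "\<gamma> g * \<gamma> h \<in> carrier_mat k k"
      using \<gamma>c[OF mult[OF g h]] \<gamma>c[OF g] \<gamma>c[OF h] by auto
    fix x :: "complex vec" assume x: "x \<in> carrier_vec k"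
    have "(\<gamma> g * \<gamma> h) *\<^sub>v x = \<gamma> g *\<^sub>v (\<gamma> h *\<^sub>v x)" using \<gamma>c[OF g] \<gamma>c[OF h] x by (intro assoc_mult_mat_vec)
    also have "\<dots> = P *\<^sub>v (g *\<^sub>v (E *\<^sub>v (\<gamma> h *\<^sub>v x)))"
      using \<gamma>c[OF h] x by (intro \<gamma>v[OF g]) auto
    also have "\<dots> = P *\<^sub>v (g *\<^sub>v (h *\<^sub>v (E *\<^sub>v x)))" using E\<gamma>[OF h x] by simp
    also have "\<dots> = \<gamma> (g * h) *\<^sub>v x"
      using \<gamma>v[OF mult[OF g h] x] Wc[OF f(3)[OF x]] by (simp add: mult_vec[OF g h])
    finally show "\<gamma> (g * h) *\<^sub>v x = (\<gamma> g * \<gamma> h) *\<^sub>v x" ..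
  qed
  have \<gamma>_one: "\<gamma> (1\<^sub>m n) = 1\<^sub>m k" unfolding \<gamma>_def using f(1,2) fr by (simp add: frame_def)
  interpret K: matrix_group k "\<gamma> ` \<Gamma>"
  proof
    show "\<gamma> ` \<Gamma> \<subseteq> carrier_mat k k" using \<gamma>c by auto
    show "1\<^sub>m k \<in> \<gamma> ` \<Gamma>" using \<gamma>_one one by force
    show "x * y \<in> \<gamma> ` \<Gamma>" if "x \<in> \<gamma> ` \<Gamma>" "y \<in> \<gamma> ` \<Gamma>" for x y
      using that mult by (auto simp flip: \<gamma>_mult)
    show "\<exists>y\<in>\<gamma> ` \<Gamma>. x * y = 1\<^sub>m k \<and> y * x = 1\<^sub>m k" if "x \<in> \<gamma> ` \<Gamma>" for x
    proof -
      obtain g where g: "g \<in> \<Gamma>" "x = \<gamma> g" using \<open>x \<in> \<gamma> ` \<Gamma>\<close> by auto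
      then show ?thesis using minv[OF g(1)] \<gamma>_one by (intro bexI[of _ "\<gamma> (minv g)"]) (auto simp flip: \<gamma>_mult)
    qed
  qed
  let ?V = "carrier_vec k :: complex vec set"
  let ?E = "\<lambda>U. (*\<^sub>v) E ` U"
  have V: "is_subspace k ?V" unfolding is_subspace_iff by auto
  have EV: "?E ?V = W"
  proof
    show "?E ?V \<subseteq> W" using f(3) by auto
    show "W \<subseteq> ?E ?V" using f(5,6) by (metis image_eqI subsetI)
  qed
  have PE: "(*\<^sub>v) P ` ?E U = U" if "U \<subseteq> ?V" for U
    unfolding image_image using f(4) that by (force simp: subset_iff)
  have E_sub: "is_subspace n (?E U)" if U: "is_subspace k U" for U
  proof -
    have Uc: "u \<in> carrier_vec k" if "u \<in> U" for u using that subspace_carrier[OF U] by blast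
    have "E *\<^sub>v 0\<^sub>v k = 0\<^sub>v n" using f(1) by (intro eq_vecI) (auto simp: scalar_prod_def)
    then have "0\<^sub>v n \<in> ?E U" using subspace_zero[OF U] by (metis image_eqI)
    moreover have "?E U \<subseteq> carrier_vec n" using f(1) Uc by auto
    moreover have "E *\<^sub>v u + E *\<^sub>v v \<in> ?E U" if "u \<in> U" "v \<in> U" for u v
      using subspace_add[OF U that] Uc that f(1) by (simp flip: mult_add_distrib_mat_vec)
    moreover have "c \<cdot>\<^sub>v (E *\<^sub>v u) \<in> ?E U" if "u \<in> U" for c u
      using subspace_smult[OF U that] Uc[OF that] f(1) by (simp flip: mult_mat_vec)
    ultimately show ?thesis unfolding is_subspace_iff by auto
  qed
  have E_tr: "translate g (?E U) = ?E (translate (\<gamma> g) U)" if "g \<in> \<Gamma>" "U \<subseteq> ?V" for g U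
    unfolding translate_def image_image using E\<gamma>[OF that(1)] that(2) by (intro image_cong) auto
  have irr: "acts_irreducibly k (\<gamma> ` \<Gamma>) ?V"
    unfolding acts_irreducibly_def
  proof (intro conjI allI impI)
    show "?V \<noteq> {0\<^sub>v k}"
    proof
      assume "?V = {0\<^sub>v k}"
      then have "unit_vec k 0 = (0\<^sub>v k :: complex vec)" using unit_vec_carrier by blast
      then have "unit_vec k 0 $ 0 = (0\<^sub>v k $ 0 :: complex)" by simp
      then show False using k by simp
    qed
    show "\<forall>g\<in>\<gamma> ` \<Gamma>. translate g ?V = ?V" using K.translate_carrier_vec by blast
    fix U assume U: "is_subspace k U \<and> U \<subseteq> ?V \<and> (\<forall>g\<in>\<gamma> ` \<Gamma>. translate g U = U)"
    have "\<forall>g\<in>\<Gamma>. translate g (?E U) = ?E U" using U E_tr by auto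
    moreover have "?E U \<subseteq> W" using U EV by blast
    moreover have "\<forall>U. is_subspace n U \<and> U \<subseteq> W \<and> (\<forall>g\<in>\<Gamma>. translate g U = U) \<longrightarrow> U = {0\<^sub>v n} \<or> U = W"
      using prim unfolding acts_primitively_def acts_irreducibly_def by (elim conjE)
    ultimately have "?E U = {0\<^sub>v n} \<or> ?E U = W"
      using E_sub[of U] U by simp
    then show "U = {0\<^sub>v k} \<or> U = ?V"
    proof
      assume "?E U = {0\<^sub>v n}"
      moreover have "P *\<^sub>v 0\<^sub>v n = 0\<^sub>v k" using f(2) by (intro eq_vecI) (auto simp: scalar_prod_def)
      ultimately show ?thesis using PE[of U] U by simp
    next
      assume "?E U = W"
      then show ?thesis using PE[of U] PE[of ?V] U EV by auto
    qed
  qed (rule V)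
  have "acts_primitively k (\<gamma> ` \<Gamma>) ?V"
    unfolding acts_primitively_def
  proof (intro conjI irr notI, elim exE conjE)
    \<comment> \<open>A system of imprimitivity on \<open>k\<close>-space would be carried by
      \<open>E\<close> to one on \<open>W\<close>.\<close>
    fix Q assume Q: "is_direct_sum k ?V Q (\<lambda>U. U)" "\<forall>U\<in>Q. U \<subset> ?V"
      "\<forall>g\<in>\<gamma> ` \<Gamma>. \<forall>U\<in>Q. translate g U \<in> Q"
    note D = is_direct_sumD[OF Q(1)]
    have inj: "inj_on ?E Q" using PE D(4) by (intro inj_on_inverseI[of _ "\<lambda>U. (*\<^sub>v) P ` U"]) auto
    have "is_direct_sum n W (?E ` Q) (\<lambda>U. U)"
    proof (rule is_direct_sumI[OF finite_imageI[OF D(1)] W])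
      show "is_subspace n U" if "U \<in> ?E ` Q" for U using that D(3) E_sub by auto
      show "U \<subseteq> W" if "U \<in> ?E ` Q" for U using that D(4) EV by blast
    next
      fix w assume w: "w \<in> W"
      obtain u where u: "\<forall>U\<in>Q. u U \<in> U" "P *\<^sub>v w = vsum k u Q" using D(5)[OF f(6)] by blast
      have uc: "u U \<in> carrier_vec k" if "U \<in> Q" for U using u(1) that D(4) by blast
      let ?u = "\<lambda>U. E *\<^sub>v u ((*\<^sub>v) P ` U)"
      have eq: "?u (?E U) = E *\<^sub>v u U" if "U \<in> Q" for U using PE D(4)[OF that] by simp
      have "w = E *\<^sub>v vsum k u Q" using f(5)[OF w] u(2) by simp
      also have "\<dots> = vsum n (\<lambda>U. E *\<^sub>v u U) Q" using D(1) uc f(1) by (intro mult_mat_vsum)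
      also have "\<dots> = vsum n (\<lambda>U. ?u (?E U)) Q"
        using D(1) eq uc f(1) by (intro vsum_cong) auto
      also have "\<dots> = vsum n ?u (?E ` Q)"
        using D(1) eq uc f(1) inj by (intro vsum_reindex[symmetric]) auto
      finally have "w = vsum n ?u (?E ` Q)" .
      moreover have "\<forall>U\<in>?E ` Q. ?u U \<in> U" using eq u(1) by auto
      ultimately show "\<exists>u. (\<forall>U\<in>?E ` Q. u U \<in> U) \<and> w = vsum n u (?E ` Q)"
        by (intro exI[of _ ?u] conjI)
    next
      fix u U assume u: "\<And>U. U \<in> ?E ` Q \<Longrightarrow> u U \<in> U" and 0: "vsum n u (?E ` Q) = 0\<^sub>v n" and U: "U \<in> ?E ` Q"
      obtain U' where U': "U' \<in> Q" "U = ?E U'" using U by auto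
      have uW: "u (?E V) \<in> W" if "V \<in> Q" for V using u[of "?E V"] that D(4) EV by blast
      have "vsum k (\<lambda>V. P *\<^sub>v u (?E V)) Q = P *\<^sub>v vsum n (\<lambda>V. u (?E V)) Q"
        using D(1) uW Wc f(2) by (intro mult_mat_vsum[symmetric]) auto
      also have "vsum n (\<lambda>V. u (?E V)) Q = 0\<^sub>v n"
        unfolding 0[symmetric] using D(1) uW Wc by (intro vsum_reindex[OF inj, symmetric]) auto
      also have "P *\<^sub>v 0\<^sub>v n = 0\<^sub>v k" using f(2) by (intro eq_vecI) (auto simp: scalar_prod_def)
      finally have "vsum k (\<lambda>V. P *\<^sub>v u (?E V)) Q = 0\<^sub>v k" .
      moreover have "P *\<^sub>v u (?E V) \<in> V" if "V \<in> Q" for V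
      proof -
        have "P *\<^sub>v u (?E V) \<in> (*\<^sub>v) P ` ?E V" using u[of "?E V"] that by blast
        then show ?thesis using PE D(4)[OF that] by simp
      qed
      ultimately have "P *\<^sub>v u (?E U') = 0\<^sub>v k"
        by (intro D(6)[of "\<lambda>V. P *\<^sub>v u (?E V)" U'] U'(1))
      then have "u U = E *\<^sub>v 0\<^sub>v k" using f(5)[OF uW[OF U'(1)]] U'(2) by simp
      also have "\<dots> = 0\<^sub>v n" using f(1) by (intro eq_vecI) (auto simp: scalar_prod_def)
      finally show "u U = 0\<^sub>v n" .
    qed
    moreover have "\<forall>U\<in>?E ` Q. U \<subset> W"
    proof
      fix U assume U: "U \<in> ?E ` Q"
      obtain U' where U': "U' \<in> Q" "U = ?E U'" using U by auto
      have 1: "U' \<subset> ?V" using Q(2) U'(1) by simp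
      have "?E U' \<noteq> ?E ?V"
      proof
        assume "?E U' = ?E ?V"
        then have "(*\<^sub>v) P ` ?E U' = (*\<^sub>v) P ` ?E ?V" by (rule arg_cong)
        then show False using PE[of U'] PE[of ?V] 1 by simp
      qed
      moreover have "?E U' \<subseteq> ?E ?V" using 1 by (intro image_mono) simp
      ultimately show "U \<subset> W" unfolding U'(2) EV by (intro psubsetI)
    qed
    moreover have "\<forall>g\<in>\<Gamma>. \<forall>U\<in>?E ` Q. translate g U \<in> ?E ` Q"
    proof (intro ballI)
      fix g U assume g: "g \<in> \<Gamma>" and U: "U \<in> ?E ` Q"
      obtain U' where U': "U' \<in> Q" "U = ?E U'" using U by auto
      have "translate (\<gamma> g) U' \<in> Q" using Q(3) g U'(1) by simp
      then show "translate g U \<in> ?E ` Q" unfolding U'(2) E_tr[OF g D(4)[OF U'(1)]] by (rule imageI)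
    qed
    moreover have "\<nexists>P. is_direct_sum n W P (\<lambda>U. U) \<and> (\<forall>U\<in>P. U \<subset> W) \<and> (\<forall>g\<in>\<Gamma>. \<forall>U\<in>P. translate g U \<in> P)"
      using prim unfolding acts_primitively_def by (elim conjE)
    ultimately show False by (metis (no_types, lifting))
  qed
  then have "primitive_in_PGL k (proj_image k (\<gamma> ` \<Gamma>) ?V)"
    using fin by (intro K.primitive_in_PGL_proj_image) auto
  then have "card (proj_image k (\<gamma> ` \<Gamma>) ?V) \<le> JC k" using k by (intro card_le_JC)
  \<comment> \<open>Matrices proportional in frame coordinates come from elements proportional on
    \<open>W\<close>; this direction suffices for the estimate.\<close>
  moreover have "card (proj_image n \<Gamma> W) \<le> card (proj_image k (\<gamma> ` \<Gamma>) ?V)"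
    unfolding proj_image_def
  proof (rule card_image_le_image(2)[where h = \<gamma>])
    fix g h assume g: "g \<in> \<Gamma>" and h: "h \<in> \<Gamma>" and "K.proj_coset ?V (\<gamma> g) = K.proj_coset ?V (\<gamma> h)"
    then obtain c where c: "c \<noteq> 0" "\<forall>x\<in>?V. \<gamma> h *\<^sub>v x = c \<cdot>\<^sub>v (\<gamma> g *\<^sub>v x)"
      using K.proj_coset_eq_iff[OF V] K.translate_carrier_vec by blast
    have "h *\<^sub>v v = c \<cdot>\<^sub>v (g *\<^sub>v v)" if v: "v \<in> W" for v
    proof -
      have "h *\<^sub>v v = E *\<^sub>v (\<gamma> h *\<^sub>v (P *\<^sub>v v))" using E\<gamma>[OF h f(6)] f(5)[OF v] by simp
      also have "\<dots> = E *\<^sub>v (c \<cdot>\<^sub>v (\<gamma> g *\<^sub>v (P *\<^sub>v v)))" using c(2) f(6) by simp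
      also have "\<dots> = c \<cdot>\<^sub>v (E *\<^sub>v (\<gamma> g *\<^sub>v (P *\<^sub>v v)))"
        using f(1) \<gamma>c[OF g] f(6) by (intro mult_mat_vec) auto
      also have "\<dots> = c \<cdot>\<^sub>v (g *\<^sub>v v)" using E\<gamma>[OF g f(6)] f(5)[OF v] by simp
      finally show ?thesis .
    qed
    then show "proj_coset W g = proj_coset W h"
      using proj_coset_eq_iff[OF W g trW[OF g] h trW[OF h]] c(1) by blast
  qed (use fin in auto)
  ultimately show ?thesis by simp
qed

end

subsection \<open>Diagonal automorphisms\<close>

text \<open>Where the absolute value of \<open>l\<close> is largest, the relation would enlarge it
  by the factor \<open>c > 1\<close> unless it is 0. This is the injectivity behind the eigenvalue
  system, used once for moduli and once for angles.\<close>

lemma scaled_self_map_zero: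
  fixes l :: "'b \<Rightarrow> real"
  assumes "finite B" "\<And>b. b \<in> B \<Longrightarrow> \<tau> b \<in> B" "c > 1" "\<And>b. b \<in> B \<Longrightarrow> c * l b = - l (\<tau> b)" "b \<in> B"
  shows "l b = 0"
proof -
  let ?M = "Max ((\<lambda>b. \<bar>l b\<bar>) ` B)"
  have le: "\<bar>l b\<bar> \<le> ?M" if "b \<in> B" for b using assms(1) that by (intro Max_ge) auto
  have "?M \<in> (\<lambda>b. \<bar>l b\<bar>) ` B" using assms(1,5) by (intro Max_in) auto
  then obtain a where a: "a \<in> B" "?M = \<bar>l a\<bar>" by auto
  have "c * \<bar>l a\<bar> = \<bar>c * l a\<bar>" using assms(3) by (simp add: abs_mult)
  then have "c * \<bar>l a\<bar> = \<bar>l (\<tau> a)\<bar>" using assms(4)[OF a(1)] by simp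
  then have "c * \<bar>l a\<bar> \<le> 1 * \<bar>l a\<bar>" using le[OF assms(2)[OF a(1)]] a(2) by simp
  then have "\<bar>l a\<bar> = 0" using assms(3) by (metis abs_ge_zero less_le_not_le mult_le_cancel_right order_antisym_conv)
  then show ?thesis using le[OF assms(5)] a(2) by simp
qed

text \<open>The angle in full turns, moved from the range of \<open>Arg\<close> to the interval from
  0 (included) to 1 (excluded), so that the weighted sums of two angles considered below take only
  \<open>d\<close> integer values.\<close>

definition turn :: "complex \<Rightarrow> real" where
  "turn z = (if Arg z < 0 then Arg z / (2 * pi) + 1 else Arg z / (2 * pi))"

lemma turn:
  assumes "cmod z = 1"
  shows "0 \<le> turn z" "turn z < 1" "cis (2 * pi * turn z) = z"
proof -
  have b: "- pi < Arg z" "Arg z \<le> pi" using Arg_bounded[of z] by auto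
  then show "0 \<le> turn z" "turn z < 1"
    unfolding turn_def using pi_gt_zero by (auto simp: field_simps)
  have "cis (Arg z) = z" using rcis_cmod_Arg[of z] assms by (simp add: rcis_def)
  moreover have "2 * pi * turn z = Arg z \<or> 2 * pi * turn z = Arg z + 2 * pi"
    unfolding turn_def by (simp add: field_simps)
  ultimately show "cis (2 * pi * turn z) = z" by (auto simp flip: cis_mult)
qed

lemma cis_2pi_eq_1:
  assumes "cis (2 * pi * x) = 1"
  shows "x \<in> \<int>"
proof -
  have "cos (2 * pi * x) = 1" using assms by (metis Re_complex_of_real cis.simps(1) one_complex.simps(1))
  then obtain n :: int where "2 * pi * x = of_int n * 2 * pi" using cos_one_2pi_int by blast
  then have "x = of_int n" by simp
  then show ?thesis by simp
qed

text \<open>Write \<open>\<zeta> b = exp (2 \<pi> i \<theta> b)\<close> with \<open>0 \<le> \<theta> b < 1\<close>. The integers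
  \<open>(d - 1) \<theta> b + \<theta> (\<tau> b) \<in> {0, \<dots>, d - 1}\<close> determine \<open>\<theta>\<close>, because the
  linear map \<open>\<theta> \<mapsto> (d - 1) \<theta> + \<theta> \<circ> \<tau>\<close> is injective for \<open>d \<ge> 3\<close>.\<close>

lemma torus_solutions:
  fixes \<tau> :: "'b \<Rightarrow> 'b"
  assumes B: "finite B" and \<tau>: "\<And>b. b \<in> B \<Longrightarrow> \<tau> b \<in> B" and d: "d \<ge> 3"
  defines "L \<equiv> {\<zeta> \<in> B \<rightarrow>\<^sub>E (UNIV :: complex set). \<forall>b\<in>B. \<zeta> b ^ (d - 1) * \<zeta> (\<tau> b) = 1}"
  shows "finite L" "card L \<le> d ^ card B"
proof -
  have d1: "real (d - 1) > 1" using d by simp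
  \<comment> \<open>The logarithms of the moduli satisfy the homogeneous linear system, so they
    vanish and all solutions lie on the unit torus.\<close>
  have norm: "cmod (\<zeta> b) = 1" if \<zeta>: "\<zeta> \<in> L" and b: "b \<in> B" for \<zeta> b
  proof -
    have nz: "\<zeta> b \<noteq> 0" if "b \<in> B" for b
      using \<zeta> that d unfolding L_def by (auto simp: power_0_left dest!: bspec[of B _ b])
    have "ln (cmod (\<zeta> b)) = 0"
    proof (rule scaled_self_map_zero[OF B \<tau> d1 _ b])
      fix b assume b: "b \<in> B"
      have "cmod (\<zeta> b) ^ (d - 1) * cmod (\<zeta> (\<tau> b)) = 1"
        using \<zeta> b unfolding L_def by (metis (mono_tags, lifting) mem_Collect_eq norm_mult norm_one norm_power)
      then have "ln (cmod (\<zeta> b) ^ (d - 1) * cmod (\<zeta> (\<tau> b))) = 0" by simp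
      then show "real (d - 1) * ln (cmod (\<zeta> b)) = - ln (cmod (\<zeta> (\<tau> b)))"
        using nz[OF b] nz[OF \<tau>[OF b]] by (simp add: ln_mult ln_realpow)
    qed
    then show ?thesis using nz[OF b] by (simp add: ln_eq_zero_iff)
  qed
  let ?X = "\<lambda>\<zeta> b. real (d - 1) * turn (\<zeta> b) + turn (\<zeta> (\<tau> b))"
  have X_int: "?X \<zeta> b \<in> \<int>" if \<zeta>: "\<zeta> \<in> L" and b: "b \<in> B" for \<zeta> b
  proof (rule cis_2pi_eq_1)
    have "cis (2 * pi * ?X \<zeta> b) = cis (real (d - 1) * (2 * pi * turn (\<zeta> b)) + 2 * pi * turn (\<zeta> (\<tau> b)))"
      by (simp add: algebra_simps)
    also have "\<dots> = cis (2 * pi * turn (\<zeta> b)) ^ (d - 1) * cis (2 * pi * turn (\<zeta> (\<tau> b)))"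
      by (simp only: Complex.DeMoivre cis_mult)
    also have "\<dots> = 1"
      using turn(3)[OF norm[OF \<zeta> b]] turn(3)[OF norm[OF \<zeta> \<tau>[OF b]]] \<zeta> b unfolding L_def by auto
    finally show "cis (2 * pi * ?X \<zeta> b) = 1" .
  qed
  have X_bd: "0 \<le> ?X \<zeta> b" "?X \<zeta> b < real d" if \<zeta>: "\<zeta> \<in> L" and b: "b \<in> B" for \<zeta> b
  proof -
    note t = turn(1,2)[OF norm[OF \<zeta> b]] turn(1,2)[OF norm[OF \<zeta> \<tau>[OF b]]]
    show "0 \<le> ?X \<zeta> b" using t by simp
    have "real (d - 1) * turn (\<zeta> b) \<le> real (d - 1) * 1" using t by (intro mult_left_mono) auto
    moreover have "real (d - 1) + 1 = real d" using d by simp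
    ultimately show "?X \<zeta> b < real d" using t by linarith
  qed
  let ?n = "\<lambda>\<zeta>. \<lambda>b\<in>B. nat \<lfloor>?X \<zeta> b\<rfloor>"
  have "?n ` L \<subseteq> B \<rightarrow>\<^sub>E {..<d}"
    using X_bd by (intro image_subsetI restrict_PiE_iff[THEN iffD2] ballI) (simp add: nat_less_iff floor_less_iff)
  moreover have "inj_on ?n L"
  proof (rule inj_onI)
    fix \<zeta> \<kappa> assume \<zeta>: "\<zeta> \<in> L" and \<kappa>: "\<kappa> \<in> L" and eq: "?n \<zeta> = ?n \<kappa>"
    have "turn (\<zeta> b) - turn (\<kappa> b) = 0" if b: "b \<in> B" for b
    proof (rule scaled_self_map_zero[OF B \<tau> d1 _ b])
      fix b assume b: "b \<in> B"
      have "nat \<lfloor>?X \<zeta> b\<rfloor> = nat \<lfloor>?X \<kappa> b\<rfloor>" using fun_cong[OF eq, of b] b by simp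
      then have "\<lfloor>?X \<zeta> b\<rfloor> = \<lfloor>?X \<kappa> b\<rfloor>" using X_bd(1)[OF \<zeta> b] X_bd(1)[OF \<kappa> b] by (simp add: eq_nat_nat_iff)
      then have "?X \<zeta> b = ?X \<kappa> b" using X_int[OF \<zeta> b] X_int[OF \<kappa> b] by (metis Ints_cases floor_of_int)
      then show "real (d - 1) * (turn (\<zeta> b) - turn (\<kappa> b)) = - (turn (\<zeta> (\<tau> b)) - turn (\<kappa> (\<tau> b)))"
        by (simp add: algebra_simps)
    qed
    then have "\<zeta> b = \<kappa> b" if "b \<in> B" for b
      using turn(3)[OF norm[OF \<zeta> that]] turn(3)[OF norm[OF \<kappa> that]] that by (metis eq_iff_diff_eq_0)
    moreover have "\<zeta> \<in> extensional B" "\<kappa> \<in> extensional B" using \<zeta> \<kappa> unfolding L_def by (auto simp: PiE_def)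
    ultimately show "\<zeta> = \<kappa>" by (intro extensionalityI) auto
  qed
  moreover have "finite (B \<rightarrow>\<^sub>E {..<d})" using B by (intro finite_PiE) auto
  ultimately show "finite L" "card L \<le> d ^ card B"
    using card_inj_on_le[of ?n L "B \<rightarrow>\<^sub>E {..<d}"] B by (auto simp: card_PiE intro: inj_on_finite)
qed

text \<open>A diagonal substitution multiplies each monomial by a scalar, so comparing coefficients
  forces the scalar of every monomial of \<open>F\<close> to be 1.\<close>

lemma diagonal_invariant_monomial:
  assumes form: "is_form r d F" and \<mu>: "\<mu> \<in> Poly_Mapping.keys F"
    and inv: "\<And>x. eval_at (vec r (\<lambda>k. a k * x k)) F = eval_at (vec r x) F"
  shows "(\<Prod>k<r. a k ^ Poly_Mapping.lookup \<mu> k) = 1"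
proof -
  let ?e = "\<lambda>\<mu> k. Poly_Mapping.lookup \<mu> k"
  let ?a = "\<lambda>\<mu>. Poly_Mapping.lookup F \<mu> * ((\<Prod>k<r. a k ^ ?e \<mu> k) - 1)"
  have "(\<Sum>\<mu>\<in>Poly_Mapping.keys F. ?a \<mu> * (\<Prod>k<r. x k ^ ?e \<mu> k)) = 0" for x
    using inv[of x] unfolding eval_at_form[OF form]
    by (simp add: algebra_simps power_mult_distrib prod.distrib sum_subtractf)
  then have "(\<Sum>\<nu> | \<nu> \<in> Poly_Mapping.keys F \<and> (\<forall>k\<in>{..<r}. ?e \<nu> k = ?e \<mu> k). ?a \<nu>) = 0"
    by (intro polyfun_zero_coeffs) auto
  moreover have "{\<nu>. \<nu> \<in> Poly_Mapping.keys F \<and> (\<forall>k\<in>{..<r}. ?e \<nu> k = ?e \<mu> k)} = {\<mu>}"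
  proof -
    have "\<nu> = \<mu>" if "\<nu> \<in> Poly_Mapping.keys F" "\<forall>k\<in>{..<r}. ?e \<nu> k = ?e \<mu> k" for \<nu>
    proof (rule poly_mapping_eqI)
      fix k show "?e \<nu> k = ?e \<mu> k"
      proof (cases "k < r")
        case False
        then have "k \<notin> Poly_Mapping.keys \<nu>" "k \<notin> Poly_Mapping.keys \<mu>"
          using form that(1) \<mu> unfolding is_form_def by auto
        then show ?thesis by (simp add: in_keys_iff)
      qed (use that(2) in auto)
    qed
    then show ?thesis using \<mu> by blast
  qed
  ultimately show ?thesis using \<mu> by (simp add: in_keys_iff)
qed

lemma mult_mat_vec_diagonal:
  fixes A :: "complex mat"
  assumes A: "A \<in> carrier_mat r r" and e: "\<And>p. p < r \<Longrightarrow> A *\<^sub>v unit_vec r p = a p \<cdot>\<^sub>v unit_vec r p"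
  shows "A = mat r r (\<lambda>(i, j). if i = j then a j else 0)" "A *\<^sub>v vec r x = vec r (\<lambda>k. a k * x k)"
proof -
  show A': "A = mat r r (\<lambda>(i, j). if i = j then a j else 0)"
  proof (rule eq_matI)
    fix i j assume "i < dim_row (mat r r (\<lambda>(i, j). if i = j then a j else 0))"
      "j < dim_col (mat r r (\<lambda>(i, j). if i = j then a j else 0))"
    then have ij: "i < r" "j < r" by auto
    have "(A *\<^sub>v unit_vec r j) $ i = A $$ (i, j)" using A ij by simp
    then show "A $$ (i, j) = mat r r (\<lambda>(i, j). if i = j then a j else 0) $$ (i, j)"
      using e[OF ij(2)] ij by auto
  qed (use A in auto)
  show "A *\<^sub>v vec r x = vec r (\<lambda>k. a k * x k)"
  proof (rule eq_vecI)
    fix i assume "i < dim_vec (vec r (\<lambda>k. a k * x k))"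
    then have i: "i < r" by simp
    have "(A *\<^sub>v vec r x) $ i = (\<Sum>q<r. if i = q then a q * x q else 0)"
      using i by (subst mult_mat_vec_index[OF A]) (auto simp: A' if_distrib[of "\<lambda>a. a * _"] cong: if_cong)
    then show "(A *\<^sub>v vec r x) $ i = vec r (\<lambda>k. a k * x k) $ i" using i by simp
  qed (use A in auto)
qed

text \<open>One coordinate per block is enough: its monomial from smoothness yields an equation
  between the scalar of that block and the scalar of the block containing \<open>x\<^sub>q\<close>,
  here \<open>\<tau> i\<close>. Thus the number of unknowns is the number of blocks, not of
  coordinates.\<close>

lemma card_block_scalar_automorphisms:
  fixes b :: "nat \<Rightarrow> 'b"
  assumes form: "is_form r d F" and sm: "smooth r F" and d: "d \<ge> 3"
    and I: "finite I" "b ` {..<r} = I"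
    and N: "\<And>g. g \<in> N \<Longrightarrow> g \<in> carrier_mat r r"
    and inv: "\<And>g v. g \<in> N \<Longrightarrow> v \<in> carrier_vec r \<Longrightarrow> eval_at (g *\<^sub>v v) F = eval_at v F"
    and diag: "\<And>g. g \<in> N \<Longrightarrow> \<exists>\<zeta>. \<forall>p<r. g *\<^sub>v unit_vec r p = \<zeta> (b p) \<cdot>\<^sub>v unit_vec r p"
  shows "finite N" "card N \<le> d ^ card I"
proof -
  have "\<forall>i\<in>I. \<exists>p<r. b p = i" using I(2) by auto
  then obtain p where p: "\<And>i. i \<in> I \<Longrightarrow> p i < r \<and> b (p i) = i" by metis
  have d1: "d \<ge> 1" using d by simp
  have "\<exists>\<mu> q. \<mu> \<in> Poly_Mapping.keys F \<and> q < r \<and>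
    (\<forall>k. Poly_Mapping.lookup \<mu> k = (if k = p i then d - 1 else 0) + (if k = q then 1 else 0))" if "i \<in> I" for i
  proof -
    have pi: "p i < r" using p[OF that] by blast
    show ?thesis by (rule smooth_form_monomial[OF form sm pi d1]) blast
  qed
  then obtain \<mu> q where \<mu>: "\<And>i. i \<in> I \<Longrightarrow> \<mu> i \<in> Poly_Mapping.keys F \<and> q i < r \<and>
    (\<forall>k. Poly_Mapping.lookup (\<mu> i) k = (if k = p i then d - 1 else 0) + (if k = q i then 1 else 0))" by metis
  define \<tau> where "\<tau> i = b (q i)" for i
  have \<tau>: "\<tau> i \<in> I" if "i \<in> I" for i using \<mu>[OF that] I(2) unfolding \<tau>_def by blast
  define L where "L = {\<zeta> \<in> I \<rightarrow>\<^sub>E (UNIV :: complex set). \<forall>i\<in>I. \<zeta> i ^ (d - 1) * \<zeta> (\<tau> i) = 1}"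
  have L: "finite L" "card L \<le> d ^ card I"
    unfolding L_def by (rule torus_solutions[OF I(1) \<tau> d]; assumption)+
  obtain \<Lambda> where \<Lambda>: "\<And>g k. g \<in> N \<Longrightarrow> k < r \<Longrightarrow> g *\<^sub>v unit_vec r k = \<Lambda> g (b k) \<cdot>\<^sub>v unit_vec r k"
    using diag by metis
  have "(\<lambda>g. restrict (\<Lambda> g) I) ` N \<subseteq> L"
  proof
    fix f assume "f \<in> (\<lambda>g. restrict (\<Lambda> g) I) ` N"
    then obtain g where g: "g \<in> N" "f = restrict (\<Lambda> g) I" by auto
    have "\<Lambda> g i ^ (d - 1) * \<Lambda> g (\<tau> i) = 1" if i: "i \<in> I" for i
    proof -
      have "eval_at (vec r (\<lambda>k. \<Lambda> g (b k) * x k)) F = eval_at (vec r x) F" for x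
        using inv[OF g(1), of "vec r x"] mult_mat_vec_diagonal(2)[OF N[OF g(1)] \<Lambda>[OF g(1)]] by simp
      then have "(\<Prod>k<r. \<Lambda> g (b k) ^ Poly_Mapping.lookup (\<mu> i) k) = 1"
        using \<mu>[OF i] by (intro diagonal_invariant_monomial[OF form]) auto
      moreover have "(\<Prod>k<r. \<Lambda> g (b k) ^ Poly_Mapping.lookup (\<mu> i) k) =
          (\<Prod>k<r. if k = p i then \<Lambda> g (b k) ^ (d - 1) else 1) * (\<Prod>k<r. if k = q i then \<Lambda> g (b k) else 1)"
      proof -
        have "(\<Prod>k<r. \<Lambda> g (b k) ^ Poly_Mapping.lookup (\<mu> i) k) =
            (\<Prod>k<r. (if k = p i then \<Lambda> g (b k) ^ (d - 1) else 1) * (if k = q i then \<Lambda> g (b k) else 1))"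
          using \<mu>[OF i] by (intro prod.cong refl) (simp add: power_add)
        then show ?thesis by (simp only: prod.distrib)
      qed
      ultimately show ?thesis using p[OF i] \<mu>[OF i] by (simp add: \<tau>_def)
    qed
    then show "f \<in> L" unfolding L_def g(2) using \<tau> by auto
  qed
  moreover have "inj_on (\<lambda>g. restrict (\<Lambda> g) I) N"
  proof (rule inj_onI)
    fix g h assume g: "g \<in> N" and h: "h \<in> N" and eq: "restrict (\<Lambda> g) I = restrict (\<Lambda> h) I"
    have ab: "\<Lambda> g (b k) = \<Lambda> h (b k)" if "k < r" for k
      using fun_cong[OF eq, of "b k"] I(2) that by auto
    have "g = mat r r (\<lambda>(i, j). if i = j then \<Lambda> g (b j) else 0)"
      by (rule mult_mat_vec_diagonal(1)[OF N[OF g] \<Lambda>[OF g]])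
    also have "\<dots> = mat r r (\<lambda>(i, j). if i = j then \<Lambda> h (b j) else 0)"
      using ab by (intro cong_mat) auto
    also have "\<dots> = h"
      by (rule mult_mat_vec_diagonal(1)[OF N[OF h] \<Lambda>[OF h], symmetric])
    finally show "g = h" .
  qed
  ultimately show "finite N" "card N \<le> d ^ card I"
    using L card_inj_on_le[of "\<lambda>g. restrict (\<Lambda> g) I" N L] by (auto intro: inj_on_finite)
qed

subsection \<open>The invariant bilinear part\<close>

text \<open>The first polar of \<open>F\<close>: the derivative at \<open>x\<close> in direction
  \<open>y\<close>. It is linear in \<open>y\<close> only, so the subspace of degenerate vectors is
  formed in the second argument.\<close>

definition polar :: "nat \<Rightarrow> cpoly \<Rightarrow> complex vec \<Rightarrow> complex vec \<Rightarrow> complex" where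
  "polar r F x y = (\<Sum>q<r. y $ q * eval_at x (partial q F))"

text \<open>Both sides are the derivative at 0 of the same function, because \<open>F\<close> takes
  equal values along the two lines.\<close>

lemma polar_mult_mat_vec:
  assumes form: "is_form r d F" and g: "g \<in> carrier_mat r r"
    and inv: "\<And>v. v \<in> carrier_vec r \<Longrightarrow> eval_at (g *\<^sub>v v) F = eval_at v F"
    and xy: "x \<in> carrier_vec r" "y \<in> carrier_vec r"
  shows "polar r F (g *\<^sub>v x) (g *\<^sub>v y) = polar r F x y"
proof -
  have "g *\<^sub>v x + t \<cdot>\<^sub>v (g *\<^sub>v y) = g *\<^sub>v (x + t \<cdot>\<^sub>v y)" for t
    using g xy by (simp add: mult_add_distrib_mat_vec mult_mat_vec)
  then have "eval_at (g *\<^sub>v x + t \<cdot>\<^sub>v (g *\<^sub>v y)) F = eval_at (x + t \<cdot>\<^sub>v y) F" for t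
    using inv[of "x + t \<cdot>\<^sub>v y"] xy by simp
  then show ?thesis
    using DERIV_eval_at_line[OF form xy] DERIV_eval_at_line[OF form, of "g *\<^sub>v x" "g *\<^sub>v y"] g xy DERIV_unique
    unfolding polar_def by auto
qed

lemma polar_add: "u \<in> carrier_vec r \<Longrightarrow> v \<in> carrier_vec r \<Longrightarrow> polar r F x (u + v) = polar r F x u + polar r F x v"
  unfolding polar_def by (simp add: distrib_right sum.distrib)

lemma polar_smult: "v \<in> carrier_vec r \<Longrightarrow> polar r F x (c \<cdot>\<^sub>v v) = c * polar r F x v"
  unfolding polar_def by (simp add: sum_distrib_left mult_ac)

lemma polar_unit_vec: "p < r \<Longrightarrow> polar r F x (unit_vec r p) = eval_at x (partial p F)"
  unfolding polar_def by (simp add: if_distrib[of "\<lambda>x. x * _"] cong: if_cong)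

text \<open>Let \<open>x\<^sub>p\<close> be the single variable of \<open>V2\<close> in
  \<open>\<mu>\<close>. If the pairing vanished, the partial derivative of \<open>F\<close> by
  \<open>x\<^sub>p\<close> would be zero on \<open>V\<close>; but there it contains the monomial
  \<open>\<mu>\<close> divided by \<open>x\<^sub>p\<close>, with nonzero coefficient.\<close>

lemma polar_nonzero:
  assumes form: "is_form r d F" and V: "is_subspace r V" and \<mu>: "\<mu> \<in> Poly_Mapping.keys F"
    and tens: "in_sym_tensor r \<mu> a V 1 V2"
  shows "\<exists>x\<in>V. \<exists>y\<in>V2. polar r F x y \<noteq> 0"
proof (rule ccontr)
  assume zero: "\<not> ?thesis"
  let ?C = "coords r V" and ?D = "coords r V2" and ?l = Poly_Mapping.lookup
  have C: "?C \<subseteq> {..<r}" and D: "?D \<subseteq> {..<r}" unfolding coords_def by auto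
  have fin: "finite ?C" "finite ?D" using C D finite_subset by blast+
  have keys: "Poly_Mapping.keys \<mu> \<subseteq> ?C \<union> ?D" and one: "(\<Sum>p\<in>?D. ?l \<mu> p) = 1"
    using tens unfolding in_sym_tensor_def by auto
  obtain p where p: "p \<in> ?D" "?l \<mu> p = 1" "\<And>k. k \<in> ?D \<Longrightarrow> k \<noteq> p \<Longrightarrow> ?l \<mu> k = 0"
    using one fin(2) by (auto simp: sum_eq_Suc0_iff)
  have pr: "p < r" and eV2: "unit_vec r p \<in> V2" using p(1) unfolding coords_def by auto
  define e :: "(nat \<Rightarrow>\<^sub>0 nat) \<Rightarrow> nat \<Rightarrow> nat" where "e \<nu> k = ?l \<nu> k - (if k = p then 1 else 0)" for \<nu> k
  \<comment> \<open>Only these monomials can contribute on \<open>V\<close> after differentiation by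
    \<open>x\<^sub>p\<close>; any other retains a coordinate outside \<open>coords r V\<close>,
    which is 0 at the test vector.\<close>
  define A where "A = {\<nu> \<in> Poly_Mapping.keys F. \<forall>k<r. k \<notin> ?C \<longrightarrow> e \<nu> k = 0}"
  let ?a = "\<lambda>\<nu>. of_nat (?l \<nu> p) * ?l F \<nu>"
  have "(\<Sum>\<nu>\<in>A. ?a \<nu> * (\<Prod>k\<in>?C. x k ^ e \<nu> k)) = 0" for x
  proof -
    define v where "v = vec r (\<lambda>k. if k \<in> ?C then x k else 0)"
    have "v = vsum r (\<lambda>k. x k \<cdot>\<^sub>v unit_vec r k) ?C"
      unfolding v_def by (rule vec_eq_vsum_unit_vecs[OF C])
    also have "\<dots> \<in> V"
      using fin by (intro vsum_in_subspace[OF V] subspace_smult[OF V]) (auto simp: coords_def)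
    finally have "polar r F v (unit_vec r p) = 0" using zero eV2 by blast
    then have "(\<Sum>\<nu>\<in>Poly_Mapping.keys F. ?a \<nu> * (\<Prod>k<r. (v $ k) ^ e \<nu> k)) = 0"
      unfolding polar_unit_vec[OF pr] eval_at_partial[OF form] e_def .
    also have "(\<Sum>\<nu>\<in>Poly_Mapping.keys F. ?a \<nu> * (\<Prod>k<r. (v $ k) ^ e \<nu> k)) = (\<Sum>\<nu>\<in>A. ?a \<nu> * (\<Prod>k<r. (v $ k) ^ e \<nu> k))"
    proof (rule sum.mono_neutral_right)
      show "\<forall>\<nu>\<in>Poly_Mapping.keys F - A. ?a \<nu> * (\<Prod>k<r. (v $ k) ^ e \<nu> k) = 0"
      proof
        fix \<nu> assume "\<nu> \<in> Poly_Mapping.keys F - A"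
        then obtain k where k: "k < r" "k \<notin> ?C" "e \<nu> k \<noteq> 0" unfolding A_def by auto
        then have "(v $ k) ^ e \<nu> k = 0" by (simp add: v_def)
        then have "(\<Prod>k<r. (v $ k) ^ e \<nu> k) = 0" using k(1) by (intro prod_zero) auto
        then show "?a \<nu> * (\<Prod>k<r. (v $ k) ^ e \<nu> k) = 0" by simp
      qed
    qed (auto simp: A_def)
    also have "\<dots> = (\<Sum>\<nu>\<in>A. ?a \<nu> * (\<Prod>k\<in>?C. x k ^ e \<nu> k))"
    proof (intro sum.cong refl arg_cong2[of _ _ _ _ "(*)"])
      fix \<nu> assume \<nu>: "\<nu> \<in> A"
      have "(\<Prod>k<r. (v $ k) ^ e \<nu> k) = (\<Prod>k\<in>?C. (v $ k) ^ e \<nu> k)"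
        using C \<nu> by (intro prod.mono_neutral_right) (auto simp: A_def)
      also have "\<dots> = (\<Prod>k\<in>?C. x k ^ e \<nu> k)"
        using C by (intro prod.cong) (auto simp: v_def)
      finally show "(\<Prod>k<r. (v $ k) ^ e \<nu> k) = (\<Prod>k\<in>?C. x k ^ e \<nu> k)" .
    qed
    finally show ?thesis .
  qed
  then have "(\<Sum>\<nu> | \<nu> \<in> A \<and> (\<forall>k\<in>?C. e \<nu> k = e \<mu> k). ?a \<nu>) = 0"
    by (intro polyfun_zero_coeffs fin) (auto simp: A_def)
  moreover have "(\<Sum>\<nu> | \<nu> \<in> A \<and> (\<forall>k\<in>?C. e \<nu> k = e \<mu> k). ?a \<nu>) = (\<Sum>\<nu>\<in>{\<mu>}. ?a \<nu>)"
  proof (rule sum.mono_neutral_right)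
    have off: "e \<mu> k = 0" if "k < r" "k \<notin> ?C" for k
    proof (cases "k \<in> Poly_Mapping.keys \<mu>")
      case True
      then have "k \<in> ?D" using keys that by blast
      then show ?thesis using p unfolding e_def by (cases "k = p") auto
    qed (simp add: e_def in_keys_iff)
    then show "{\<mu>} \<subseteq> {\<nu> \<in> A. \<forall>k\<in>?C. e \<nu> k = e \<mu> k}" using \<mu> by (auto simp: A_def)
    \<comment> \<open>By truncation, a monomial without \<open>x\<^sub>p\<close> may have the same
      lowered exponents as \<open>\<mu>\<close>; it is harmless because its coefficient carries the
      factor 0.\<close>
    show "\<forall>\<nu>\<in>{\<nu> \<in> A. \<forall>k\<in>?C. e \<nu> k = e \<mu> k} - {\<mu>}. ?a \<nu> = 0"
    proof
      fix \<nu> assume \<nu>: "\<nu> \<in> {\<nu> \<in> A. \<forall>k\<in>?C. e \<nu> k = e \<mu> k} - {\<mu>}"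
      have "?l \<nu> p = 0"
      proof (rule ccontr)
        assume nz: "?l \<nu> p \<noteq> 0"
        have "?l \<nu> k = ?l \<mu> k" for k
        proof (cases "k < r")
          case True
          then have "e \<nu> k = e \<mu> k" using \<nu> off by (cases "k \<in> ?C") (auto simp: A_def)
          then show ?thesis using nz p(2) unfolding e_def by (cases "k = p") auto
        next
          case False
          then have "k \<notin> Poly_Mapping.keys \<nu>" "k \<notin> Poly_Mapping.keys \<mu>"
            using form \<nu> \<mu> unfolding is_form_def A_def by auto
          then show ?thesis by (simp add: in_keys_iff)
        qed
        then have "\<nu> = \<mu>" by (rule poly_mapping_eqI)
        then show False using \<nu> by simp
      qed
      then show "?a \<nu> = 0" by simp
    qed
  qed (simp add: A_def)
  ultimately show False using p(2) \<mu> by (simp add: in_keys_iff)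
qed

text \<open>The vectors \<open>y \<in> V2\<close> for which the derivative of \<open>F\<close> in direction \<open>y\<close> vanishes on \<open>V\<close>
  form a stable proper subspace of the irreducible space \<open>V2\<close>.\<close>

lemma (in matrix_group) trivial_on_irreducible:
  assumes form: "is_form n d F"
    and inv: "\<And>g v. g \<in> \<Gamma> \<Longrightarrow> v \<in> carrier_vec n \<Longrightarrow> eval_at (g *\<^sub>v v) F = eval_at v F"
    and V: "is_subspace n V" and stable: "\<And>g x. g \<in> \<Gamma> \<Longrightarrow> x \<in> V \<Longrightarrow> g *\<^sub>v x \<in> V"
    and irr: "acts_irreducibly n \<Gamma> V2"
    and \<mu>: "\<mu> \<in> Poly_Mapping.keys F" "in_sym_tensor n \<mu> a V 1 V2"
    and c: "c \<in> \<Gamma>" "\<And>x. x \<in> V \<Longrightarrow> c *\<^sub>v x = x" and y: "y \<in> V2"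
  shows "c *\<^sub>v y = y"
proof -
  have V2: "is_subspace n V2" and tr: "\<And>g. g \<in> \<Gamma> \<Longrightarrow> translate g V2 = V2"
    and min: "\<And>U. is_subspace n U \<Longrightarrow> U \<subseteq> V2 \<Longrightarrow> (\<forall>g\<in>\<Gamma>. translate g U = U) \<Longrightarrow> U = {0\<^sub>v n} \<or> U = V2"
    using irr unfolding acts_irreducibly_def by auto
  have Vc: "x \<in> carrier_vec n" if "x \<in> V" for x using that subspace_carrier[OF V] by blast
  have V2c: "y \<in> carrier_vec n" if "y \<in> V2" for y using that subspace_carrier[OF V2] by blast
  have gV2: "g *\<^sub>v y \<in> V2" if "g \<in> \<Gamma>" "y \<in> V2" for g y using tr[OF that(1)] that(2) unfolding translate_def by blast
  have pinv: "polar n F (g *\<^sub>v x) (g *\<^sub>v y) = polar n F x y" if "g \<in> \<Gamma>" "x \<in> V" "y \<in> V2" for g x y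
    using that Vc V2c inv in_carrier by (intro polar_mult_mat_vec[OF form])
  define K where "K = {y \<in> V2. \<forall>x\<in>V. polar n F x y = 0}"
  have K: "is_subspace n K"
    unfolding is_subspace_iff K_def using V2c subspace_zero[OF V2] subspace_add[OF V2] subspace_smult[OF V2]
    by (auto simp: polar_add polar_smult) (simp add: polar_def)
  have gK: "g *\<^sub>v y \<in> K" if g: "g \<in> \<Gamma>" and y: "y \<in> K" for g y
  proof -
    have yV2: "y \<in> V2" using y unfolding K_def by simp
    have "polar n F x (g *\<^sub>v y) = 0" if x: "x \<in> V" for x
    proof -
      have "polar n F (g *\<^sub>v (minv g *\<^sub>v x)) (g *\<^sub>v y) = polar n F (minv g *\<^sub>v x) y"
        using stable[OF minv(1)[OF g] x] yV2 by (rule pinv[OF g])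
      then show ?thesis
        using minv_mult_vec(2)[OF g Vc[OF x]] stable[OF minv(1)[OF g] x] y unfolding K_def by simp
    qed
    then show ?thesis using gV2[OF g yV2] unfolding K_def by simp
  qed
  have "translate g K = K" if g: "g \<in> \<Gamma>" for g
  proof
    show "translate g K \<subseteq> K" using gK[OF g] unfolding translate_def by blast
    show "K \<subseteq> translate g K"
    proof
      fix y assume y: "y \<in> K"
      then have "y = g *\<^sub>v (minv g *\<^sub>v y)" using minv_mult_vec(2)[OF g] V2c unfolding K_def by simp
      then show "y \<in> translate g K" unfolding translate_def using gK[OF minv(1)[OF g] y] by blast
    qed
  qed
  then have "K = {0\<^sub>v n} \<or> K = V2" using min[OF K] unfolding K_def by blast
  moreover have "K \<noteq> V2" using polar_nonzero[OF form V \<mu>] unfolding K_def by blast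
  ultimately have K0: "K = {0\<^sub>v n}" by blast
  let ?z = "c *\<^sub>v y + (-1) \<cdot>\<^sub>v y"
  have cy: "c *\<^sub>v y \<in> V2" using gV2[OF c(1) y] .
  \<comment> \<open>As \<open>c\<close> fixes \<open>x\<close>, invariance makes the pairing of
    \<open>x\<close> with \<open>c y\<close> equal to the pairing of \<open>x\<close> with
    \<open>y\<close>.\<close>
  have "polar n F x ?z = 0" if x: "x \<in> V" for x
    using pinv[OF c(1) x y] c(2)[OF x] V2c[OF cy] V2c[OF y] by (simp add: polar_add polar_smult)
  then have "?z \<in> K" unfolding K_def using cy y by (auto intro!: subspace_add[OF V2] subspace_smult[OF V2])
  then have z: "?z = 0\<^sub>v n" using K0 by simp
  show ?thesis
  proof (rule eq_vecI)
    show "dim_vec (c *\<^sub>v y) = dim_vec y" using V2c[OF cy] V2c[OF y] dims(1)[OF c(1)] by simp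
    fix i assume "i < dim_vec y"
    then have i: "i < n" using V2c[OF y] by simp
    have "?z $ i = 0" using z i by simp
    then show "(c *\<^sub>v y) $ i = y $ i" using i V2c[OF y] V2c[OF cy] dims(1)[OF c(1)] by (simp del: index_mult_mat_vec)
  qed
qed

subsection \<open>Counting\<close>

text \<open>Putting \<open>v\<close> at index \<open>i\<close> and its negative at \<open>j\<close>
  gives a family with sum zero.\<close>

lemma direct_sum_disjoint:
  assumes D: "is_direct_sum n W I U" and ij: "i \<in> I" "j \<in> I" "i \<noteq> j" and v: "v \<in> U i" "v \<in> U j"
  shows "v = 0\<^sub>v n"
proof -
  note d = is_direct_sumD[OF D]
  have vc: "v \<in> carrier_vec n" using d(3)[OF ij(1)] v(1) subspace_carrier by blast
  let ?u = "\<lambda>x. if x = i then v else if x = j then (-1) \<cdot>\<^sub>v v else 0\<^sub>v n"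
  let ?a = "\<lambda>x. if x = i then v else 0\<^sub>v n" and ?b = "\<lambda>x. if x = j then (-1) \<cdot>\<^sub>v v else 0\<^sub>v n"
  have "vsum n ?u I = vsum n (\<lambda>x. ?a x + ?b x) I"
    using d(1) vc ij(3) by (intro vsum_cong) auto
  also have "\<dots> = v + (-1) \<cdot>\<^sub>v v"
    using d(1) vc ij by (subst vsum_add) (auto simp: vsum_single)
  also have "\<dots> = 0\<^sub>v n" using vc by (intro eq_vecI) auto
  finally have "vsum n ?u I = 0\<^sub>v n" .
  moreover have "?u x \<in> U x" if "x \<in> I" for x
    using v subspace_zero[OF d(3)[OF that]] subspace_smult[OF d(3)[OF that]] by auto
  ultimately have "?u i = 0\<^sub>v n" by (intro d(6)[of ?u i] ij(1))
  then show ?thesis by simp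
qed

lemma direct_sum_factor_nonzero:
  assumes "is_direct_sum n W I U" "W \<noteq> {0\<^sub>v n}"
  shows "I \<noteq> {}"
proof
  assume "I = {}"
  have "w = 0\<^sub>v n" if w: "w \<in> W" for w
  proof -
    obtain u where "w = vsum n u I" using is_direct_sumD(5)[OF assms(1) w] by blast
    then show ?thesis unfolding \<open>I = {}\<close> by (simp add: finsum_vec_empty)
  qed
  then have "W = {0\<^sub>v n}" using subspace_zero[OF is_direct_sumD(2)[OF assms(1)]] by blast
  then show False using assms(2) by simp
qed

lemma fact_mult_le: "fact a * fact b \<le> (fact (a + b) :: nat)"
  by (intro dvd_imp_le fact_fact_dvd_fact) auto

text \<open>Integrality of multinomial coefficients. It accounts for different \<open>V i\<close>
  whose blocks have the same dimension, which the subdegree sequence merges.\<close>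

lemma prod_fact_le_fact_sum: "finite A \<Longrightarrow> (\<Prod>i\<in>A. fact (f i)) \<le> (fact (\<Sum>i\<in>A. f i) :: nat)"
proof (induction A rule: finite_induct)
  case (insert x A)
  then have "(\<Prod>i\<in>insert x A. fact (f i)) \<le> fact (f x) * (fact (\<Sum>i\<in>A. f i) :: nat)" by simp
  also have "\<dots> \<le> fact (\<Sum>i\<in>insert x A. f i)" using insert fact_mult_le by simp
  finally show ?case .
qed simp

text \<open>A count in the style of Lagrange: each element is the representative of its fibre times
  an element of \<open>N\<close>. As \<open>f\<close> is an arbitrary map, permutations and tuples
  of cosets can be inserted without showing that they multiply correctly; finiteness of the group is
  part of the result.\<close>

lemma (in matrix_group) card_le_fibres:
  assumes "finite (f ` \<Gamma>)" "finite N" "\<And>g h. g \<in> \<Gamma> \<Longrightarrow> h \<in> \<Gamma> \<Longrightarrow> f g = f h \<Longrightarrow> minv g * h \<in> N"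
  shows "finite \<Gamma>" "card \<Gamma> \<le> card (f ` \<Gamma>) * card N"
proof -
  let ?r = "\<lambda>y. SOME g. g \<in> \<Gamma> \<and> f g = y"
  have "\<Gamma> \<subseteq> (\<lambda>(y, x). ?r y * x) ` (f ` \<Gamma> \<times> N)"
  proof
    fix h assume h: "h \<in> \<Gamma>"
    have r: "?r (f h) \<in> \<Gamma> \<and> f (?r (f h)) = f h" by (rule someI[of _ h]) (use h in auto)
    then have "h = ?r (f h) * (minv (?r (f h)) * h)" using h by simp
    moreover have "minv (?r (f h)) * h \<in> N" using assms(3) r h by blast
    ultimately show "h \<in> (\<lambda>(y, x). ?r y * x) ` (f ` \<Gamma> \<times> N)"
      using h by (intro image_eqI[of _ _ "(f h, minv (?r (f h)) * h)"]) simp_all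
  qed
  moreover have "finite (f ` \<Gamma> \<times> N)" using assms(1,2) by simp
  ultimately show "finite \<Gamma>" "card \<Gamma> \<le> card (f ` \<Gamma>) * card N"
    using finite_surj[of "f ` \<Gamma> \<times> N" \<Gamma>] surj_card_le[of "f ` \<Gamma> \<times> N" \<Gamma>] by (auto simp: card_cartesian_product)
qed

lemma (in matrix_group) translate_mult:
  assumes "g \<in> \<Gamma>" "h \<in> \<Gamma>" "U \<subseteq> carrier_vec n"
  shows "translate (g * h) U = translate g (translate h U)"
  unfolding translate_def image_image using assms by (intro image_cong refl mult_vec) auto

lemma (in matrix_group) translate_minv:
  assumes "g \<in> \<Gamma>" "U \<subseteq> carrier_vec n"
  shows "translate (minv g) (translate g U) = U"
proof -
  have "(\<lambda>v. minv g *\<^sub>v (g *\<^sub>v v)) ` U = (\<lambda>v. v) ` U"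
    using minv_mult_vec(1)[OF assms(1)] assms(2) by (intro image_cong) auto
  then show ?thesis unfolding translate_def image_image by simp
qed

text \<open>Conjugation by \<open>g\<close> carries one stabilizer into the other and preserves
  proportionality.\<close>

lemma (in matrix_group) card_H_group_translate_le:
  assumes W: "is_subspace n W" and g: "g \<in> \<Gamma>" "translate g W = W'" and W': "is_subspace n W'"
    and fin: "finite (H_group n \<Gamma> W')"
  shows "card (H_group n \<Gamma> W) \<le> card (H_group n \<Gamma> W')"
  unfolding H_group_def proj_image_def
proof (rule card_image_le_image(2)[where h = "\<lambda>a. g * a * minv g"])
  note [simp] = mult minv(1)
  have Wc: "W \<subseteq> carrier_vec n" "W' \<subseteq> carrier_vec n" using W W' unfolding is_subspace_iff by auto
  show "finite (proj_coset W' ` stabilizer \<Gamma> W')" using fin unfolding H_group_def proj_image_def .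
  have W'_W: "translate (minv g) W' = W" using translate_minv[OF g(1) Wc(1)] g(2) by simp
  show st: "g * a * minv g \<in> stabilizer \<Gamma> W'" if "a \<in> stabilizer \<Gamma> W" for a
    using that g Wc W'_W unfolding stabilizer_def by (simp add: translate_mult)
  fix a b assume a: "a \<in> stabilizer \<Gamma> W" and b: "b \<in> stabilizer \<Gamma> W"
    and eq: "proj_coset W' (g * a * minv g) = proj_coset W' (g * b * minv g)"
  have a': "a \<in> \<Gamma>" "translate a W = W" and b': "b \<in> \<Gamma>" "translate b W = W"
    using a b unfolding stabilizer_def by auto
  obtain c where c: "c \<noteq> 0" "\<And>v. v \<in> W' \<Longrightarrow> (g * b * minv g) *\<^sub>v v = c \<cdot>\<^sub>v ((g * a * minv g) *\<^sub>v v)"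
    using proj_coset_eq_iff[OF W', of "g * a * minv g" "g * b * minv g"] eq st[OF a] st[OF b]
    unfolding stabilizer_def by blast
  have "b *\<^sub>v w = c \<cdot>\<^sub>v (a *\<^sub>v w)" if w: "w \<in> W" for w
  proof -
    have wc: "w \<in> carrier_vec n" using w Wc by auto
    have conj: "(g * x * minv g) *\<^sub>v (g *\<^sub>v w) = g *\<^sub>v (x *\<^sub>v w)" if "x \<in> \<Gamma>" for x
      using that g(1) wc by (simp add: mult_vec minv_mult_vec)
    have "g *\<^sub>v w \<in> W'" using g(2) w unfolding translate_def by blast
    then have "g *\<^sub>v (b *\<^sub>v w) = c \<cdot>\<^sub>v (g *\<^sub>v (a *\<^sub>v w))"
      using c(2)[of "g *\<^sub>v w"] conj a' b' by simp
    also have "\<dots> = g *\<^sub>v (c \<cdot>\<^sub>v (a *\<^sub>v w))"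
      using in_carrier[OF g(1)] a'(1) by (simp add: mult_mat_vec)
    finally have "minv g *\<^sub>v (g *\<^sub>v (b *\<^sub>v w)) = minv g *\<^sub>v (g *\<^sub>v (c \<cdot>\<^sub>v (a *\<^sub>v w)))" by simp
    then show ?thesis using minv_mult_vec(1)[OF g(1)] a'(1) b'(1) by simp
  qed
  then show "proj_coset W a = proj_coset W b"
    using proj_coset_eq_iff[OF W a' b'] c(1) by blast
qed

section \<open>The subdegree sequence as a list\<close>

lemma sum_list_concat: "sum_list (concat xss) = sum_list (map sum_list (xss :: nat list list))"
  by (induction xss) auto

lemma prod_list_concat: "prod_list (concat xss) = prod_list (map prod_list (xss :: nat list list))"
  by (induction xss) auto

lemma count_list_replicate: "count_list (replicate n x) a = (if x = a then n else 0)"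
  by (induction n) auto

text \<open>Rewrites the quantities of \<open>fermat_ratio\<close> as products over the blocks.
  Everything is read off multisets, so sorting has no effect. The last claim is only an inequality,
  because equal values in different rows are counted together.\<close>

lemma card_grouped_list:
  fixes e :: "nat \<Rightarrow> nat \<Rightarrow> nat" and k :: "nat \<Rightarrow> nat"
  assumes const: "\<And>i j. i \<in> {1..m} \<Longrightarrow> j \<in> {1..k i} \<Longrightarrow> e i j = e i 1"
  defines "l \<equiv> rev (sort (concat (map (\<lambda>i. map (\<lambda>j. e i j) [1..<Suc (k i)]) [1..<Suc m])))"
  shows "length l = (\<Sum>i\<in>{1..m}. k i)"
    and "sum_list l = (\<Sum>i\<in>{1..m}. \<Sum>j\<in>{1..k i}. e i j)"
    and "prod_list (map f l) = (\<Prod>i\<in>{1..m}. \<Prod>j\<in>{1..k i}. f (e i j) :: nat)"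
    and "(\<Prod>i\<in>{1..m}. fact (k i)) \<le> (\<Prod>a\<in>set l. fact (count_list l a) :: nat)"
proof -
  let ?L = "concat (map (\<lambda>i. map (\<lambda>j. e i j) [1..<Suc (k i)]) [1..<Suc m])"
  have up: "set [1..<Suc x] = {1..x}" "distinct [1..<Suc x]" for x by auto
  have ms: "mset l = mset ?L" unfolding l_def by simp
  have sum_up: "sum_list (map h [1..<Suc x]) = (\<Sum>i\<in>{1..x}. h i)" for h :: "nat \<Rightarrow> nat" and x
    using sum_list_distinct_conv_sum_set[OF up(2)] up(1) by metis
  have prod_up: "prod_list (map h [1..<Suc x]) = (\<Prod>i\<in>{1..x}. h i)" for h :: "nat \<Rightarrow> nat" and x
    using prod.distinct_set_conv_list[OF up(2)] up(1) by metis
  have "length l = length ?L" using ms by (rule mset_eq_length)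
  also have "\<dots> = sum_list (map k [1..<Suc m])" by (simp add: length_concat comp_def del: upt_Suc)
  finally show "length l = (\<Sum>i\<in>{1..m}. k i)" by (simp only: sum_up)
  have "sum_list l = sum_list ?L" using ms by (metis sum_mset_sum_list)
  also have "\<dots> = sum_list (map (\<lambda>i. \<Sum>j\<in>{1..k i}. e i j) [1..<Suc m])"
    by (simp only: sum_list_concat map_map comp_def sum_up)
  finally show "sum_list l = (\<Sum>i\<in>{1..m}. \<Sum>j\<in>{1..k i}. e i j)" by (simp only: sum_up)
  have "mset (map f l) = mset (map f ?L)" using ms by simp
  then have "prod_list (map f l) = prod_list (map f ?L)" by (metis prod_mset_prod_list)
  also have "\<dots> = prod_list (map (\<lambda>i. \<Prod>j\<in>{1..k i}. f (e i j)) [1..<Suc m])"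
    by (simp only: map_concat prod_list_concat map_map comp_def prod_up)
  finally show "prod_list (map f l) = (\<Prod>i\<in>{1..m}. \<Prod>j\<in>{1..k i}. f (e i j))" by (simp only: prod_up)
  \<comment> \<open>Row \<open>i\<close> is constant, so it contributes \<open>k i\<close> copies of
    the value \<open>e i 1\<close>.\<close>
  have count: "count_list l a = (\<Sum>i | i \<in> {1..m} \<and> e i 1 = a. k i)" for a
  proof -
    have "count_list l a = count_list ?L a" using ms by (metis count_mset)
    also have "\<dots> = sum_list (map (\<lambda>i. count_list (map (e i) [1..<Suc (k i)]) a) [1..<Suc m])"
      by (simp only: count_list_concat map_map comp_def)
    also have "\<dots> = (\<Sum>i\<in>{1..m}. count_list (map (e i) [1..<Suc (k i)]) a)" by (rule sum_up)
    also have "\<dots> = (\<Sum>i\<in>{1..m}. if e i 1 = a then k i else 0)"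
    proof (intro sum.cong refl)
      fix i assume i: "i \<in> {1..m}"
      have "map (e i) [1..<Suc (k i)] = replicate (k i) (e i 1)"
      proof (rule replicate_eqI)
        fix y assume "y \<in> set (map (e i) [1..<Suc (k i)])"
        then obtain j where "j \<in> {1..k i}" "y = e i j"
          unfolding set_map up(1) by blast
        then show "y = e i 1" using const[OF i] by blast
      qed simp
      then show "count_list (map (e i) [1..<Suc (k i)]) a = (if e i 1 = a then k i else 0)"
        by (simp add: count_list_replicate)
    qed
    also have "\<dots> = (\<Sum>i | i \<in> {1..m} \<and> e i 1 = a. k i)" by (intro sum.inter_filter[symmetric]) simp
    finally show ?thesis .
  qed
  let ?S = "(\<lambda>i. e i 1) ` {1..m}"
  have set: "set l \<subseteq> ?S"
  proof
    fix a assume "a \<in> set l"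
    then have "a \<in> set ?L" using ms by (metis set_mset_mset)
    then obtain i j where "i \<in> {1..m}" "j \<in> {1..k i}" "a = e i j"
      by (auto simp only: set_concat set_map up(1) Union_iff image_iff)
    then show "a \<in> ?S" using const[of i j] by (intro image_eqI[of _ _ i]) simp_all
  qed
  have "(\<Prod>i\<in>{1..m}. fact (k i)) = (\<Prod>a\<in>?S. \<Prod>i | i \<in> {1..m} \<and> e i 1 = a. fact (k i) :: nat)"
    by (intro prod.group[symmetric]) auto
  also have "\<dots> \<le> (\<Prod>a\<in>?S. fact (count_list l a))"
    unfolding count by (intro prod_mono conjI prod_fact_le_fact_sum) auto
  also have "\<dots> = (\<Prod>a\<in>set l. fact (count_list l a))"
    using set by (intro prod.mono_neutral_right) (auto simp: count_list_0_iff)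
  finally show "(\<Prod>i\<in>{1..m}. fact (k i)) \<le> (\<Prod>a\<in>set l. fact (count_list l a) :: nat)" .
qed

subsection \<open>Decompositions\<close>

locale decomposition =
  fixes r m :: nat and G :: "complex mat set" and V :: "nat \<Rightarrow> complex vec set"
    and k :: "nat \<Rightarrow> nat" and W :: "nat \<Rightarrow> nat \<Rightarrow> complex vec set"
  assumes G: "subgroup G (GL r)"
    and data: "decomposition_data r G m V k W"
    and compat: "compatible_basis r m k W"
begin

sublocale matrix_group r G by (rule matrix_group_subgroup_GL[OF G])

definition blocks :: "(nat \<times> nat) set" where
  "blocks = (SIGMA i:{1..m}. {1..k i})"

lemma finite_blocks: "finite blocks"
  unfolding blocks_def by (intro finite_SigmaI) auto

lemma
  shows V_sum: "is_direct_sum r (carrier_vec r) {1..m} V"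
    and V_irr: "i \<in> {1..m} \<Longrightarrow> acts_irreducibly r G (V i)"
    and W_sum: "i \<in> {1..m} \<Longrightarrow> is_direct_sum r (V i) {1..k i} (W i)"
    and W_perm: "i \<in> {1..m} \<Longrightarrow> g \<in> G \<Longrightarrow> j \<in> {1..k i} \<Longrightarrow> \<exists>j'\<in>{1..k i}. translate g (W i j) = W i j'"
    and W_trans: "i \<in> {1..m} \<Longrightarrow> j \<in> {1..k i} \<Longrightarrow> j' \<in> {1..k i} \<Longrightarrow> \<exists>g\<in>G. translate g (W i j) = W i j'"
    and W_prim: "i \<in> {1..m} \<Longrightarrow> j \<in> {1..k i} \<Longrightarrow> acts_primitively r (stabilizer G (W i j)) (W i j)"
  using data unfolding decomposition_data_def by (elim conjE; blast)+

lemma V_sub: "i \<in> {1..m} \<Longrightarrow> is_subspace r (V i)"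
  using is_direct_sumD(3)[OF V_sum] .

lemma V_stable: "i \<in> {1..m} \<Longrightarrow> g \<in> G \<Longrightarrow> v \<in> V i \<Longrightarrow> g *\<^sub>v v \<in> V i"
  using V_irr unfolding acts_irreducibly_def translate_def by blast

lemma W_sub: "i \<in> {1..m} \<Longrightarrow> j \<in> {1..k i} \<Longrightarrow> is_subspace r (W i j)"
  using is_direct_sumD(3)[OF W_sum] .

lemma W_carrier: "i \<in> {1..m} \<Longrightarrow> j \<in> {1..k i} \<Longrightarrow> W i j \<subseteq> carrier_vec r"
  using W_sub unfolding is_subspace_iff by blast

lemma W_le_V: "i \<in> {1..m} \<Longrightarrow> j \<in> {1..k i} \<Longrightarrow> W i j \<subseteq> V i"
  using is_direct_sumD(4)[OF W_sum] .

lemma W_nonzero: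
  assumes "i \<in> {1..m}" "j \<in> {1..k i}"
  shows "W i j \<noteq> {0\<^sub>v r}"
  using W_prim[OF assms] unfolding acts_primitively_def acts_irreducibly_def by blast

text \<open>Distinct summands meet only in 0, whereas each block is nonzero. This makes the induced
  map on block indices injective.\<close>

lemma W_inj:
  assumes "i \<in> {1..m}" "j \<in> {1..k i}" "j' \<in> {1..k i}" "W i j = W i j'"
  shows "j = j'"
proof (rule ccontr)
  assume "j \<noteq> j'"
  then have "v = 0\<^sub>v r" if "v \<in> W i j" for v
    using direct_sum_disjoint[OF W_sum[OF assms(1)] assms(2,3)] assms(4) that by blast
  then show False using W_nonzero[OF assms(1,2)] subspace_zero[OF W_sub[OF assms(1,2)]] by blast
qed

lemma k_pos: "i \<in> {1..m} \<Longrightarrow> 1 \<in> {1..k i}"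
  using direct_sum_factor_nonzero[OF W_sum] V_irr unfolding acts_irreducibly_def by fastforce

lemma unit_vec_nonzero: "p < r \<Longrightarrow> unit_vec r p \<noteq> (0\<^sub>v r :: complex vec)"
  by (metis index_unit_vec(1) index_zero_vec(1) zero_neq_one)

lemma coords_disjoint:
  assumes "i \<in> {1..m}" "j \<in> {1..k i}" "i' \<in> {1..m}" "j' \<in> {1..k i'}"
    "p \<in> coords r (W i j)" "p \<in> coords r (W i' j')"
  shows "(i, j) = (i', j')"
proof -
  have p: "p < r" "unit_vec r p \<in> W i j" "unit_vec r p \<in> W i' j'" using assms(5,6) unfolding coords_def by auto
  have "i = i'"
  proof (rule ccontr)
    assume "i \<noteq> i'"
    then have "unit_vec r p = (0\<^sub>v r :: complex vec)"
      using direct_sum_disjoint[OF V_sum assms(1,3)] W_le_V assms(1-4) p(2,3) by blast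
    then show False using unit_vec_nonzero p(1) by blast
  qed
  moreover have "j = j'"
  proof (rule ccontr)
    assume "j \<noteq> j'"
    then have "unit_vec r p = (0\<^sub>v r :: complex vec)"
      using direct_sum_disjoint[OF W_sum[OF assms(1)] assms(2)] assms(4) p(2,3) \<open>i = i'\<close> by blast
    then show False using unit_vec_nonzero p(1) by blast
  qed
  ultimately show ?thesis by simp
qed

lemma W_span: "i \<in> {1..m} \<Longrightarrow> j \<in> {1..k i} \<Longrightarrow> vspan r (unit_vec r ` coords r (W i j)) = W i j"
  using compat[unfolded compatible_basis_def, THEN conjunct1] by blast

lemma coords_cover: "(\<Union>i\<in>{1..m}. \<Union>j\<in>{1..k i}. coords r (W i j)) = {..<r}"
  using compat[unfolded compatible_basis_def, THEN conjunct2, THEN conjunct1] .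

definition block_of :: "nat \<Rightarrow> nat \<times> nat" where
  "block_of p = (SOME (i, j). (i, j) \<in> blocks \<and> p \<in> coords r (W i j))"

lemma block_of:
  assumes "p < r"
  obtains i j where "block_of p = (i, j)" "i \<in> {1..m}" "j \<in> {1..k i}" "unit_vec r p \<in> W i j"
proof -
  have "p \<in> (\<Union>i\<in>{1..m}. \<Union>j\<in>{1..k i}. coords r (W i j))" using assms coords_cover by simp
  then obtain i j where "i \<in> {1..m}" "j \<in> {1..k i}" "p \<in> coords r (W i j)" by blast
  then have "\<exists>x. case x of (i, j) \<Rightarrow> (i, j) \<in> blocks \<and> p \<in> coords r (W i j)"
    unfolding blocks_def by (intro exI[of _ "(i, j)"]) simp
  from someI_ex[OF this] show ?thesis
    by (cases "block_of p") (use that in \<open>auto simp: block_of_def blocks_def coords_def\<close>)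
qed

lemma W_dim:
  assumes ij: "i \<in> {1..m}" "j \<in> {1..k i}"
  shows "sdim r (W i j) = card (coords r (W i j))" "\<exists>E P. frame r (sdim r (W i j)) (W i j) E P"
    "sdim r (W i j) > 0"
proof -
  obtain E P where fr: "frame r (card (coords r (W i j))) (W i j) E P"
    using coordinate_frame[OF W_span[OF ij]] by blast
  show dim: "sdim r (W i j) = card (coords r (W i j))" by (rule frame_sdim[OF W_sub[OF ij] fr])
  show "\<exists>E P. frame r (sdim r (W i j)) (W i j) E P" using fr unfolding dim by blast
  show "sdim r (W i j) > 0"
  proof (rule ccontr)
    assume "\<not> sdim r (W i j) > 0"
    moreover have "finite (coords r (W i j))" unfolding coords_def by simp
    ultimately have "coords r (W i j) = {}" unfolding dim by simp
    then have "W i j = {v \<in> carrier_vec r. \<forall>p<r. v $ p = 0}"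
      using W_span[OF ij] vspan_unit_vecs[of "{}" r] by simp
    also have "\<dots> = {0\<^sub>v r}" by (auto intro!: eq_vecI)
    finally show False using W_nonzero[OF ij] by blast
  qed
qed

text \<open>The blocks of one \<open>V i\<close> form an orbit, along which frames can be
  moved.\<close>

lemma W_dim_const:
  assumes "i \<in> {1..m}" "j \<in> {1..k i}"
  shows "sdim r (W i j) = sdim r (W i 1)"
proof -
  obtain E P where fr: "frame r (sdim r (W i 1)) (W i 1) E P"
    using W_dim(2)[OF assms(1) k_pos[OF assms(1)]] by blast
  obtain g where "g \<in> G" "translate g (W i 1) = W i j"
    using W_trans[OF assms(1) k_pos[OF assms(1)] assms(2)] by blast
  from frame_sdim[OF W_sub[OF assms] frame_translate[OF W_sub[OF assms(1) k_pos[OF assms(1)]] fr this]]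
  show ?thesis .
qed

text \<open>The compatible basis partitions the coordinates among the blocks. This identifies the
  denominator of \<open>fermat_ratio\<close> with \<open>d ^ r * fact r\<close>.\<close>

lemma sum_dims: "(\<Sum>i\<in>{1..m}. \<Sum>j\<in>{1..k i}. sdim r (W i j)) = r"
proof -
  have "(\<Sum>i\<in>{1..m}. \<Sum>j\<in>{1..k i}. sdim r (W i j)) = (\<Sum>(i, j)\<in>blocks. card (coords r (W i j)))"
    unfolding blocks_def by (subst sum.Sigma[symmetric]) (auto simp: W_dim(1))
  also have "\<dots> = card (\<Union>x\<in>blocks. coords r (W (fst x) (snd x)))"
  proof (subst card_UN_disjoint)
    show "\<forall>x\<in>blocks. \<forall>y\<in>blocks. x \<noteq> y \<longrightarrow> coords r (W (fst x) (snd x)) \<inter> coords r (W (fst y) (snd y)) = {}"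
    proof (intro ballI impI, rule ccontr)
      fix x y assume x: "x \<in> blocks" and y: "y \<in> blocks" and "x \<noteq> y"
        and "coords r (W (fst x) (snd x)) \<inter> coords r (W (fst y) (snd y)) \<noteq> {}"
      then obtain p where "p \<in> coords r (W (fst x) (snd x))" "p \<in> coords r (W (fst y) (snd y))" by blast
      from coords_disjoint[OF _ _ _ _ this] x y \<open>x \<noteq> y\<close> show False
        unfolding blocks_def by (auto simp: mem_Sigma_iff)
    qed
  qed (auto simp: finite_blocks coords_def case_prod_beta)
  also have "(\<Union>x\<in>blocks. coords r (W (fst x) (snd x))) = {..<r}"
    unfolding coords_cover[symmetric] blocks_def by force
  finally show ?thesis by simp
qed

section \<open>The kernel of the permutation action on the blocks, and its projective images\<close>

definition kernel :: "complex mat set" where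
  "kernel = {g \<in> G. \<forall>i\<in>{1..m}. \<forall>j\<in>{1..k i}. translate g (W i j) = W i j}"

lemma kernel_group: "matrix_group r kernel"
proof
  show "kernel \<subseteq> carrier_mat r r" unfolding kernel_def using carrier by auto
  have "translate (1\<^sub>m r) U = U" if "U \<subseteq> carrier_vec r" for U
    unfolding translate_def using that by force
  then show "1\<^sub>m r \<in> kernel" unfolding kernel_def using one W_carrier by auto
  show "g * h \<in> kernel" if "g \<in> kernel" "h \<in> kernel" for g h
    using that mult W_carrier unfolding kernel_def by (auto simp: translate_mult)
  show "\<exists>h\<in>kernel. g * h = 1\<^sub>m r \<and> h * g = 1\<^sub>m r" if "g \<in> kernel" for g
  proof -
    have g: "g \<in> G" "\<And>i j. i \<in> {1..m} \<Longrightarrow> j \<in> {1..k i} \<Longrightarrow> translate g (W i j) = W i j"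
      using that unfolding kernel_def by auto
    have "translate (minv g) (W i j) = W i j" if "i \<in> {1..m}" "j \<in> {1..k i}" for i j
      using translate_minv[OF g(1) W_carrier[OF that]] g(2)[OF that] by simp
    then have "minv g \<in> kernel" unfolding kernel_def using minv(1)[OF g(1)] by simp
    then show ?thesis using minv(2,3)[OF g(1)] by blast
  qed
qed

text \<open>Elements that permute the block indices in the same way differ by an element of the
  kernel, and there are \<open>fact (k i)\<close> permutations for each \<open>i\<close>.\<close>

lemma card_le_kernel:
  assumes "finite kernel"
  shows "finite G" "card G \<le> (\<Prod>i\<in>{1..m}. fact (k i)) * card kernel"
proof -
  have "\<exists>f. \<forall>i\<in>{1..m}. \<forall>j\<in>{1..k i}. f i j \<in> {1..k i} \<and> translate g (W i j) = W i (f i j)" if "g \<in> G" for g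
    using W_perm[OF _ that] by (intro exI[of _ "\<lambda>i j. SOME j'. j' \<in> {1..k i} \<and> translate g (W i j) = W i j'"])
      (metis (mono_tags, lifting) someI)
  then obtain f where f: "\<And>g i j. g \<in> G \<Longrightarrow> i \<in> {1..m} \<Longrightarrow> j \<in> {1..k i} \<Longrightarrow>
      f g i j \<in> {1..k i} \<and> translate g (W i j) = W i (f g i j)"
    by metis
  \<comment> \<open>Extension by the identity outside \<open>{1..k i}\<close> is what
    \<open>permutes\<close> demands.\<close>
  define \<pi> where "\<pi> g = (\<lambda>i\<in>{1..m}. \<lambda>j. if j \<in> {1..k i} then f g i j else j)" for g
  have "\<pi> g \<in> (\<Pi>\<^sub>E i\<in>{1..m}. {p. p permutes {1..k i}})" if g: "g \<in> G" for g
    unfolding \<pi>_def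
  proof (intro restrict_PiE_iff[THEN iffD2] ballI CollectI)
    fix i assume i: "i \<in> {1..m}"
    have "inj_on (f g i) {1..k i}"
    proof (rule inj_onI)
      fix j j' assume j: "j \<in> {1..k i}" "j' \<in> {1..k i}" "f g i j = f g i j'"
      then have "translate g (W i j) = translate g (W i j')" using f[OF g i] by metis
      then have "W i j = W i j'"
        using translate_minv[OF g W_carrier[OF i j(1)]] translate_minv[OF g W_carrier[OF i j(2)]] by metis
      then show "j = j'" using W_inj[OF i j(1,2)] by blast
    qed
    moreover have "f g i ` {1..k i} \<subseteq> {1..k i}" using f[OF g i] by blast
    ultimately have "bij_betw (f g i) {1..k i} {1..k i}"
      by (simp add: bij_betw_def endo_inj_surj)
    then show "(\<lambda>j. if j \<in> {1..k i} then f g i j else j) permutes {1..k i}"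
      using bij_betw_cong[of "{1..k i}" "\<lambda>j. if j \<in> {1..k i} then f g i j else j" "f g i"]
      by (intro bij_imp_permutes) auto
  qed
  then have sub: "\<pi> ` G \<subseteq> (\<Pi>\<^sub>E i\<in>{1..m}. {p. p permutes {1..k i}})" by blast
  have fin: "finite (\<Pi>\<^sub>E i\<in>{1..m}. {p. p permutes {1..k i}})"
    by (intro finite_PiE finite_permutations) auto
  have card_Pi: "card (\<Pi>\<^sub>E i\<in>{1..m}. {p. p permutes {1..k i}}) = (\<Prod>i\<in>{1..m}. fact (k i))"
    by (simp add: card_PiE card_permutations)
  have fibre: "minv g * h \<in> kernel" if g: "g \<in> G" and h: "h \<in> G" and eq: "\<pi> g = \<pi> h" for g h
    unfolding kernel_def
  proof (intro CollectI conjI ballI mult minv(1) g h)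
    fix i j assume ij: "i \<in> {1..m}" "j \<in> {1..k i}"
    have "f g i j = f h i j" using fun_cong[OF fun_cong[OF eq, of i], of j] ij unfolding \<pi>_def by simp
    then have "translate h (W i j) = translate g (W i j)" using f[OF g ij] f[OF h ij] by simp
    then show "translate (minv g * h) (W i j) = W i j"
      using translate_mult[OF minv(1)[OF g] h W_carrier[OF ij]] translate_minv[OF g W_carrier[OF ij]] by simp
  qed
  have "finite (\<pi> ` G)" using sub fin by (rule finite_subset)
  note count = card_le_fibres[OF this assms fibre]
  show "finite G" by (rule count(1))
  show "card G \<le> (\<Prod>i\<in>{1..m}. fact (k i)) * card kernel"
    using count(2) mult_le_mono1[OF card_mono[OF fin sub]] unfolding card_Pi by (rule order_trans)
qed

text \<open>The part of the kernel with trivial projective action on the blocks in \<open>X\<close>.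
  With \<open>X\<close> the blocks outside \<open>V 2\<close> it is the group \<open>N\<close> of
  the overview; with all blocks it consists of diagonal matrices.\<close>

definition scalar_on :: "(nat \<times> nat) set \<Rightarrow> complex mat set" where
  "scalar_on X = {g \<in> kernel. \<forall>(i, j)\<in>X. \<exists>c. \<forall>v\<in>W i j. g *\<^sub>v v = c \<cdot>\<^sub>v v}"

text \<open>Elements with the same tuple of projective actions on the blocks in \<open>X\<close>
  differ by an element acting as a scalar on each of them.\<close>

lemma kernel_le_scalar_on:
  assumes X: "X \<subseteq> blocks" and fin: "finite (scalar_on X)"
    and H: "\<And>i j. (i, j) \<in> X \<Longrightarrow> finite (H_group r G (W i j))"
  shows "finite kernel" "card kernel \<le> (\<Prod>(i, j)\<in>X. card (H_group r G (W i j))) * card (scalar_on X)"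
proof -
  interpret K: matrix_group r kernel by (rule kernel_group)
  let ?f = "\<lambda>g. \<lambda>(i, j)\<in>X. proj_coset (W i j) g"
  have X': "i \<in> {1..m}" "j \<in> {1..k i}" if "(i, j) \<in> X" for i j
    using that X unfolding blocks_def by auto
  have finX: "finite X" using X finite_blocks finite_subset by blast
  have tr: "translate g (W i j) = W i j" if "g \<in> kernel" "(i, j) \<in> X" for g i j
    using that(1) X'[OF that(2)] unfolding kernel_def by auto
  have kG: "g \<in> G" if "g \<in> kernel" for g using that unfolding kernel_def by simp
  have sub: "?f ` kernel \<subseteq> (\<Pi>\<^sub>E x\<in>X. H_group r G (W (fst x) (snd x)))"
  proof (intro image_subsetI restrict_PiE_iff[THEN iffD2] ballI)
    fix g x assume g: "g \<in> kernel" and x: "x \<in> X"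
    have "g \<in> stabilizer G (W (fst x) (snd x))"
      using kG[OF g] tr[OF g, of "fst x" "snd x"] x unfolding stabilizer_def by simp
    then show "(case x of (i, j) \<Rightarrow> proj_coset (W i j) g) \<in> H_group r G (W (fst x) (snd x))"
      unfolding H_group_def proj_image_def case_prod_beta by (rule imageI)
  qed
  have finPi: "finite (\<Pi>\<^sub>E x\<in>X. H_group r G (W (fst x) (snd x)))"
    using H by (intro finite_PiE finX) auto
  have cardPi: "card (\<Pi>\<^sub>E x\<in>X. H_group r G (W (fst x) (snd x))) = (\<Prod>(i, j)\<in>X. card (H_group r G (W i j)))"
    using finX by (simp add: card_PiE case_prod_beta)
  have fibre: "K.minv g * h \<in> scalar_on X" if g: "g \<in> kernel" and h: "h \<in> kernel" and eq: "?f g = ?f h" for g h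
    unfolding scalar_on_def
  proof (intro CollectI conjI ballI K.mult K.minv(1) g h, clarify)
    fix i j assume ij: "(i, j) \<in> X"
    have "proj_coset (W i j) g = proj_coset (W i j) h" using fun_cong[OF eq, of "(i, j)"] ij by simp
    then obtain c where c: "\<And>v. v \<in> W i j \<Longrightarrow> h *\<^sub>v v = c \<cdot>\<^sub>v (g *\<^sub>v v)"
      using proj_coset_eq_iff[OF W_sub[OF X'[OF ij]] kG[OF g] tr[OF g ij] kG[OF h] tr[OF h ij]] by blast
    have "(K.minv g * h) *\<^sub>v v = c \<cdot>\<^sub>v v" if v: "v \<in> W i j" for v
    proof -
      have vc: "v \<in> carrier_vec r" using v W_carrier[OF X'[OF ij]] by blast
      have "(K.minv g * h) *\<^sub>v v = K.minv g *\<^sub>v (c \<cdot>\<^sub>v (g *\<^sub>v v))"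
        using K.mult_vec[OF K.minv(1)[OF g] h vc] c[OF v] by simp
      also have "\<dots> = c \<cdot>\<^sub>v (K.minv g *\<^sub>v (g *\<^sub>v v))"
        using K.in_carrier[OF K.minv(1)[OF g]] g by (intro mult_mat_vec) auto
      finally show ?thesis using K.minv_mult_vec(1)[OF g vc] by simp
    qed
    then show "\<exists>c. \<forall>v\<in>W i j. (K.minv g * h) *\<^sub>v v = c \<cdot>\<^sub>v v" by blast
  qed
  have "finite (?f ` kernel)" using sub finPi by (rule finite_subset)
  note count = K.card_le_fibres[OF this fin fibre]
  show "finite kernel" by (rule count(1))
  show "card kernel \<le> (\<Prod>(i, j)\<in>X. card (H_group r G (W i j))) * card (scalar_on X)"
    using count(2) mult_le_mono1[OF card_mono[OF finPi sub]] unfolding cardPi by (rule order_trans)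
qed

text \<open>Transitivity gives inequalities in both directions. Thus the product of the
  \<open>|H 2 j|\<close> is the power \<open>|H 2 1| ^ k 2\<close> by which the theorem
  divides.\<close>

lemma card_H_group_const:
  assumes fin: "\<And>j. j \<in> {1..k i} \<Longrightarrow> finite (H_group r G (W i j))" and ij: "i \<in> {1..m}" "j \<in> {1..k i}"
  shows "card (H_group r G (W i j)) = card (H_group r G (W i 1))"
proof -
  have "card (H_group r G (W i a)) \<le> card (H_group r G (W i b))" if ab: "a \<in> {1..k i}" "b \<in> {1..k i}" for a b
  proof -
    obtain g where "g \<in> G" "translate g (W i a) = W i b" using W_trans[OF ij(1) ab] by blast
    then show ?thesis
      using W_sub[OF ij(1) ab(1)] W_sub[OF ij(1) ab(2)] fin[OF ab(2)] by (intro card_H_group_translate_le)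
  qed
  then show ?thesis using ij k_pos by (intro antisym) auto
qed

lemma H_group_nonempty:
  assumes "i \<in> {1..m}" "j \<in> {1..k i}"
  shows "H_group r G (W i j) \<noteq> {}"
proof -
  interpret S: matrix_group r "stabilizer G (W i j)" by (rule stabilizer_matrix_group[OF W_sub[OF assms]])
  show ?thesis unfolding H_group_def proj_image_def using S.one by blast
qed

lemma card_H_group_le_JC:
  assumes fin: "finite G" and ij: "i \<in> {1..m}" "j \<in> {1..k i}"
  shows "card (H_group r G (W i j)) \<le> JC (sdim r (W i j))"
proof -
  interpret S: matrix_group r "stabilizer G (W i j)" by (rule stabilizer_matrix_group[OF W_sub[OF ij]])
  obtain E P where fr: "frame r (sdim r (W i j)) (W i j) E P" using W_dim(2)[OF ij] by blast
  have "finite (stabilizer G (W i j))" using fin unfolding stabilizer_def by simp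
  from S.card_proj_image_le_JC[OF this W_sub[OF ij] fr W_dim(3)[OF ij] W_prim[OF ij]]
  show ?thesis unfolding H_group_def .
qed

end

lemma mult_mat_vsum_fixed:
  assumes "finite I" "\<And>i. i \<in> I \<Longrightarrow> u i \<in> carrier_vec n" "A \<in> carrier_mat n n" "\<And>i. i \<in> I \<Longrightarrow> A *\<^sub>v u i = u i"
  shows "A *\<^sub>v vsum n u I = vsum n u I"
  using assms by (subst mult_mat_vsum[of _ _ n _ n]) (auto intro!: vsum_cong)

lemma Aut_eval_at:
  assumes "is_form r d F" "g \<in> Aut r F" "v \<in> carrier_vec r"
  shows "eval_at (g *\<^sub>v v) F = eval_at v F"
proof -
  have "g \<in> carrier_mat r r"
    using assms(2) unfolding Aut_def GL_def units_of_def Units_def by (auto simp: ring_mat_simps)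
  then show ?thesis using eval_at_mat_subst[OF assms(1) _ assms(3)] assms(2) unfolding Aut_def by fastforce
qed

context decomposition
begin

lemma card_blocks: "card blocks = (\<Sum>i\<in>{1..m}. k i)"
  unfolding blocks_def by (subst card_SigmaI) auto

lemma block_of_image: "block_of ` {..<r} = blocks"
proof
  show "block_of ` {..<r} \<subseteq> blocks"
  proof (rule image_subsetI)
    fix p assume "p \<in> {..<r}"
    then have "p < r" by simp
    then show "block_of p \<in> blocks" by (rule block_of) (simp add: blocks_def)
  qed
  show "blocks \<subseteq> block_of ` {..<r}"
  proof
    fix x assume "x \<in> blocks"
    then obtain i j where x: "x = (i, j)" and ij: "i \<in> {1..m}" "j \<in> {1..k i}" unfolding blocks_def by blast
    have "coords r (W i j) \<noteq> {}" using W_dim(1,3)[OF ij] by auto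
    then obtain p where p: "p \<in> coords r (W i j)" by blast
    then have pr: "p < r" unfolding coords_def by simp
    obtain i' j' where b: "block_of p = (i', j')" "i' \<in> {1..m}" "j' \<in> {1..k i'}" "unit_vec r p \<in> W i' j'"
      by (rule block_of[OF pr])
    then have "p \<in> coords r (W i' j')" using pr unfolding coords_def by simp
    then have "(i', j') = (i, j)" using coords_disjoint[OF b(2,3) ij _ p] by blast
    then show "x \<in> block_of ` {..<r}" using b(1) x pr by force
  qed
qed

text \<open>In the compatible basis, acting by a scalar on each block means being diagonal and
  constant on blocks, which is the situation of the eigenvalue system.\<close>

lemma scalar_on_blocks:
  assumes form: "is_form r d F" and "smooth r F" "d \<ge> 3" and Aut: "G \<subseteq> Aut r F"
  shows "finite (scalar_on blocks)" "card (scalar_on blocks) \<le> d ^ card blocks"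
proof -
  have kG: "g \<in> G" if "g \<in> scalar_on blocks" for g using that unfolding scalar_on_def kernel_def by simp
  have diag: "\<exists>\<zeta>. \<forall>p<r. g *\<^sub>v unit_vec r p = \<zeta> (block_of p) \<cdot>\<^sub>v unit_vec r p" if g: "g \<in> scalar_on blocks" for g
  proof -
    have "\<forall>x\<in>blocks. \<exists>c. \<forall>v\<in>W (fst x) (snd x). g *\<^sub>v v = c \<cdot>\<^sub>v v"
      using g unfolding scalar_on_def by (simp add: case_prod_beta)
    then obtain \<zeta> where \<zeta>: "\<And>x v. x \<in> blocks \<Longrightarrow> v \<in> W (fst x) (snd x) \<Longrightarrow> g *\<^sub>v v = \<zeta> x \<cdot>\<^sub>v v" by metis
    have "g *\<^sub>v unit_vec r p = \<zeta> (block_of p) \<cdot>\<^sub>v unit_vec r p" if "p < r" for p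
      by (rule block_of[OF that], rule \<zeta>) (simp_all add: blocks_def)
    then show ?thesis by blast
  qed
  have inv: "eval_at (g *\<^sub>v v) F = eval_at v F" if "g \<in> scalar_on blocks" "v \<in> carrier_vec r" for g v
    using Aut_eval_at[OF form _ that(2)] kG[OF that(1)] Aut by blast
  show "finite (scalar_on blocks)" "card (scalar_on blocks) \<le> d ^ card blocks"
    using card_block_scalar_automorphisms[OF assms(1-3) finite_blocks block_of_image in_carrier[OF kG] inv diag]
    by blast+
qed

text \<open>\<open>X\<close> consists of full rows, and \<open>s\<close> permutes the blocks within
  a row; so the conjugate acts on \<open>W i j\<close> by the scalar of \<open>g\<close> on the
  translate of \<open>W i j\<close> by \<open>s\<close>.\<close>

lemma scalar_on_normal:
  assumes X: "X = (SIGMA i:J. {1..k i})" "J \<subseteq> {1..m}" and g: "g \<in> scalar_on X" and s: "s \<in> G"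
  shows "minv s * g * s \<in> scalar_on X"
proof -
  note [simp] = mult minv(1)
  have gG: "g \<in> G" and tr: "\<And>i j. i \<in> {1..m} \<Longrightarrow> j \<in> {1..k i} \<Longrightarrow> translate g (W i j) = W i j"
    using g unfolding scalar_on_def kernel_def by auto
  have sc: "\<exists>c. \<forall>v\<in>W i j. g *\<^sub>v v = c \<cdot>\<^sub>v v" if "i \<in> J" "j \<in> {1..k i}" for i j
    using g that unfolding scalar_on_def X(1) by blast
  have "minv s * g * s \<in> kernel"
    unfolding kernel_def
  proof (intro CollectI conjI ballI)
    show "minv s * g * s \<in> G" using gG s by simp
    fix i j assume ij: "i \<in> {1..m}" "j \<in> {1..k i}"
    obtain j' where j': "j' \<in> {1..k i}" "translate s (W i j) = W i j'" using W_perm[OF ij(1) s ij(2)] by blast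
    have "translate (minv s * g * s) (W i j) = translate (minv s) (translate g (translate s (W i j)))"
      using s gG W_carrier[OF ij] W_carrier[OF ij(1) j'(1)] j'(2) by (simp add: translate_mult)
    then show "translate (minv s * g * s) (W i j) = W i j"
      using tr[OF ij(1) j'(1)] j'(2) translate_minv[OF s W_carrier[OF ij]] by simp
  qed
  moreover have "\<exists>c. \<forall>v\<in>W i j. (minv s * g * s) *\<^sub>v v = c \<cdot>\<^sub>v v" if i: "i \<in> J" and j: "j \<in> {1..k i}" for i j
  proof -
    have im: "i \<in> {1..m}" using i X(2) by blast
    obtain j' where j': "j' \<in> {1..k i}" "translate s (W i j) = W i j'" using W_perm[OF im s j] by blast
    obtain c where c: "\<And>v. v \<in> W i j' \<Longrightarrow> g *\<^sub>v v = c \<cdot>\<^sub>v v" using sc[OF i j'(1)] by blast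
    have "(minv s * g * s) *\<^sub>v v = c \<cdot>\<^sub>v v" if v: "v \<in> W i j" for v
    proof -
      have vc: "v \<in> carrier_vec r" using v W_carrier[OF im j] by blast
      have "s *\<^sub>v v \<in> W i j'" using j'(2) v unfolding translate_def by blast
      then have "(minv s * g * s) *\<^sub>v v = minv s *\<^sub>v (c \<cdot>\<^sub>v (s *\<^sub>v v))"
        using s gG vc c by (simp add: mult_vec)
      also have "\<dots> = c \<cdot>\<^sub>v (minv s *\<^sub>v (s *\<^sub>v v))"
        using in_carrier[OF minv(1)[OF s]] s by (intro mult_mat_vec) auto
      finally show ?thesis using minv_mult_vec(1)[OF s vc] by simp
    qed
    then show ?thesis by blast
  qed
  ultimately show ?thesis unfolding scalar_on_def X(1) by blast
qed

text \<open>Commutators of elements that are scalar on all blocks outside \<open>V 2\<close> are trivial there, hence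
  trivial. By primitivity, the resulting commutative normal subgroup is also scalar on the
  blocks of \<open>V 2\<close>.\<close>

lemma scalar_on_extend:
  assumes form: "is_form r d F" and Aut: "G \<subseteq> Aut r F" and fin: "finite G" and m: "m \<ge> 2"
    and \<mu>: "\<mu> \<in> Poly_Mapping.keys F" "in_sym_tensor r \<mu> a (family_sum r ({1..m} - {2}) V) 1 (V 2)"
  shows "scalar_on (SIGMA i:{1..m} - {2}. {1..k i}) \<subseteq> scalar_on blocks"
proof
  note [simp] = mult minv(1)
  let ?J = "{1..m} - {2}"
  let ?X = "SIGMA i:?J. {1..k i}"
  let ?V = "family_sum r ?J V"
  have two: "2 \<in> {1..m}" using m by simp
  have inv: "eval_at (g *\<^sub>v v) F = eval_at v F" if "g \<in> G" "v \<in> carrier_vec r" for g v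
    using Aut_eval_at[OF form _ that(2)] that(1) Aut by blast
  have iff: "v \<in> ?V \<longleftrightarrow> (\<exists>u. (\<forall>i\<in>?J. u i \<in> V i) \<and> v = vsum r u ?J)" for v
    using V_sub by (intro family_sum_iff) auto
  have Vsub: "is_subspace r ?V" using V_sub by (intro family_sum_subspace) auto
  have Vc: "v \<in> carrier_vec r" if "i \<in> {1..m}" "v \<in> V i" for i v
    using subspace_carrier[OF V_sub[OF that(1)] that(2)] .
  have stable: "g *\<^sub>v x \<in> ?V" if g: "g \<in> G" and x: "x \<in> ?V" for g x
  proof -
    obtain u where u: "\<forall>i\<in>?J. u i \<in> V i" "x = vsum r u ?J" using x iff by blast
    have "g *\<^sub>v x = vsum r (\<lambda>i. g *\<^sub>v u i) ?J"
      unfolding u(2) using u(1) Vc in_carrier[OF g] by (intro mult_mat_vsum) auto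
    then show ?thesis unfolding iff using u(1) V_stable[OF _ g] by (intro exI[of _ "\<lambda>i. g *\<^sub>v u i"]) auto
  qed
  have XG: "g \<in> G" "g \<in> kernel" if "g \<in> scalar_on ?X" for g
    using that unfolding scalar_on_def kernel_def by auto
  have sc: "\<exists>c. \<forall>v\<in>W i j. g *\<^sub>v v = c \<cdot>\<^sub>v v" if "g \<in> scalar_on ?X" "i \<in> ?J" "j \<in> {1..k i}" for g i j
    using that unfolding scalar_on_def by blast
  have comm: "g *\<^sub>v (h *\<^sub>v y) = h *\<^sub>v (g *\<^sub>v y)"
    if g: "g \<in> scalar_on ?X" and h: "h \<in> scalar_on ?X" and y: "y \<in> V 2" for g h y
  proof -
    have gG: "g \<in> G" and hG: "h \<in> G" using XG g h by auto
    define c where "c = g * h * (minv g * minv h)"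
    have cG: "c \<in> G" unfolding c_def using gG hG by simp
    have c_eq: "c * (h * g) = g * h"
    proof -
      have "c * (h * g) = g * (h * (minv g * (minv h * (h * g))))"
        unfolding c_def using gG hG by (simp add: mult_assoc)
      also have "\<dots> = g * (h * (minv g * g))" using gG hG by simp
      also have "\<dots> = g * h" using gG hG minv(3)[OF gG] in_carrier[OF hG] by simp
      finally show ?thesis .
    qed
    have cW: "c *\<^sub>v w = w" if i: "i \<in> ?J" and j: "j \<in> {1..k i}" and w: "w \<in> W i j" for i j w
    proof -
      have im: "i \<in> {1..m}" using i by simp
      have wc: "w \<in> carrier_vec r" using w W_carrier[OF im j] by blast
      obtain a where a: "\<And>v. v \<in> W i j \<Longrightarrow> g *\<^sub>v v = a \<cdot>\<^sub>v v" using sc[OF g i j] by blast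
      obtain b where b: "\<And>v. v \<in> W i j \<Longrightarrow> h *\<^sub>v v = b \<cdot>\<^sub>v v" using sc[OF h i j] by blast
      have "translate (h * g) (W i j) = W i j"
        using XG(2)[OF g] XG(2)[OF h] im j gG hG W_carrier[OF im j] unfolding kernel_def
        by (simp add: translate_mult)
      \<comment> \<open>Writing \<open>w\<close> as the image of \<open>w'\<close> under
        \<open>h * g\<close> makes the relation \<open>c * (h * g) = g * h\<close> applicable, and
        the two scalars commute.\<close>
      then obtain w' where w': "w' \<in> W i j" "w = (h * g) *\<^sub>v w'" using w unfolding translate_def by blast
      have w'c: "w' \<in> carrier_vec r" using w'(1) W_carrier[OF im j] by blast
      have "a \<cdot>\<^sub>v w' \<in> W i j" "b \<cdot>\<^sub>v w' \<in> W i j" using subspace_smult[OF W_sub[OF im j] w'(1)] by auto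
      then have eq: "g *\<^sub>v (h *\<^sub>v w') = h *\<^sub>v (g *\<^sub>v w')"
        using a b w'(1) by (simp add: smult_smult_assoc mult.commute)
      have "c *\<^sub>v w = (c * (h * g)) *\<^sub>v w'" unfolding w'(2) using cG gG hG w'c by (simp add: mult_vec)
      also have "\<dots> = g *\<^sub>v (h *\<^sub>v w')" unfolding c_eq using gG hG w'c by (simp add: mult_vec)
      also have "\<dots> = w" unfolding eq w'(2) using gG hG w'c by (simp add: mult_vec)
      finally show ?thesis .
    qed
    have cV: "c *\<^sub>v x = x" if i: "i \<in> ?J" and x: "x \<in> V i" for i x
    proof -
      have im: "i \<in> {1..m}" using i by simp
      obtain u where u: "\<forall>j\<in>{1..k i}. u j \<in> W i j" "x = vsum r u {1..k i}"
        using is_direct_sumD(5)[OF W_sum[OF im] x] by blast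
      have "u j \<in> carrier_vec r" "c *\<^sub>v u j = u j" if "j \<in> {1..k i}" for j
        using u(1) cW[OF i that] W_carrier[OF im that] that by blast+
      then show ?thesis
        unfolding u(2) using in_carrier[OF cG] by (intro mult_mat_vsum_fixed) simp_all
    qed
    have cV': "c *\<^sub>v x = x" if x: "x \<in> ?V" for x
    proof -
      obtain u where u: "\<forall>i\<in>?J. u i \<in> V i" "x = vsum r u ?J" using x iff by blast
      show ?thesis
        unfolding u(2) using u(1) cV Vc in_carrier[OF cG] by (intro mult_mat_vsum_fixed) auto
    qed
    \<comment> \<open>The commutator is tested at this vector because
      \<open>c * (h * g) = g * h\<close> then yields commutation of \<open>g\<close> and
      \<open>h\<close> at \<open>y\<close>.\<close>
    have "c *\<^sub>v (h *\<^sub>v (g *\<^sub>v y)) = h *\<^sub>v (g *\<^sub>v y)"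
      by (rule trivial_on_irreducible[OF form inv Vsub stable V_irr[OF two] \<mu> cG cV'
            V_stable[OF two hG V_stable[OF two gG y]]])
    moreover have "c *\<^sub>v (h *\<^sub>v (g *\<^sub>v y)) = (c * (h * g)) *\<^sub>v y"
      using cG gG hG Vc[OF two y] by (simp add: mult_vec)
    moreover have "\<dots> = g *\<^sub>v (h *\<^sub>v y)" unfolding c_eq using gG hG Vc[OF two y] by (simp add: mult_vec)
    ultimately show ?thesis by simp
  qed
  fix g assume g: "g \<in> scalar_on ?X"
  have "\<exists>c. \<forall>v\<in>W 2 j. g *\<^sub>v v = c \<cdot>\<^sub>v v" if j: "j \<in> {1..k 2}" for j
  proof (rule primitive_commuting_scalar[OF W_prim[OF two j], of "scalar_on ?X"])
    have st: "s \<in> G" "translate s (W 2 j) = W 2 j" if "s \<in> stabilizer G (W 2 j)" for s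
      using that unfolding stabilizer_def by auto
    have wc: "v \<in> carrier_vec r" if "v \<in> W 2 j" for v using that W_carrier[OF two j] by blast
    show "s \<in> carrier_mat r r" if "s \<in> stabilizer G (W 2 j)" for s using in_carrier[OF st(1)[OF that]] .
    show "\<exists>t\<in>stabilizer G (W 2 j). \<forall>v\<in>W 2 j. t *\<^sub>v (s *\<^sub>v v) = v \<and> s *\<^sub>v (t *\<^sub>v v) = v"
      if s: "s \<in> stabilizer G (W 2 j)" for s
    proof (intro bexI[of _ "minv s"] ballI conjI)
      show "minv s \<in> stabilizer G (W 2 j)"
        using st[OF s] translate_minv[OF st(1)[OF s] W_carrier[OF two j]] unfolding stabilizer_def by simp
    qed (use minv_mult_vec[OF st(1)[OF s]] wc in auto)
    show "finite (scalar_on ?X)" using fin XG(1) by (meson finite_subset subsetI)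
    show "A \<in> carrier_mat r r" if "A \<in> scalar_on ?X" for A using in_carrier[OF XG(1)[OF that]] .
    show "A *\<^sub>v v \<in> W 2 j" if A: "A \<in> scalar_on ?X" and v: "v \<in> W 2 j" for A v
    proof -
      have "translate A (W 2 j) = W 2 j" using XG(2)[OF A] two j unfolding kernel_def by blast
      then show ?thesis using v unfolding translate_def by blast
    qed
    show "\<exists>n>0. \<forall>v\<in>W 2 j. ((*\<^sub>v) A ^^ n) v = v" if "A \<in> scalar_on ?X" for A
      using finite_order[OF fin XG(1)[OF that]] wc by blast
    show "A *\<^sub>v (B *\<^sub>v v) = B *\<^sub>v (A *\<^sub>v v)" if "A \<in> scalar_on ?X" "B \<in> scalar_on ?X" "v \<in> W 2 j" for A B v
      using comm[OF that(1,2)] W_le_V[OF two j] that(3) by blast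
    show "\<exists>B\<in>scalar_on ?X. \<forall>v\<in>W 2 j. A *\<^sub>v (s *\<^sub>v v) = s *\<^sub>v (B *\<^sub>v v)"
      if s: "s \<in> stabilizer G (W 2 j)" and A: "A \<in> scalar_on ?X" for s A
    proof (intro bexI[of _ "minv s * A * s"] ballI)
      have sG: "s \<in> G" using st(1)[OF s] .
      have AG: "A \<in> G" using XG(1)[OF A] .
      show "minv s * A * s \<in> scalar_on ?X" by (rule scalar_on_normal[OF refl _ A sG]) auto
      fix v assume "v \<in> W 2 j"
      then show "A *\<^sub>v (s *\<^sub>v v) = s *\<^sub>v ((minv s * A * s) *\<^sub>v v)"
        using sG AG wc by (simp add: mult_vec minv_mult_vec)
    qed
  qed (rule g)
  moreover have "\<exists>c. \<forall>v\<in>W i j. g *\<^sub>v v = c \<cdot>\<^sub>v v" if "i \<in> {1..m}" "i \<noteq> 2" "j \<in> {1..k i}" for i j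
    using sc[OF g] that by blast
  ultimately have "\<exists>c. \<forall>v\<in>W i j. g *\<^sub>v v = c \<cdot>\<^sub>v v" if "i \<in> {1..m}" "j \<in> {1..k i}" for i j
    using that by (cases "i = 2") auto
  then show "g \<in> scalar_on blocks" using XG(2)[OF g] unfolding scalar_on_def blocks_def by blast
qed

lemma prod_split_second:
  assumes "m \<ge> 2" "\<And>j. j \<in> {1..k 2} \<Longrightarrow> f 2 j = f 2 1"
  shows "(\<Prod>i\<in>{1..m}. \<Prod>j\<in>{1..k i}. f i j) =
    f 2 1 ^ k 2 * (\<Prod>(i, j)\<in>(SIGMA i:{1..m} - {2}. {1..k i}). f i j :: nat)"
proof -
  have "(\<Prod>i\<in>{1..m}. \<Prod>j\<in>{1..k i}. f i j) = (\<Prod>j\<in>{1..k 2}. f 2 j) * (\<Prod>i\<in>{1..m} - {2}. \<Prod>j\<in>{1..k i}. f i j)"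
    using assms(1) by (intro prod.remove) auto
  also have "(\<Prod>j\<in>{1..k 2}. f 2 j) = (\<Prod>j\<in>{1..k 2}. f 2 1)" using assms(2) by (intro prod.cong) blast+
  also have "(\<Prod>i\<in>{1..m} - {2}. \<Prod>j\<in>{1..k i}. f i j) = (\<Prod>(i, j)\<in>(SIGMA i:{1..m} - {2}. {1..k i}). f i j)"
    by (intro prod.Sigma) auto
  finally show ?thesis by simp
qed

lemma order_bounds:
  assumes form: "is_form r d F" and sm: "smooth r F" and d: "d \<ge> 3" and Aut: "G \<subseteq> Aut r F" and m: "m \<ge> 2"
    and \<mu>: "\<mu> \<in> Poly_Mapping.keys F" "in_sym_tensor r \<mu> a (family_sum r ({1..m} - {2}) V) 1 (V 2)"
  shows "real (card G) \<le> real (canonical_bound r d G m k W) / real (card (H_group r G (W 2 1))) ^ k 2"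
    and "real (canonical_bound r d G m k W) / real (card (H_group r G (W 2 1))) ^ k 2 \<le>
           fermat_ratio (subdegree_sequence r m k W) d * real d ^ r * fact r / real (JC (sdim r (W 2 1))) ^ k 2"
proof -
  let ?h = "\<lambda>i j. card (H_group r G (W i j))" and ?J = "\<lambda>i j. JC (sdim r (W i j))"
  let ?X = "SIGMA i:{1..m} - {2}. {1..k i}" and ?l = "subdegree_sequence r m k W"
  let ?s = "\<Sum>i\<in>{1..m}. k i"
  let ?B = "real (canonical_bound r d G m k W) / real (?h 2 1) ^ k 2"
  let ?R = "fermat_ratio ?l d * real d ^ r * fact r / real (?J 2 1) ^ k 2"
  have two: "2 \<in> {1..m}" using m by simp
  have R0: "?R \<ge> 0" unfolding fermat_ratio_def
    by (intro divide_nonneg_nonneg mult_nonneg_nonneg of_nat_0_le_iff zero_le_power fact_ge_zero)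
  have "real (card G) \<le> ?B \<and> ?B \<le> ?R"
  proof (cases "finite G")
    \<comment> \<open>With all \<open>H i j\<close> finite, the kernel and then \<open>G\<close>
      would be finite. So some \<open>card (H_group ...)\<close> is 0, hence also the canonical
      bound, and \<open>card G\<close> is 0 as well.\<close>
    case False
    have "\<exists>i\<in>{1..m}. \<exists>j\<in>{1..k i}. infinite (H_group r G (W i j))"
    proof (rule ccontr)
      assume "\<not> ?thesis"
      then have "finite kernel"
        using kernel_le_scalar_on(1)[OF order_refl scalar_on_blocks(1)[OF form sm d Aut]]
        unfolding blocks_def by blast
      then show False using card_le_kernel(1) False by blast
    qed
    then obtain i j where ij: "i \<in> {1..m}" "j \<in> {1..k i}" "?h i j = 0" by force
    then have "(\<Prod>j\<in>{1..k i}. ?h i j) = 0" by (intro prod_zero) auto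
    then have "(\<Prod>i\<in>{1..m}. \<Prod>j\<in>{1..k i}. ?h i j) = 0" using ij(1) by (intro prod_zero) auto
    then have "canonical_bound r d G m k W = 0" unfolding canonical_bound_def by simp
    then show ?thesis using False R0 by simp
  next
    case fin: True
    have finH: "finite (H_group r G (W i j))" for i j
      using fin unfolding H_group_def proj_image_def stabilizer_def by simp
    have hpos: "?h 2 1 > 0"
      using finH H_group_nonempty[OF two k_pos[OF two]] by (simp add: card_gt_0_iff)
    have hJ: "?h i j \<le> ?J i j" if "i \<in> {1..m}" "j \<in> {1..k i}" for i j
      using card_H_group_le_JC[OF fin that] .
    have Jpos: "?J 2 1 > 0" using hpos hJ[OF two k_pos[OF two]] by linarith
    let ?P = "\<Prod>(i, j)\<in>?X. ?h i j" and ?Q = "\<Prod>(i, j)\<in>?X. ?J i j" and ?f = "\<Prod>i\<in>{1..m}. fact (k i) :: nat"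
    let ?c = "\<Prod>a\<in>set ?l. fact (count_list ?l a) :: nat"
    have hc: "?h 2 j = ?h 2 1" if "j \<in> {1..k 2}" for j
      using card_H_group_const[OF _ two that] finH by blast
    have split: "(\<Prod>i\<in>{1..m}. \<Prod>j\<in>{1..k i}. ?h i j) = ?h 2 1 ^ k 2 * ?P"
      using m hc by (rule prod_split_second)
    have B: "canonical_bound r d G m k W = ?h 2 1 ^ k 2 * (d ^ ?s * ?P * ?f)"
      unfolding canonical_bound_def split by (simp only: mult_ac)
    \<comment> \<open>The division is an exact cancellation, since \<open>|H 2 1|\<close> is
      positive.\<close>
    then have B': "?B = real (d ^ ?s * ?P * ?f)" using hpos by (simp add: of_nat_mult)
    have const: "sdim r (W i j) = sdim r (W i 1)" if "i \<in> {1..m}" "j \<in> {1..k i}" for i j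
      using W_dim_const[OF that] .
    have "sum_list ?l = (\<Sum>i\<in>{1..m}. \<Sum>j\<in>{1..k i}. sdim r (W i j))"
      unfolding subdegree_sequence_def using const by (rule card_grouped_list(2))
    then have suml: "sum_list ?l = r" using sum_dims by simp
    have len: "length ?l = ?s"
      unfolding subdegree_sequence_def using const by (rule card_grouped_list(1))
    have fc: "?f \<le> ?c"
      unfolding subdegree_sequence_def using const by (rule card_grouped_list(4))
    have "prod_list (map JC ?l) = (\<Prod>i\<in>{1..m}. \<Prod>j\<in>{1..k i}. ?J i j)"
      unfolding subdegree_sequence_def using const by (rule card_grouped_list(3))
    also have "\<dots> = ?J 2 1 ^ k 2 * ?Q"
      using m arg_cong[OF const[OF two], of _ JC] by (rule prod_split_second)
    finally have "prod_list (map JC ?l) = ?J 2 1 ^ k 2 * ?Q" .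
    then have R: "?R = real (d ^ ?s * ?Q * ?c)"
      unfolding fermat_ratio_def len suml using d Jpos by (simp add: field_simps)
    have "?P \<le> ?Q" using hJ by (intro prod_mono) auto
    then have "d ^ ?s * ?P * ?f \<le> d ^ ?s * ?Q * ?c" using fc by (intro mult_le_mono le_refl)
    then have "?B \<le> ?R" unfolding B' R by (simp only: of_nat_le_iff)
    moreover have "card G \<le> d ^ ?s * ?P * ?f"
    proof -
      have sub: "?X \<subseteq> blocks" unfolding blocks_def by auto
      note sb = scalar_on_blocks[OF form sm d Aut]
      \<comment> \<open>The monomial enters here: elements scalar outside \<open>V 2\<close> are
        scalar on all blocks, so the kernel is counted without the factors belonging to
        \<open>V 2\<close>.\<close>
      have ext: "scalar_on ?X \<subseteq> scalar_on blocks" by (rule scalar_on_extend[OF form Aut fin m \<mu>])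
      have "card (scalar_on ?X) \<le> d ^ ?s"
        using card_mono[OF sb(1) ext] sb(2) unfolding card_blocks by linarith
      moreover have "finite (scalar_on ?X)" using ext sb(1) by (rule finite_subset)
      ultimately have "finite kernel" "card kernel \<le> ?P * d ^ ?s"
        using kernel_le_scalar_on[OF sub _ finH] by (auto intro: order_trans mult_le_mono2)
      then have "card G \<le> ?f * (?P * d ^ ?s)"
        using card_le_kernel(2) by (meson order_trans mult_le_mono2)
      then show ?thesis by (simp add: mult_ac)
    qed
    ultimately show ?thesis unfolding B' by (simp only: of_nat_le_iff)
  qed
  then show "real (card G) \<le> ?B" "?B \<le> ?R" by auto
qed

end

theorem lemma5p4:
  fixes r d m :: nat
    and F :: cpoly
    and G :: "complex mat set"
    and V :: "nat \<Rightarrow> complex vec set"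
    and k :: "nat \<Rightarrow> nat"
    and W :: "nat \<Rightarrow> nat \<Rightarrow> complex vec set"
  assumes "r \<ge> 3" and "d \<ge> 3"
    and "is_form r d F" and "smooth r F"
    and "subgroup G (GL r)" and "G \<subseteq> Aut r F"
    and "decomposition_data r G m V k W"
    and "compatible_basis r m k W"
    and "m \<ge> 2"
    and "\<exists>\<mu>\<in>Poly_Mapping.keys F.
           in_sym_tensor r \<mu> (d - 1) (family_sum r ({1..m} - {2}) V) 1 (V 2)"
  shows "real (card G) \<le>
           real (canonical_bound r d G m k W) / real (card (H_group r G (W 2 1))) ^ k 2 \<and>
         real (canonical_bound r d G m k W) / real (card (H_group r G (W 2 1))) ^ k 2 \<le>
           fermat_ratio (subdegree_sequence r m k W) d * real d ^ r * fact r /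
             real (JC (sdim r (W 2 1))) ^ k 2"
proof -
  interpret decomposition r m G V k W using assms(5,7,8) by (rule decomposition.intro)
  show ?thesis using assms(10) order_bounds[OF assms(3,4,2,6,9)] by blast
qed

end
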